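(* Let $(Q,\mathcal{D},g)$ be a sub-Riemannian structure and let $\gamma:[0,T]\to Q$ be a normal sub-Riemannian extremal. Then there exists a number $\varepsilon>0$ such that for every interval $[a,b]\subset[0,T]$ of length smaller than $\varepsilon$ the curve $\gamma|_{[a,b]}:[a,b]\to Q$ is a minimizing sub-Riemannian geodesic. Moreover, $\gamma|_{[a,b]}$ is the unique minimizing sub-Riemannian geodesic (parametrized by $[a,b]$) joining its end-points $\gamma(a)$ and $\gamma(b)$.
   Context: A sub-Riemannian structure $(Q,\mathcal{D},g)$ consists of a smooth $n$-dimensional manifold $Q$, a smooth distribution $\mathcal{D}\subset TQ$ of constant rank $k$, and a smooth positive definite symmetric bilinear product $g$ on the fibres of $\mathcal{D}$. No bracket-generating assumption is made. A curve is ACB if it is absolutely continuous and its derivative (defined a.e.) is essentially bounded. An ACB curve $\gamma$ is tangent to $\mathcal{D}$ if $\dot\gamma(t)\in\mathcal{D}_{\gamma(t)}$ for a.e. $t$. The energy of an ACB curve $\gamma:[a,b]\to Q$ tangent to $\mathcal{D}$ is $\mathcal{E}(\gamma)=\frac12\int_a^b g(\dot\gamma(t),\dot\gamma(t))\,dt$. A minimizing sub-Riemannian geodesic on $[a,b]$ is an ACB curve $\gamma:[a,b]\to Q$ tangent to $\mathcal{D}$ which realizes the minimum of $\mathcal{E}$ among all ACB curves $[a,b]\to Q$ tangent to $\mathcal{D}$ and having the same initial point $\gamma(a)$ and the same end-point $\gamma(b)$. A normal sub-Riemannian extremal is a normal extremal in the sense of the Pontryagin Maximum Principle: an ACB curve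 $\gamma:[0,T]\to Q$ tangent to $\mathcal{D}$ which is the projection to $Q$ of an integral curve of the Hamiltonian vector field on $T^*Q$ of the function $H$ given locally by $H(q,p)=\frac12\sum_{i=1}^k\langle p,X_i(q)\rangle^2$, where $X_1,\dots,X_k$ is any local $g$-orthonormal frame of $\mathcal{D}$ ($H$ does not depend on the choice of the frame). Known characterization (a cited result): let $X_1,\dots,X_k$ be a $g$-orthonormal frame of $\mathcal{D}$ (working locally), let $\gamma:[0,T]\to Q$ satisfy $\dot\gamma(t)=\sum_i u^i(t)X_i(\gamma(t))$ a.e. with $u$ bounded measurable and $\sum_i u^i(t)^2\equiv1$, and let $F_{t\tau}$ be the flow from time $\tau$ to time $t$ of the time-dependent vector field $\sum_i u^i(t)X_i$. Then $\gamma$ is a normal sub-Riemannian extremal if and only if $t\mapsto\dot\gamma(t)$ is ACB and, for every $t\in[0,T]$, $\dot\gamma(t)$ does not belong to the linear span of $\{TF_{t\tau}(Y) : \tau\in[0,T],\ Y\in\mathcal{D}_{\gamma(\tau)},\ g(Y,\dot\gamma(\tau))=0\}$. *)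

theory Defs
  imports "HOL-Analysis.Analysis"
begin

section \<open>Smooth maps between open subsets of Euclidean spaces\<close>

text \<open>On an open set \<^term>\<open>S\<close>, \<open>Ck_on n S f\<close> says that all iterated directional
  derivatives of \<open>f\<close> up to order \<open>n\<close> exist and are continuous, i.e. \<open>f\<close> is of class \<open>C\<^sup>n\<close>.\<close>

primrec Ck_on :: "nat \<Rightarrow> 'a::real_normed_vector set \<Rightarrow> ('a \<Rightarrow> 'b::real_normed_vector) \<Rightarrow> bool" where
  "Ck_on 0 S f \<longleftrightarrow> continuous_on S f"
| "Ck_on (Suc n) S f \<longleftrightarrow>
     (\<forall>x\<in>S. f differentiable (at x)) \<and> (\<forall>v. Ck_on n S (\<lambda>x. frechet_derivative f (at x) v))"

definition smooth_on :: "'a::real_normed_vector set \<Rightarrow> ('a \<Rightarrow> 'b::real_normed_vector) \<Rightarrow> bool" where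
  "smooth_on S f \<longleftrightarrow> (\<forall>n. Ck_on n S f)"


section \<open>Smooth manifolds\<close>

text \<open>The manifold is a whole Hausdorff, second countable type \<open>'q\<close>, of dimension \<open>CARD('n)\<close>;
  its smooth structure is given by an atlas \<open>A\<close> (not necessarily maximal). A chart is a
  coordinate domain with a coordinate map; only the values of that map on the domain matter.\<close>

type_synonym ('q, 'n) chart = "'q set \<times> ('q \<Rightarrow> real ^ 'n)"

abbreviation chdom :: "('q, 'n) chart \<Rightarrow> 'q set" where
  "chdom c \<equiv> fst c"

abbreviation chmap :: "('q, 'n) chart \<Rightarrow> 'q \<Rightarrow> real ^ 'n" where
  "chmap c \<equiv> snd c"

abbreviation chinv :: "('q, 'n) chart \<Rightarrow> real ^ 'n \<Rightarrow> 'q" where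
  "chinv c \<equiv> inv_into (chdom c) (chmap c)"

definition transition :: "('q, 'n) chart \<Rightarrow> ('q, 'n) chart \<Rightarrow> real ^ 'n \<Rightarrow> real ^ 'n" where
  "transition c c' = chmap c' \<circ> chinv c"

definition is_chart :: "('q::topological_space, 'n::finite) chart \<Rightarrow> bool" where
  "is_chart c \<longleftrightarrow> open (chdom c) \<and> open (chmap c ` chdom c) \<and>
     homeomorphism (chdom c) (chmap c ` chdom c) (chmap c) (chinv c)"

definition smooth_atlas :: "('q::{t2_space, second_countable_topology}, 'n::finite) chart set \<Rightarrow> bool" where
  "smooth_atlas A \<longleftrightarrow> (\<forall>c\<in>A. is_chart c) \<and> (\<Union>c\<in>A. chdom c) = UNIV \<and>
     (\<forall>c\<in>A. \<forall>c'\<in>A. smooth_on (chmap c ` (chdom c \<inter> chdom c')) (transition c c'))"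

definition smooth_fun_on :: "('q, 'n::finite) chart set \<Rightarrow> 'q set \<Rightarrow> ('q \<Rightarrow> real) \<Rightarrow> bool" where
  "smooth_fun_on A V f \<longleftrightarrow> (\<forall>c\<in>A. smooth_on (chmap c ` (chdom c \<inter> V)) (f \<circ> chinv c))"


section \<open>Tangent vectors\<close>

text \<open>A tangent vector is the family of its components in all the charts of the atlas around its
  base point, related by the Jacobians of the coordinate changes. The components in the other
  charts are fixed to be \<open>0\<close>, so that a vector at a given point is determined by its components.
  Families are wrapped in a type of their own in order to be a real vector space.\<close>

typedef ('q, 'n) tvec = "UNIV :: (('q, 'n) chart \<Rightarrow> real ^ 'n) set"
  morphisms comps Tvec ..

lemma comps_Tvec [simp]: "comps (Tvec f) = f"
  by (simp add: Tvec_inverse)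

lemma tvec_eq_iff: "v = w \<longleftrightarrow> (\<forall>c. comps v c = comps w c)"
  by (metis comps_inject ext)

instantiation tvec :: (type, finite) real_vector
begin

definition "0 = Tvec (\<lambda>c. 0)"
definition "v + w = Tvec (\<lambda>c. comps v c + comps w c)"
definition "- v = Tvec (\<lambda>c. - comps v c)"
definition "v - w = Tvec (\<lambda>c. comps v c - comps w c)"
definition "r *\<^sub>R v = Tvec (\<lambda>c. r *\<^sub>R comps v c)"

instance
  by standard
    (simp_all add: zero_tvec_def plus_tvec_def uminus_tvec_def minus_tvec_def scaleR_tvec_def
      tvec_eq_iff scaleR_add_right scaleR_add_left)

end

definition tangent_space :: "('q, 'n::finite) chart set \<Rightarrow> 'q \<Rightarrow> ('q, 'n) tvec set" where
  "tangent_space A q = {v.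
     (\<forall>c. \<not> (c \<in> A \<and> q \<in> chdom c) \<longrightarrow> comps v c = 0) \<and>
     (\<forall>c\<in>A. \<forall>c'\<in>A. q \<in> chdom c \<inter> chdom c' \<longrightarrow>
        comps v c' = frechet_derivative (transition c c') (at (chmap c q)) (comps v c))}"

definition tvec_at :: "('q, 'n::finite) chart set \<Rightarrow> ('q, 'n) chart \<Rightarrow> 'q \<Rightarrow> real ^ 'n \<Rightarrow> ('q, 'n) tvec" where
  \<comment> \<open>the tangent vector at \<open>q\<close> whose components in the chart \<open>c\<close> are \<open>w\<close>\<close>
  "tvec_at A c q w = Tvec (\<lambda>c'. if c' \<in> A \<and> q \<in> chdom c'
     then frechet_derivative (transition c c') (at (chmap c q)) w else 0)"

definition velocity :: "('q, 'n::finite) chart set \<Rightarrow> (real \<Rightarrow> 'q) \<Rightarrow> real \<Rightarrow> ('q, 'n) tvec" where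
  "velocity A \<gamma> t = Tvec (\<lambda>c. if c \<in> A \<and> \<gamma> t \<in> chdom c
     then vector_derivative (chmap c \<circ> \<gamma>) (at t) else 0)"

definition smooth_vector_field_on ::
  "('q, 'n::finite) chart set \<Rightarrow> 'q set \<Rightarrow> ('q \<Rightarrow> ('q, 'n) tvec) \<Rightarrow> bool" where
  "smooth_vector_field_on A V X \<longleftrightarrow> (\<forall>q\<in>V. X q \<in> tangent_space A q) \<and>
     (\<forall>c\<in>A. smooth_on (chmap c ` (chdom c \<inter> V)) (\<lambda>x. comps (X (chinv c x)) c))"


section \<open>Sub-Riemannian structures\<close>

definition smooth_distribution ::
  "('q::topological_space, 'n::finite) chart set \<Rightarrow> nat \<Rightarrow> ('q \<Rightarrow> ('q, 'n) tvec set) \<Rightarrow> bool" where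
  "smooth_distribution A k D \<longleftrightarrow>
     (\<forall>q. D q \<subseteq> tangent_space A q \<and> subspace (D q) \<and> dim (D q) = k) \<and>
     (\<forall>q. \<exists>V X. open V \<and> q \<in> V \<and> (\<forall>i<k. smooth_vector_field_on A V (X i)) \<and>
        (\<forall>q'\<in>V. D q' = span {X i q' | i. i < k}))"

definition inner_product_on :: "'v::real_vector set \<Rightarrow> ('v \<Rightarrow> 'v \<Rightarrow> real) \<Rightarrow> bool" where
  "inner_product_on E b \<longleftrightarrow>
     (\<forall>u\<in>E. \<forall>v\<in>E. b u v = b v u) \<and>
     (\<forall>u\<in>E. \<forall>v\<in>E. \<forall>w\<in>E. b (u + v) w = b u w + b v w) \<and>
     (\<forall>r. \<forall>u\<in>E. \<forall>v\<in>E. b (r *\<^sub>R u) v = r * b u v) \<and>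
     (\<forall>u\<in>E. u \<noteq> 0 \<longrightarrow> b u u > 0)"

definition smooth_metric_on_distribution ::
  "('q::topological_space, 'n::finite) chart set \<Rightarrow> ('q \<Rightarrow> ('q, 'n) tvec set) \<Rightarrow>
    ('q \<Rightarrow> ('q, 'n) tvec \<Rightarrow> ('q, 'n) tvec \<Rightarrow> real) \<Rightarrow> bool" where
  "smooth_metric_on_distribution A D g \<longleftrightarrow>
     (\<forall>q. inner_product_on (D q) (g q)) \<and>
     (\<forall>V X Y. open V \<and> smooth_vector_field_on A V X \<and> smooth_vector_field_on A V Y \<and>
        (\<forall>q\<in>V. X q \<in> D q \<and> Y q \<in> D q) \<longrightarrow> smooth_fun_on A V (\<lambda>q. g q (X q) (Y q)))"

definition subriemannian_structure ::
  "('q::{t2_space, second_countable_topology}, 'n::finite) chart set \<Rightarrow> nat \<Rightarrow>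
    ('q \<Rightarrow> ('q, 'n) tvec set) \<Rightarrow> ('q \<Rightarrow> ('q, 'n) tvec \<Rightarrow> ('q, 'n) tvec \<Rightarrow> real) \<Rightarrow> bool" where
  "subriemannian_structure A k D g \<longleftrightarrow>
     smooth_atlas A \<and> smooth_distribution A k D \<and> smooth_metric_on_distribution A D g"


section \<open>ACB curves, energy, minimizing geodesics\<close>

text \<open>Absolute continuity: finite families of non-overlapping compact subintervals of \<open>[a,b]\<close> are
  expressed as divisions of subsets of \<open>[a,b]\<close>.\<close>

definition abs_cont_on :: "real \<Rightarrow> real \<Rightarrow> (real \<Rightarrow> 'v::real_normed_vector) \<Rightarrow> bool" where
  "abs_cont_on a b f \<longleftrightarrow> (\<forall>\<epsilon>>0. \<exists>\<delta>>0. \<forall>d S. d division_of S \<and> S \<subseteq> {a..b} \<and>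
     (\<Sum>K\<in>d. Sup K - Inf K) < \<delta> \<longrightarrow> (\<Sum>K\<in>d. norm (f (Sup K) - f (Inf K))) < \<epsilon>)"

definition ACB_vec :: "real \<Rightarrow> real \<Rightarrow> (real \<Rightarrow> 'v::real_normed_vector) \<Rightarrow> bool" where
  "ACB_vec a b f \<longleftrightarrow> abs_cont_on a b f \<and>
     (\<exists>B. AE t in lebesgue_on {a..b}.
        \<exists>f'. (f has_vector_derivative f') (at t within {a..b}) \<and> norm f' \<le> B)"

text \<open>Curves are total functions of which only the restriction to the interval in question matters.
  Being ACB is tested in charts, on the compact subintervals mapped into a chart domain; on those
  the boundedness of the derivative does not depend on the chart.\<close>

definition ACB :: "('q::topological_space, 'n::finite) chart set \<Rightarrow> real \<Rightarrow> real \<Rightarrow> (real \<Rightarrow> 'q) \<Rightarrow> bool" where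
  "ACB A a b \<gamma> \<longleftrightarrow> continuous_on {a..b} \<gamma> \<and>
     (\<forall>c\<in>A. \<forall>s t. a \<le> s \<and> s \<le> t \<and> t \<le> b \<and> \<gamma> ` {s..t} \<subseteq> chdom c \<longrightarrow> ACB_vec s t (chmap c \<circ> \<gamma>))"

definition ACB_tangent ::
  "('q::topological_space, 'n::finite) chart set \<Rightarrow> ('q \<Rightarrow> ('q, 'n) tvec set) \<Rightarrow>
    real \<Rightarrow> real \<Rightarrow> (real \<Rightarrow> 'q) \<Rightarrow> bool" where
  "ACB_tangent A D a b \<gamma> \<longleftrightarrow> ACB A a b \<gamma> \<and>
     (AE t in lebesgue_on {a..b}. velocity A \<gamma> t \<in> D (\<gamma> t))"

definition energy ::
  "('q, 'n::finite) chart set \<Rightarrow> ('q \<Rightarrow> ('q, 'n) tvec \<Rightarrow> ('q, 'n) tvec \<Rightarrow> real) \<Rightarrow>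
    real \<Rightarrow> real \<Rightarrow> (real \<Rightarrow> 'q) \<Rightarrow> real" where
  "energy A g a b \<gamma> = 1 / 2 * integral {a..b} (\<lambda>t. g (\<gamma> t) (velocity A \<gamma> t) (velocity A \<gamma> t))"

definition minimizing_geodesic ::
  "('q::topological_space, 'n::finite) chart set \<Rightarrow> ('q \<Rightarrow> ('q, 'n) tvec set) \<Rightarrow>
    ('q \<Rightarrow> ('q, 'n) tvec \<Rightarrow> ('q, 'n) tvec \<Rightarrow> real) \<Rightarrow> real \<Rightarrow> real \<Rightarrow> (real \<Rightarrow> 'q) \<Rightarrow> bool" where
  "minimizing_geodesic A D g a b \<gamma> \<longleftrightarrow> ACB_tangent A D a b \<gamma> \<and>
     (\<forall>\<eta>. ACB_tangent A D a b \<eta> \<and> \<eta> a = \<gamma> a \<and> \<eta> b = \<gamma> b \<longrightarrow>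
        energy A g a b \<gamma> \<le> energy A g a b \<eta>)"


section \<open>Normal extremals\<close>

definition cotangent_space ::
  "('q, 'n::finite) chart set \<Rightarrow> 'q \<Rightarrow> (('q, 'n) tvec \<Rightarrow> real) set" where
  "cotangent_space A q = {p.
     (\<forall>u\<in>tangent_space A q. \<forall>v\<in>tangent_space A q. p (u + v) = p u + p v) \<and>
     (\<forall>r. \<forall>u\<in>tangent_space A q. p (r *\<^sub>R u) = r * p u) \<and>
     (\<forall>u. u \<notin> tangent_space A q \<longrightarrow> p u = 0)}"

definition orthonormal_frame_on ::
  "('q::topological_space, 'n::finite) chart set \<Rightarrow> nat \<Rightarrow> ('q \<Rightarrow> ('q, 'n) tvec set) \<Rightarrow>
    ('q \<Rightarrow> ('q, 'n) tvec \<Rightarrow> ('q, 'n) tvec \<Rightarrow> real) \<Rightarrow> 'q set \<Rightarrow> (nat \<Rightarrow> 'q \<Rightarrow> ('q, 'n) tvec) \<Rightarrow> bool" where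
  \<comment> \<open>as \<open>D\<close> has rank \<open>k\<close>, the \<open>k\<close> orthonormal sections below form a basis at each point\<close>
  "orthonormal_frame_on A k D g V X \<longleftrightarrow> open V \<and>
     (\<forall>i<k. smooth_vector_field_on A V (X i) \<and> (\<forall>q\<in>V. X i q \<in> D q)) \<and>
     (\<forall>q\<in>V. \<forall>i<k. \<forall>j<k. g q (X i q) (X j q) = (if i = j then 1 else 0))"

definition sR_hamiltonian ::
  "('q::topological_space, 'n::finite) chart set \<Rightarrow> nat \<Rightarrow> ('q \<Rightarrow> ('q, 'n) tvec set) \<Rightarrow>
    ('q \<Rightarrow> ('q, 'n) tvec \<Rightarrow> ('q, 'n) tvec \<Rightarrow> real) \<Rightarrow> 'q \<Rightarrow> (('q, 'n) tvec \<Rightarrow> real) \<Rightarrow> real" where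
  "sR_hamiltonian A k D g q p = (THE h. \<exists>V X. orthonormal_frame_on A k D g V X \<and> q \<in> V \<and>
     h = 1 / 2 * (\<Sum>i<k. (p (X i q))\<^sup>2))"

text \<open>Canonical coordinates \<open>(x, \<xi>)\<close> on the cotangent bundle over a chart domain: \<open>x\<close> are the
  coordinates of the base point, and \<open>\<xi>\<close> those of the covector with respect to the basis dual to
  the coordinate vector fields.\<close>

definition covec_coords ::
  "('q, 'n::finite) chart set \<Rightarrow> ('q, 'n) chart \<Rightarrow> 'q \<Rightarrow> (('q, 'n) tvec \<Rightarrow> real) \<Rightarrow> real ^ 'n" where
  "covec_coords A c q p = (\<chi> i. p (tvec_at A c q (axis i 1)))"

definition covec_at ::
  "('q, 'n::finite) chart set \<Rightarrow> ('q, 'n) chart \<Rightarrow> 'q \<Rightarrow> real ^ 'n \<Rightarrow> ('q, 'n) tvec \<Rightarrow> real" where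
  "covec_at A c q \<xi> = (\<lambda>v. if v \<in> tangent_space A q then \<xi> \<bullet> comps v c else 0)"

definition in_canonical_coords ::
  "('q, 'n::finite) chart set \<Rightarrow> ('q, 'n) chart \<Rightarrow> ('q \<Rightarrow> (('q, 'n) tvec \<Rightarrow> real) \<Rightarrow> real) \<Rightarrow>
    (real ^ 'n) \<times> (real ^ 'n) \<Rightarrow> real" where
  "in_canonical_coords A c H = (\<lambda>(x, \<xi>). H (chinv c x) (covec_at A c (chinv c x) \<xi>))"

text \<open>The canonical symplectic form \<open>\<Sum>\<^sub>i dx\<^sup>i \<and> d\<xi>\<^sub>i\<close>.\<close>

definition symplectic_form :: "'e::real_inner \<times> 'e \<Rightarrow> 'e \<times> 'e \<Rightarrow> real" where
  "symplectic_form = (\<lambda>(v, \<omega>) (v', \<omega>'). v \<bullet> \<omega>' - \<omega> \<bullet> v')"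

text \<open>The curve \<open>t \<mapsto> (\<gamma> t, p t)\<close> in the cotangent bundle is an integral curve on \<open>[a,b]\<close> of the
  Hamiltonian vector field \<open>Z\<close> of \<open>H\<close>, which is determined by \<open>symplectic_form Z = dH\<close>. In
  components \<open>Z = (\<partial>H/\<partial>\<xi>, - \<partial>H/\<partial>x)\<close>.\<close>

definition hamiltonian_integral_curve ::
  "('q::topological_space, 'n::finite) chart set \<Rightarrow> ('q \<Rightarrow> (('q, 'n) tvec \<Rightarrow> real) \<Rightarrow> real) \<Rightarrow>
    real \<Rightarrow> real \<Rightarrow> (real \<Rightarrow> 'q) \<Rightarrow> (real \<Rightarrow> ('q, 'n) tvec \<Rightarrow> real) \<Rightarrow> bool" where
  "hamiltonian_integral_curve A H a b \<gamma> p \<longleftrightarrow>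
     continuous_on {a..b} \<gamma> \<and>
     (\<forall>t\<in>{a..b}. p t \<in> cotangent_space A (\<gamma> t)) \<and>
     (\<forall>t\<in>{a..b}. \<forall>c\<in>A. \<gamma> t \<in> chdom c \<longrightarrow>
        (let z = (\<lambda>s. (chmap c (\<gamma> s), covec_coords A c (\<gamma> s) (p s))) in
         \<exists>Z. (in_canonical_coords A c H has_derivative symplectic_form Z) (at (z t)) \<and>
             (z has_vector_derivative Z) (at t within {a..b})))"

definition normal_extremal ::
  "('q::topological_space, 'n::finite) chart set \<Rightarrow> nat \<Rightarrow> ('q \<Rightarrow> ('q, 'n) tvec set) \<Rightarrow>
    ('q \<Rightarrow> ('q, 'n) tvec \<Rightarrow> ('q, 'n) tvec \<Rightarrow> real) \<Rightarrow> real \<Rightarrow> (real \<Rightarrow> 'q) \<Rightarrow> bool" where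
  "normal_extremal A k D g T \<gamma> \<longleftrightarrow> ACB_tangent A D 0 T \<gamma> \<and>
     (\<exists>p. hamiltonian_integral_curve A (sR_hamiltonian A k D g) 0 T \<gamma> p)"

end

theory Submission
  imports Defs
begin
text \<open>In a chart with orthonormal frame \<open>W\<^sub>i\<close>, a normal extremal \<open>x\<close> with covector \<open>\<xi>\<close> is calibrated by an
  explicit function, so that no Hamilton-Jacobi equation has to be solved. For a competitor \<open>y\<close> with the same
  end-points put \<open>e = y - x\<close> and \<open>\<phi>(t) = \<xi> \<bullet> e - \<lambda>/2 (t - a) \<bar>e\<bar>\<^sup>2\<close>, which vanishes at both ends. The Hamilton
  equations, a second order Taylor estimate of \<open>H\<close> and the Fenchel inequality for the covector
  \<open>q = \<xi> - \<lambda>(t - a) e\<close> give \<open>\<phi>' \<le> 1/2 g(y', y') - 1/2 g(x', x') - \<bar>e\<bar>\<^sup>2\<close> for \<open>\<lambda>\<close> large and \<open>\<lambda>(b - a) \<le> 1\<close>.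
  Integrating yields minimality and uniqueness at once. Competitors that leave the chart are excluded, for
  \<open>b - a\<close> small, because they spend too much energy before their first exit. Compactness of \<open>[0,T]\<close> makes the
  bound on \<open>b - a\<close> uniform.\<close>

section \<open>Calculus of \<open>Ck_on\<close>\<close>

text \<open>Classically a solution S of the Hamilton-Jacobi equation with dS = \<xi> along the
  extremal calibrates it. A differential inequality suffices, and it only has to be controlled to
  second order in the displacement e. The affine function z \<mapsto> \<xi> \<bullet> (z - x)
  already does this to first order: Hamilton's equations cancel all terms linear in e and leave a
  quadratic defect of unknown sign. The time derivative of the added term contributes -\<lambda>/2
  |e|^2, which outweighs that defect. Its factor t - a avoids a circular choice of constants: as
  long as \<lambda>(b - a) \<le> 1 the gradient q departs from \<xi> by at most |e|, so the Taylor
  constant is fixed before \<lambda> is chosen in terms of it. Only an upper estimate of H enters,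
  so the degeneracy of H in the covector does no harm. The technical obstacle is the weak regularity
  of competitors: they are differentiable only almost everywhere. Integrating \<phi>' therefore
  rests on the fundamental theorem of calculus for absolutely continuous functions, and the frame
  coefficients of a competitor must be shown to have integrable squares.\<close>

lemma Ck_on_cong:
  assumes "open S" "\<And>x. x \<in> S \<Longrightarrow> f x = h x" "Ck_on n S f"
  shows "Ck_on n S h"
  using assms(2,3)
proof (induction n arbitrary: f h)
  case 0
  then show ?case by (simp cong: continuous_on_cong)
next
  case (Suc n)
  have der: "(h has_derivative F) (at x)" if "x \<in> S" "(f has_derivative F) (at x)" for x F
    using has_derivative_transform_within_open[OF that(2) assms(1) that(1)] Suc.prems(1) by blast
  have "h differentiable (at x)" if "x \<in> S" for x
    using Suc.prems(2) that der[OF that] unfolding Ck_on.simps differentiable_def by metis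
  moreover have "frechet_derivative f (at x) = frechet_derivative h (at x)" if "x \<in> S" for x
    using Suc.prems(2) that der[OF that]
    by (metis Ck_on.simps(2) frechet_derivative_at frechet_derivative_works)
  ultimately show ?case
    using Suc.prems(2) Suc.IH[of "\<lambda>x. frechet_derivative f (at x) v" "\<lambda>x. frechet_derivative h (at x) v" for v]
    by simp
qed

lemma Ck_on_continuous_on: "Ck_on n S f \<Longrightarrow> continuous_on S f"
  by (cases n) (auto intro!: continuous_at_imp_continuous_on differentiable_imp_continuous_within)

lemma Ck_on_SucD: "Ck_on (Suc n) S f \<Longrightarrow> Ck_on n S f"
proof (induction n arbitrary: f)
  case 0
  then show ?case using Ck_on_continuous_on by fastforce
next
  case (Suc n)
  then show ?case by (metis Ck_on.simps(2))
qed

text \<open>\<open>frechet_derivative\<close> is a choice of derivative. By uniqueness an explicitly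
  computed \<open>F\<close> may replace it, which is how the closure properties below are
  proved.\<close>

lemma Ck_on_SucI:
  assumes "open S" and der: "\<And>x. x \<in> S \<Longrightarrow> (f has_derivative F x) (at x)"
    and "\<And>v. Ck_on n S (\<lambda>x. F x v)"
  shows "Ck_on (Suc n) S f"
proof -
  have "frechet_derivative f (at x) = F x" if "x \<in> S" for x
    using frechet_derivative_at[OF der[OF that]] by simp
  then show ?thesis
    using assms by (auto simp: differentiable_def intro: Ck_on_cong[OF assms(1) _ assms(3)])
qed

lemma Ck_on_SucD_has_derivative:
  "Ck_on (Suc n) S f \<Longrightarrow> x \<in> S \<Longrightarrow> (f has_derivative frechet_derivative f (at x)) (at x)"
  by (simp add: frechet_derivative_works)

lemma Ck_on_const: "open S \<Longrightarrow> Ck_on n S (\<lambda>x. c)"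
proof (induction n arbitrary: c)
  case (Suc n)
  show ?case
    by (rule Ck_on_SucI[where F = "\<lambda>_ _. 0"]) (auto simp: Suc)
qed simp

lemma Ck_on_add:
  assumes "open S" "Ck_on n S f" "Ck_on n S h"
  shows "Ck_on n S (\<lambda>x. f x + h x)"
  using assms(2,3)
proof (induction n arbitrary: f h)
  case 0
  then show ?case by (simp add: continuous_on_add)
next
  case (Suc n)
  show ?case
  proof (rule Ck_on_SucI[OF assms(1)])
    show "((\<lambda>x. f x + h x) has_derivative
        (\<lambda>v. frechet_derivative f (at x) v + frechet_derivative h (at x) v)) (at x)" if "x \<in> S" for x
      by (intro has_derivative_add Ck_on_SucD_has_derivative[OF _ that]) (use Suc.prems in auto)
  qed (use Suc in auto)
qed

text \<open>By Leibniz's rule the derivative is again a sum of products, so the induction closes.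
  One proof serves scalar multiples of vector fields and products of functions.\<close>

lemma (in bounded_bilinear) Ck_on:
  assumes "open S" "Ck_on n S f" "Ck_on n S h"
  shows "Ck_on n S (\<lambda>x. prod (f x) (h x))"
  using assms(2,3)
proof (induction n arbitrary: f h)
  case 0
  then show ?case by (simp add: continuous_on)
next
  case (Suc n)
  show ?case
  proof (rule Ck_on_SucI[OF assms(1)])
    show "((\<lambda>x. prod (f x) (h x)) has_derivative
        (\<lambda>v. prod (f x) (frechet_derivative h (at x) v) + prod (frechet_derivative f (at x) v) (h x))) (at x)"
      if "x \<in> S" for x
      by (intro FDERIV Ck_on_SucD_has_derivative[OF _ that]) (use Suc.prems in auto)
    show "Ck_on n S (\<lambda>x. prod (f x) (frechet_derivative h (at x) v) + prod (frechet_derivative f (at x) v) (h x))" for v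
      by (intro Ck_on_add Suc.IH assms Ck_on_SucD[of n S f] Ck_on_SucD[of n S h]) (use Suc.prems in auto)
  qed
qed

text \<open>With r = f^(-1/2) the derivative is -1/2 r^3 f'. It is a product of r itself and f', so
  the induction hypothesis for r together with the product rule suffices and no chain rule for
  \<open>Ck_on\<close> has to be set up.\<close>

lemma Ck_on_inverse_sqrt:
  fixes f :: "'a::real_normed_vector \<Rightarrow> real"
  assumes "open S" "Ck_on n S f" "\<And>x. x \<in> S \<Longrightarrow> f x > 0"
  shows "Ck_on n S (\<lambda>x. inverse (sqrt (f x)))"
  using assms(2)
proof (induction n)
  case 0
  show ?case using 0 assms(3) by (auto intro!: continuous_intros) (metis less_irrefl)
next
  case (Suc n)
  define r where "r x = inverse (sqrt (f x))" for x
  show ?case unfolding r_def[symmetric]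
  proof (rule Ck_on_SucI[OF assms(1)])
    fix x assume x: "x \<in> S"
    have f: "(f has_derivative frechet_derivative f (at x)) (at x)"
      using Ck_on_SucD_has_derivative[OF Suc.prems x] .
    have "((\<lambda>y. inverse (sqrt y)) has_real_derivative - (1/2) * (r x * r x * r x)) (at (f x))"
      using assms(3)[OF x] unfolding r_def
      by (auto intro!: derivative_eq_intros simp: field_simps power2_eq_square)
    from has_derivative_compose[OF f this[unfolded has_field_derivative_def]]
    show "(r has_derivative (\<lambda>v. - (1/2) * (r x * r x * r x) * frechet_derivative f (at x) v)) (at x)"
      unfolding r_def by simp
  next
    have r: "Ck_on n S r" using Suc.IH[OF Ck_on_SucD[OF Suc.prems]] unfolding r_def .
    show "Ck_on n S (\<lambda>x. - (1/2) * (r x * r x * r x) * frechet_derivative f (at x) v)" for v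
      using Suc.prems by (intro bounded_bilinear.Ck_on[OF bounded_bilinear_mult] assms(1) r Ck_on_const) auto
  qed
qed

text \<open>\<open>Ck_on\<close> gives continuity of the derivative one direction at a time.
  Compactness bounds it on each basis vector, and linearity combines these finitely many
  bounds.\<close>

lemma bounded_by_Ck1_derivative:
  fixes f :: "'a::euclidean_space \<Rightarrow> 'b::real_normed_vector"
  assumes "Ck_on (Suc 0) S f" "K \<subseteq> S" "compact K"
  obtains L where "L \<ge> 0" "\<And>x v. x \<in> K \<Longrightarrow> norm (frechet_derivative f (at x) v) \<le> L * norm v"
proof -
  have "\<exists>B. \<forall>x\<in>K. norm (frechet_derivative f (at x) b) \<le> B" for b
  proof -
    have "continuous_on K (\<lambda>x. frechet_derivative f (at x) b)"
      using assms by (auto intro: continuous_on_subset)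
    then have "bounded ((\<lambda>x. frechet_derivative f (at x) b) ` K)"
      using assms(3) by (intro compact_imp_bounded compact_continuous_image)
    then show ?thesis by (auto simp: bounded_iff)
  qed
  then obtain B where B: "\<And>b x. x \<in> K \<Longrightarrow> norm (frechet_derivative f (at x) b) \<le> B b" by metis
  define L where "L = (\<Sum>b\<in>Basis. \<bar>B b\<bar>)"
  have "norm (frechet_derivative f (at x) v) \<le> L * norm v" if "x \<in> K" for x v
  proof -
    have lin: "linear (frechet_derivative f (at x))"
      using assms that by (intro linear_frechet_derivative) auto
    have "frechet_derivative f (at x) v = (\<Sum>b\<in>Basis. (v \<bullet> b) *\<^sub>R frechet_derivative f (at x) b)"
      by (subst (1) euclidean_representation[of v, symmetric]) (simp add: linear_sum[OF lin] linear_cmul[OF lin])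
    also have "norm \<dots> \<le> (\<Sum>b\<in>Basis. norm v * \<bar>B b\<bar>)"
    proof (rule sum_norm_le)
      fix b :: 'a assume "b \<in> Basis"
      then show "norm ((v \<bullet> b) *\<^sub>R frechet_derivative f (at x) b) \<le> norm v * \<bar>B b\<bar>"
        using B[OF that, of b] by (auto intro!: mult_mono Basis_le_norm)
    qed
    finally show ?thesis by (simp add: L_def sum_distrib_left mult.commute)
  qed
  then show ?thesis by (intro that[of L]) (auto simp: L_def sum_nonneg)
qed

lemma Ck1_lipschitz:
  fixes f :: "'a::euclidean_space \<Rightarrow> 'b::real_normed_vector"
  assumes "Ck_on (Suc 0) S f" "K \<subseteq> S" "compact K" "convex K"
  obtains L where "L \<ge> 0" "\<And>x y. x \<in> K \<Longrightarrow> y \<in> K \<Longrightarrow> norm (f y - f x) \<le> L * norm (y - x)"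
proof -
  obtain L where L: "L \<ge> 0" "\<And>x v. x \<in> K \<Longrightarrow> norm (frechet_derivative f (at x) v) \<le> L * norm v"
    using bounded_by_Ck1_derivative[OF assms(1-3)] by blast
  have "norm (f y - f x) \<le> L * norm (y - x)" if "x \<in> K" "y \<in> K" for x y
  proof (rule differentiable_bound[OF assms(4) _ _ that(2,1)])
    show "(f has_derivative frechet_derivative f (at z)) (at z within K)" if "z \<in> K" for z
      using Ck_on_SucD_has_derivative[OF assms(1)] that assms(2) has_derivative_at_withinI by blast
    show "onorm (frechet_derivative f (at z)) \<le> L" if "z \<in> K" for z
      using L that by (intro onorm_bound) auto
  qed
  with L show ?thesis by (intro that) auto
qed

text \<open>Each partial derivative is Lipschitz on \<open>K\<close> by the first-order case, hence
  so is the whole derivative, and the mean value inequality turns this into a quadratic remainder.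
  No second derivative has to be assembled as a bilinear map.\<close>

lemma Ck2_taylor:
  fixes f :: "'a::euclidean_space \<Rightarrow> 'b::real_normed_vector"
  assumes "Ck_on (Suc (Suc 0)) S f" "K \<subseteq> S" "compact K" "convex K"
  obtains L where "L \<ge> 0" "\<And>x y. x \<in> K \<Longrightarrow> y \<in> K \<Longrightarrow>
    norm (f y - f x - frechet_derivative f (at x) (y - x)) \<le> L * (norm (y - x))\<^sup>2"
proof -
  have "\<exists>L\<ge>0. \<forall>x\<in>K. \<forall>y\<in>K. norm (frechet_derivative f (at y) b - frechet_derivative f (at x) b) \<le> L * norm (y - x)" for b
    using Ck1_lipschitz[of S "\<lambda>x. frechet_derivative f (at x) b" K] assms by (metis Ck_on.simps(2))
  then obtain B where B: "\<And>b. B b \<ge> 0" "\<And>b x y. x \<in> K \<Longrightarrow> y \<in> K \<Longrightarrow>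
      norm (frechet_derivative f (at y) b - frechet_derivative f (at x) b) \<le> B b * norm (y - x)" by metis
  define L where "L = (\<Sum>b\<in>Basis. B b)"
  have L: "norm (frechet_derivative f (at y) v - frechet_derivative f (at x) v) \<le> L * norm (y - x) * norm v"
    if "x \<in> K" "y \<in> K" for x y v
  proof -
    have lin: "linear (frechet_derivative f (at z))" if "z \<in> K" for z
      using assms that by (intro linear_frechet_derivative) auto
    have rep: "frechet_derivative f (at z) v = (\<Sum>b\<in>Basis. (v \<bullet> b) *\<^sub>R frechet_derivative f (at z) b)" if "z \<in> K" for z
      by (subst (1) euclidean_representation[of v, symmetric])
        (simp add: linear_sum[OF lin[OF that]] linear_cmul[OF lin[OF that]])
    have "frechet_derivative f (at y) v - frechet_derivative f (at x) v =
        (\<Sum>b\<in>Basis. (v \<bullet> b) *\<^sub>R (frechet_derivative f (at y) b - frechet_derivative f (at x) b))"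
      by (simp add: rep that sum_subtractf scaleR_diff_right)
    also have "norm \<dots> \<le> (\<Sum>b\<in>Basis. norm v * (B b * norm (y - x)))"
    proof (rule sum_norm_le)
      fix b :: 'a assume "b \<in> Basis"
      then show "norm ((v \<bullet> b) *\<^sub>R (frechet_derivative f (at y) b - frechet_derivative f (at x) b))
          \<le> norm v * (B b * norm (y - x))"
        using B(2)[OF that, of b] unfolding norm_scaleR by (intro mult_mono) (auto intro: Basis_le_norm)
    qed
    finally show ?thesis by (simp add: L_def sum_distrib_left sum_distrib_right mult_ac)
  qed
  have L0: "L \<ge> 0" using B by (auto simp: L_def sum_nonneg)
  have "norm (f y - f x - frechet_derivative f (at x) (y - x)) \<le> L * (norm (y - x))\<^sup>2" if "x \<in> K" "y \<in> K" for x y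
  proof -
    have seg: "closed_segment x y \<subseteq> K" using assms(4) that by (simp add: convex_contains_segment)
    \<comment> \<open>Mean value inequality for \<open>f\<close> minus its linearization at
      \<open>x\<close>, along the segment from \<open>x\<close> to \<open>y\<close>; there the two
      derivatives differ by at most \<open>L * norm (y - x)\<close>.\<close>
    have "norm (f y - f x - frechet_derivative f (at x) (y - x)) \<le> norm (y - x) * (L * norm (y - x))"
    proof (rule differentiable_bound_linearization[where f = f and S = "closed_segment x y" and f' = "\<lambda>z. frechet_derivative f (at z)"])
      show "x + t *\<^sub>R (y - x) \<in> closed_segment x y" if "t \<in> {0..1}" for t
        using that by (auto simp: in_segment algebra_simps intro!: exI[of _ t])
      show "(f has_derivative frechet_derivative f (at z)) (at z within closed_segment x y)" if "z \<in> closed_segment x y" for z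
        using Ck_on_SucD_has_derivative[OF assms(1)] that assms(2) seg has_derivative_at_withinI by blast
      show "onorm (frechet_derivative f (at z) - frechet_derivative f (at x)) \<le> L * norm (y - x)"
        if z: "z \<in> closed_segment x y" for z
        unfolding fun_diff_def
      proof (rule onorm_bound)
        fix v
        have "norm (frechet_derivative f (at z) v - frechet_derivative f (at x) v) \<le> L * norm (z - x) * norm v"
          using L seg z that by blast
        also have "\<dots> \<le> L * norm (y - x) * norm v"
          using segment_bound1[OF z] L0 by (intro mult_right_mono mult_left_mono) (auto simp: norm_minus_commute)
        finally show "norm (frechet_derivative f (at z) v - frechet_derivative f (at x) v) \<le> L * norm (y - x) * norm v" .
      qed (use L0 in auto)
    qed auto
    then show ?thesis by (simp add: power2_eq_square mult_ac)
  qed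
  with L0 show ?thesis by (intro that) auto
qed

section \<open>Absolutely continuous functions\<close>

lemma AE_lebesgue_on_iff_negligible:
  assumes "S \<in> sets lebesgue"
  shows "(AE x in lebesgue_on S. P x) \<longleftrightarrow> (\<exists>N. negligible N \<and> (\<forall>x\<in>S - N. P x))"
proof -
  have "(AE x in lebesgue_on S. P x) \<longleftrightarrow> (AE x in lebesgue. x \<in> S \<longrightarrow> P x)"
    using assms by (simp add: AE_restrict_space_iff)
  also have "\<dots> \<longleftrightarrow> (\<exists>N. negligible N \<and> (\<forall>x\<in>S - N. P x))"
    unfolding eventually_ae_filter negligible_iff_null_sets by auto
  finally show ?thesis .
qed

text \<open>The straddle lemma: since \<open>u\<close> and \<open>v\<close> lie on opposite sides of
  \<open>t\<close>, the two one-point errors add up to a multiple of \<open>v - u\<close>, the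
  length of the interval.\<close>

lemma has_vector_derivative_bound_nearby:
  fixes y :: "real \<Rightarrow> 'a::real_normed_vector"
  assumes "(y has_vector_derivative D) (at t within S)" "e > 0"
  obtains d where "d > 0" "\<And>u v. u \<in> S \<Longrightarrow> v \<in> S \<Longrightarrow> u \<le> t \<Longrightarrow> t \<le> v \<Longrightarrow> \<bar>u - t\<bar> < d \<Longrightarrow> \<bar>v - t\<bar> < d \<Longrightarrow>
    norm (y v - y u - (v - u) *\<^sub>R D) \<le> e * (v - u)"
proof -
  have "(y has_derivative (\<lambda>h. h *\<^sub>R D)) (at t within S)"
    using assms(1) by (simp add: has_vector_derivative_def)
  then obtain d where d: "d > 0" "\<And>s. s \<in> S \<Longrightarrow> norm (s - t) < d \<Longrightarrow>
      norm (y s - y t - (s - t) *\<^sub>R D) \<le> e * norm (s - t)"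
    unfolding has_derivative_within_alt using assms(2) by blast
  show ?thesis
  proof (rule that[OF d(1)])
    fix u v assume *: "u \<in> S" "v \<in> S" "u \<le> t" "t \<le> v" "\<bar>u - t\<bar> < d" "\<bar>v - t\<bar> < d"
    have "y v - y u - (v - u) *\<^sub>R D = (y v - y t - (v - t) *\<^sub>R D) - (y u - y t - (u - t) *\<^sub>R D)"
      by (simp add: algebra_simps)
    also have "norm \<dots> \<le> e * norm (v - t) + e * norm (u - t)"
      by (rule order_trans[OF norm_triangle_ineq4 add_mono]) (use d(2)[of v] d(2)[of u] * in simp_all)
    also have "\<dots> = e * (v - u)" using * by (simp add: algebra_simps)
    finally show "norm (y v - y u - (v - u) *\<^sub>R D) \<le> e * (v - u)" .
  qed
qed

text \<open>The tags in the null set are controlled by absolute continuity, via a gauge inside an open set of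
  small measure; the other ones by differentiability.\<close>
lemma abs_cont_on_has_integral:
  fixes y :: "real \<Rightarrow> 'a::euclidean_space"
  assumes ab: "a \<le> b" and ac: "abs_cont_on a b y" and N: "negligible N"
    and der: "\<And>t. t \<in> {a..b} - N \<Longrightarrow> (y has_vector_derivative f t) (at t within {a..b})"
    and f0: "\<And>t. t \<in> {a..b} \<inter> N \<Longrightarrow> f t = 0"
  shows "(f has_integral (y b - y a)) {a..b}"
  unfolding box_real(2)[symmetric] has_integral
proof (intro allI impI)
  fix e :: real assume e: "e > 0"
  \<comment> \<open>The summand 1 keeps the denominator positive when \<open>a = b\<close> and makes
    the bound on \<open>e1 * (b - a)\<close> strict.\<close>
  define e1 where "e1 = e / (2 * (b - a + 1))"
  have e1: "e1 > 0" "e1 * (b - a) < e / 2" using e ab by (auto simp: e1_def field_simps)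
  obtain \<delta> where \<delta>: "\<delta> > 0" "\<And>d S. d division_of S \<Longrightarrow> S \<subseteq> {a..b} \<Longrightarrow> (\<Sum>K\<in>d. Sup K - Inf K) < \<delta> \<Longrightarrow>
      (\<Sum>K\<in>d. norm (y (Sup K) - y (Inf K))) < e / 2"
    using ac e unfolding abs_cont_on_def by (meson half_gt_zero)
  obtain G where G: "open G" "N \<subseteq> G" "G \<in> lmeasurable" "measure lebesgue G < \<delta>"
  proof -
    obtain G where G: "open G" "N \<subseteq> G" "G - N \<in> lmeasurable" "emeasure lebesgue (G - N) < ennreal \<delta>"
      using sets_lebesgue_outer_open[OF negligible_imp_sets[OF N] \<delta>(1)] by metis
    have N': "N \<in> lmeasurable" "measure lebesgue N = 0"
      using N negligible_imp_measurable negligible_imp_measure0 by auto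
    have "G = (G - N) \<union> N" using G by blast
    then have "G \<in> lmeasurable" "measure lebesgue G \<le> measure lebesgue (G - N) + measure lebesgue N"
      using fmeasurable.Un[OF G(3) N'(1)] measure_Un_le[of "G - N" lebesgue N] G(3) N'(1) by auto
    moreover have "measure lebesgue (G - N) < \<delta>"
      using G(3,4) \<delta>(1) by (simp add: emeasure_eq_measure2 ennreal_less_iff)
    ultimately show ?thesis using that G N' by auto
  qed
  have "\<exists>d>0. (t \<in> N \<longrightarrow> ball t d \<subseteq> G) \<and> (t \<in> {a..b} - N \<longrightarrow> (\<forall>u v. u \<in> {a..b} \<longrightarrow> v \<in> {a..b} \<longrightarrow> u \<le> t \<longrightarrow> t \<le> v \<longrightarrow>
      \<bar>u - t\<bar> < d \<longrightarrow> \<bar>v - t\<bar> < d \<longrightarrow> norm (y v - y u - (v - u) *\<^sub>R f t) \<le> e1 * (v - u)))" for t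
  proof (cases "t \<in> N")
    case True
    then show ?thesis using G openE[of G t] by blast
  next
    case False
    show ?thesis
    proof (cases "t \<in> {a..b}")
      case True
      then have "(y has_vector_derivative f t) (at t within {a..b})" using False der by blast
      from has_vector_derivative_bound_nearby[OF this e1(1)] obtain d where "d > 0"
        "\<And>u v. u \<in> {a..b} \<Longrightarrow> v \<in> {a..b} \<Longrightarrow> u \<le> t \<Longrightarrow> t \<le> v \<Longrightarrow> \<bar>u - t\<bar> < d \<Longrightarrow> \<bar>v - t\<bar> < d \<Longrightarrow>
          norm (y v - y u - (v - u) *\<^sub>R f t) \<le> e1 * (v - u)" by blast
      then show ?thesis using False by (intro exI[of _ d]) simp
    qed (use False in \<open>auto intro: exI[of _ 1]\<close>)
  qed
  then have "\<exists>d. \<forall>t. d t > 0 \<and> (t \<in> N \<longrightarrow> ball t (d t) \<subseteq> G) \<and> (t \<in> {a..b} - N \<longrightarrow> (\<forall>u v. u \<in> {a..b} \<longrightarrow> v \<in> {a..b} \<longrightarrow> u \<le> t \<longrightarrow> t \<le> v \<longrightarrow>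
      \<bar>u - t\<bar> < d t \<longrightarrow> \<bar>v - t\<bar> < d t \<longrightarrow> norm (y v - y u - (v - u) *\<^sub>R f t) \<le> e1 * (v - u)))"
    by (rule choice[OF allI])
  then obtain d where d: "\<And>t. d t > 0" "\<And>t. t \<in> N \<Longrightarrow> ball t (d t) \<subseteq> G"
    "\<And>t u v. t \<in> {a..b} - N \<Longrightarrow> u \<in> {a..b} \<Longrightarrow> v \<in> {a..b} \<Longrightarrow> u \<le> t \<Longrightarrow> t \<le> v \<Longrightarrow> \<bar>u - t\<bar> < d t \<Longrightarrow> \<bar>v - t\<bar> < d t \<Longrightarrow>
       norm (y v - y u - (v - u) *\<^sub>R f t) \<le> e1 * (v - u)"
    by blast
  show "\<exists>\<gamma>. gauge \<gamma> \<and> (\<forall>\<D>. \<D> tagged_division_of cbox a b \<and> \<gamma> fine \<D> \<longrightarrow>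
      norm ((\<Sum>(x, k)\<in>\<D>. measure lborel k *\<^sub>R f x) - (y b - y a)) < e)"
  proof (intro exI[of _ "\<lambda>t. ball t (d t)"] conjI allI impI)
    show "gauge (\<lambda>t. ball t (d t))" using d(1) by (simp add: gauge_def)
    fix p assume "p tagged_division_of cbox a b \<and> (\<lambda>t. ball t (d t)) fine p"
    then have p: "p tagged_division_of {a..b}" and fine: "(\<lambda>t. ball t (d t)) fine p" by auto
    have pp: "p tagged_partial_division_of {a..b}" using p by (simp add: tagged_division_of_def)
    have fin: "finite p" using p by blast
    have K: "\<exists>u v. u \<le> v \<and> k = {u..v} \<and> u \<in> {a..b} \<and> v \<in> {a..b} \<and> u \<le> t \<and> t \<le> v \<and> \<bar>u - t\<bar> < d t \<and> \<bar>v - t\<bar> < d t \<and> t \<in> {a..b}"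
      if tk: "(t, k) \<in> p" for t k
    proof -
      obtain u v where uv: "k = {u..v}" using tagged_division_ofD(4)[OF p tk] by auto
      have t: "t \<in> k" "k \<subseteq> {a..b}" using tagged_division_ofD(2,3)[OF p tk] by auto
      have "k \<subseteq> ball t (d t)" using fine tk by (auto simp: fine_def)
      moreover have "u \<in> k" "v \<in> k" using uv t by auto
      ultimately have "u \<in> ball t (d t)" "v \<in> ball t (d t)" by blast+
      moreover have "u \<le> v" "u \<in> {a..b}" "v \<in> {a..b}" "u \<le> t" "t \<le> v" "t \<in> {a..b}" using uv t by auto
      ultimately show ?thesis using uv by (intro exI[of _ u] exI[of _ v]) (simp add: dist_real_def abs_minus_commute)
    qed
    define p1 where "p1 = {(t, k) \<in> p. t \<notin> N}"
    define p2 where "p2 = {(t, k) \<in> p. t \<in> N}"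
    have split: "p = p1 \<union> p2" "p1 \<inter> p2 = {}" "p1 \<subseteq> p" "p2 \<subseteq> p" by (auto simp: p1_def p2_def)
    \<comment> \<open>The error of one tagged interval. The increments of \<open>y\<close> telescope
      over the division, so the total error is the sum of these.\<close>
    define F where "F = (\<lambda>(t, k). measure lborel k *\<^sub>R f t - (y (Sup k) - y (Inf k)))"
    have "(\<Sum>(t, k)\<in>p. measure lborel k *\<^sub>R f t) - (y b - y a) = (\<Sum>z\<in>p. F z)"
      using additive_tagged_division_1[OF ab p, of y]
      by (simp add: F_def sum_subtractf case_prod_unfold)
    also have "\<dots> = (\<Sum>z\<in>p1. F z) + (\<Sum>z\<in>p2. F z)"
      using split fin by (metis finite_subset sum.union_disjoint)
    finally have eq: "(\<Sum>(t, k)\<in>p. measure lborel k *\<^sub>R f t) - (y b - y a) = (\<Sum>z\<in>p1. F z) + (\<Sum>z\<in>p2. F z)" .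
    have "norm (\<Sum>z\<in>p1. F z) \<le> (\<Sum>z\<in>p1. e1 * measure lborel (snd z))"
    proof (rule sum_norm_le)
      fix z assume z: "z \<in> p1"
      obtain t k where tk: "z = (t, k)" by force
      then have "(t, k) \<in> p" "t \<notin> N" using z by (auto simp: p1_def)
      from K[OF this(1)] obtain u v where uv: "u \<le> v \<and> k = {u..v} \<and> u \<in> {a..b} \<and> v \<in> {a..b} \<and> u \<le> t \<and> t \<le> v \<and> \<bar>u - t\<bar> < d t \<and> \<bar>v - t\<bar> < d t \<and> t \<in> {a..b}"
        by blast
      then have "norm (y v - y u - (v - u) *\<^sub>R f t) \<le> e1 * (v - u)"
        using d(3)[of t u v] \<open>t \<notin> N\<close> by auto
      then show "norm (F z) \<le> e1 * measure lborel (snd z)"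
        using uv by (auto simp: F_def tk norm_minus_commute)
    qed
    also have "\<dots> \<le> (\<Sum>z\<in>p. e1 * measure lborel (snd z))"
      using split fin e1 by (intro sum_mono2) auto
    also have "\<dots> = e1 * (\<Sum>(t, k)\<in>p. measure lborel k)"
      by (simp add: sum_distrib_left case_prod_unfold)
    also have "\<dots> = e1 * (b - a)"
      using additive_content_tagged_division[of p a b] p ab by simp
    finally have b1: "norm (\<Sum>z\<in>p1. F z) < e / 2" using e1 by simp
    \<comment> \<open>Absolute continuity speaks of a set of intervals, whereas \<open>p2\<close> is
      a set of tagged ones, and a one-point interval could be compared with others without
      contradicting disjointness of interiors. Intervals with empty interior contribute no error; on
      the remaining ones \<open>snd\<close> is injective.\<close>
    define P where "P = {z \<in> p2. interior (snd z) \<noteq> {}}"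
    have Pfin: "finite P" "P \<subseteq> p" using split fin finite_subset by (auto simp: P_def)
    have zero: "F z = 0" if "z \<in> p2 - P" for z
    proof -
      obtain t k where tk: "z = (t, k)" by force
      then have "(t, k) \<in> p" "t \<in> N" "interior k = {}" using that by (auto simp: p2_def P_def)
      moreover from K[OF this(1)] obtain u v where "u \<le> v" "k = {u..v}" by blast
      ultimately show ?thesis by (auto simp: F_def tk)
    qed
    have inj: "inj_on snd P"
    proof (rule inj_onI)
      fix z z' assume z: "z \<in> P" "z' \<in> P" "snd z = snd z'"
      obtain t k t' where tk: "z = (t, k)" "z' = (t', k)" using z(3) by (metis prod.collapse)
      then have "(t, k) \<in> p" "(t', k) \<in> p" "interior k \<noteq> {}" using z Pfin by (auto simp: P_def)
      then show "z = z'" using tagged_division_ofD(5)[OF p, of t k t' k] tk by blast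
    qed
    have div: "(snd ` P) division_of \<Union>(snd ` P)"
      by (rule partial_division_of_tagged_division[OF tagged_partial_division_subset[OF pp Pfin(2)]])
    have sub: "\<Union>(snd ` P) \<subseteq> {a..b}" using Pfin(2) tagged_division_ofD(3)[OF p] by fastforce
    have cont: "Sup k - Inf k = measure lebesgue k" if k: "k \<in> snd ` P" for k
    proof -
      obtain t where "(t, k) \<in> p" using k Pfin(2) by auto
      from K[OF this] obtain u v where "u \<le> v" "k = {u..v}" by blast
      then show ?thesis by simp
    qed
    have "(\<Sum>k\<in>snd ` P. Sup k - Inf k) = (\<Sum>k\<in>snd ` P. measure lebesgue k)" using cont by simp
    also have "\<dots> = measure lebesgue (\<Union>(snd ` P))" using content_division[OF div] by simp
    also have "\<dots> \<le> measure lebesgue G"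
    proof (rule measure_mono_fmeasurable[OF _ _ G(3)])
      show "\<Union>(snd ` P) \<subseteq> G"
      proof
        fix x assume "x \<in> \<Union>(snd ` P)"
        then obtain t k where "(t, k) \<in> P" "x \<in> k" by auto
        moreover from this have "(t, k) \<in> p" "t \<in> N" by (auto simp: P_def p2_def)
        moreover from this have "k \<subseteq> ball t (d t)" using fine by (auto simp: fine_def)
        ultimately show "x \<in> G" using d(2)[of t] by blast
      qed
      show "\<Union>(snd ` P) \<in> sets lebesgue"
        using lmeasurable_division[OF div] by (rule fmeasurableD)
    qed
    finally have "(\<Sum>k\<in>snd ` P. norm (y (Sup k) - y (Inf k))) < e / 2"
      using \<delta>(2)[OF div sub] G(4) by simp
    moreover have "(\<Sum>z\<in>p2. F z) = (\<Sum>z\<in>P. F z)"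
      using zero split fin by (intro sum.mono_neutral_right) (auto simp: P_def intro: finite_subset)
    moreover have "norm (\<Sum>z\<in>P. F z) \<le> (\<Sum>z\<in>P. norm (y (Sup (snd z)) - y (Inf (snd z))))"
    proof (rule sum_norm_le)
      fix z assume z: "z \<in> P"
      then obtain t k where tk: "z = (t, k)" "(t, k) \<in> p" "t \<in> N" by (auto simp: P_def p2_def)
      then have "t \<in> {a..b} \<inter> N" using K by blast
      then show "norm (F z) \<le> norm (y (Sup (snd z)) - y (Inf (snd z)))" by (simp add: F_def tk f0 norm_minus_commute)
    qed
    ultimately have "norm (\<Sum>z\<in>p2. F z) < e / 2"
      using inj by (simp add: sum.reindex)
    with b1 show "norm ((\<Sum>(t, k)\<in>p. measure lborel k *\<^sub>R f t) - (y b - y a)) < e"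
      unfolding eq using norm_triangle_ineq[of "sum F p1" "sum F p2"] by linarith
  qed
qed

lemma lipschitz_imp_abs_cont_on:
  fixes y :: "real \<Rightarrow> 'a::real_normed_vector"
  assumes "C-lipschitz_on {a..b} y"
  shows "abs_cont_on a b y"
  unfolding abs_cont_on_def
proof (intro allI impI)
  fix e :: real assume e: "e > 0"
  have C: "C \<ge> 0" using assms lipschitz_on_nonneg by blast
  show "\<exists>\<delta>>0. \<forall>d S. d division_of S \<and> S \<subseteq> {a..b} \<and> (\<Sum>K\<in>d. Sup K - Inf K) < \<delta> \<longrightarrow>
      (\<Sum>K\<in>d. norm (y (Sup K) - y (Inf K))) < e"
  \<comment> \<open>Dividing by \<open>C + 1\<close> instead of \<open>C\<close> covers the case
    \<open>C = 0\<close>.\<close>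
  proof (intro exI[of _ "e / (C + 1)"] conjI allI impI)
    fix d S assume *: "d division_of S \<and> S \<subseteq> {a..b} \<and> (\<Sum>K\<in>d. Sup K - Inf K) < e / (C + 1)"
    have K: "norm (y (Sup K) - y (Inf K)) \<le> C * (Sup K - Inf K) \<and> 0 \<le> Sup K - Inf K" if Kd: "K \<in> d" for K
    proof -
      from * have div: "d division_of S" and "S \<subseteq> {a..b}" by auto
      obtain u v where uv: "K = {u..v}" using division_ofD(4)[OF div Kd] by auto
      have "K \<noteq> {}" "K \<subseteq> {a..b}" using division_ofD(2,3)[OF div Kd] \<open>S \<subseteq> {a..b}\<close> by auto
      then have "u \<le> v" "u \<in> {a..b}" "v \<in> {a..b}" using uv by auto
      then show ?thesis using lipschitz_onD[OF assms, of v u] uv by (auto simp: dist_norm)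
    qed
    have "(\<Sum>K\<in>d. norm (y (Sup K) - y (Inf K))) \<le> C * (\<Sum>K\<in>d. Sup K - Inf K)"
      unfolding sum_distrib_left using K by (intro sum_mono) auto
    also have "\<dots> \<le> (C + 1) * (\<Sum>K\<in>d. Sup K - Inf K)"
      using C K by (intro mult_right_mono sum_nonneg) auto
    also have "\<dots> < (C + 1) * (e / (C + 1))"
      using C * by (intro mult_strict_left_mono) auto
    finally show "(\<Sum>K\<in>d. norm (y (Sup K) - y (Inf K))) < e" using C by simp
  qed (use e C in auto)
qed

text \<open>Serves to recover the coefficients of a vector in the frame \<open>W\<close> by inner
  products that depend continuously on the point. The membership of \<theta> in the span of
  \<open>W\<close> strengthens the induction: it keeps the projection of the next vector inside the
  span of the earlier ones, so that the residual cannot vanish.\<close>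

lemma continuous_dual_frame:
  fixes W :: "nat \<Rightarrow> 'a::topological_space \<Rightarrow> 'b::real_inner"
  assumes "\<And>i. i < m \<Longrightarrow> continuous_on U (W i)"
    and "\<And>x i. x \<in> U \<Longrightarrow> i < m \<Longrightarrow> W i x \<notin> span ((\<lambda>j. W j x) ` {..<i})"
  shows "\<exists>\<theta>. (\<forall>i<m. continuous_on U (\<theta> i)) \<and>
    (\<forall>x\<in>U. \<forall>i<m. \<theta> i x \<in> span ((\<lambda>j. W j x) ` {..<m}) \<and>
       (\<forall>j<m. \<theta> i x \<bullet> W j x = (if i = j then 1 else 0)))"
  using assms
proof (induction m)
  case 0
  then show ?case by simp
next
  case (Suc m)
  have "\<exists>\<theta>. (\<forall>i<m. continuous_on U (\<theta> i)) \<and>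
    (\<forall>x\<in>U. \<forall>i<m. \<theta> i x \<in> span ((\<lambda>j. W j x) ` {..<m}) \<and>
       (\<forall>j<m. \<theta> i x \<bullet> W j x = (if i = j then 1 else 0)))"
    by (rule Suc.IH) (use Suc.prems less_SucI in blast)+
  then obtain \<theta> where cont: "\<And>i. i < m \<Longrightarrow> continuous_on U (\<theta> i)"
    and sp: "\<And>x i. x \<in> U \<Longrightarrow> i < m \<Longrightarrow> \<theta> i x \<in> span ((\<lambda>j. W j x) ` {..<m})"
    and dual: "\<And>x i j. x \<in> U \<Longrightarrow> i < m \<Longrightarrow> j < m \<Longrightarrow> \<theta> i x \<bullet> W j x = (if i = j then 1 else 0)"
    by blast
  \<comment> \<open>The orthogonal projection of \<open>W m x\<close> onto the span of the earlier
    vectors, written with their dual frame; \<open>R\<close> is the residual.\<close>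
  define P where "P x = (\<Sum>i<m. (W i x \<bullet> W m x) *\<^sub>R \<theta> i x)" for x
  define R where "R x = W m x - P x" for x
  have Psp: "P x \<in> span ((\<lambda>j. W j x) ` {..<m})" if "x \<in> U" for x
    unfolding P_def using sp[OF that] by (intro span_sum span_scale) auto
  have R0: "R x \<noteq> 0" if "x \<in> U" for x
    using Psp[OF that] Suc.prems(2)[OF that, of m] by (auto simp: R_def)
  have RW: "R x \<bullet> W j x = 0" if "x \<in> U" "j < m" for x j
  proof -
    have "P x \<bullet> W j x = (\<Sum>i<m. (W i x \<bullet> W m x) * (\<theta> i x \<bullet> W j x))"
      by (simp add: P_def inner_sum_left)
    also have "\<dots> = (\<Sum>i<m. if i = j then W j x \<bullet> W m x else 0)"
      using that by (intro sum.cong) (auto simp: dual)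
    finally show ?thesis using that by (simp add: R_def inner_diff_left inner_commute[of "W m x"])
  qed
  have Rperp: "R x \<bullet> v = 0" if "x \<in> U" "v \<in> span ((\<lambda>j. W j x) ` {..<m})" for x v
    using orthogonal_to_span[of v "(\<lambda>j. W j x) ` {..<m}" "R x"] that RW
    by (auto simp: orthogonal_def)
  have RWm: "R x \<bullet> W m x = R x \<bullet> R x" if "x \<in> U" for x
    using Rperp[OF that Psp[OF that]] by (simp add: R_def inner_diff_right)
  have Rcont: "continuous_on U R"
    unfolding R_def P_def using Suc.prems(1) cont by (intro continuous_intros) auto
  define \<theta>m where "\<theta>m x = (1 / (R x \<bullet> R x)) *\<^sub>R R x" for x
  \<comment> \<open>The normalized residual is 1 on \<open>W m\<close> and 0 on the earlier vectors.
    Subtracting a multiple of it from an old dual vector therefore corrects the value on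
    \<open>W m\<close> and changes no other.\<close>
  define \<theta>' where "\<theta>' i x = (if i < m then \<theta> i x - (\<theta> i x \<bullet> W m x) *\<^sub>R \<theta>m x else \<theta>m x)" for i x
  have mcont: "continuous_on U \<theta>m"
    unfolding \<theta>m_def using R0 by (intro continuous_intros Rcont) auto
  have mono: "span ((\<lambda>j. W j x) ` {..<m}) \<subseteq> span ((\<lambda>j. W j x) ` {..<Suc m})" for x
    by (intro span_mono image_mono) auto
  have Rsp: "\<theta>m x \<in> span ((\<lambda>j. W j x) ` {..<Suc m})" if "x \<in> U" for x
    unfolding \<theta>m_def R_def using Psp[OF that] mono by (intro span_scale span_diff) (auto intro: span_base)
  show ?case
  proof (intro exI[of _ \<theta>'] conjI allI impI ballI)
    fix i assume i: "i < Suc m"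
    show "continuous_on U (\<theta>' i)"
      unfolding \<theta>'_def using cont mcont Suc.prems(1) by (cases "i < m") (auto intro!: continuous_intros)
    fix x assume x: "x \<in> U"
    show "\<theta>' i x \<in> span ((\<lambda>j. W j x) ` {..<Suc m})"
      unfolding \<theta>'_def using sp[OF x] mono Rsp[OF x] by (auto intro!: span_diff span_scale)
    fix j assume j: "j < Suc m"
    show "\<theta>' i x \<bullet> W j x = (if i = j then 1 else 0)"
      using i j x R0[OF x] by (auto simp: \<theta>'_def \<theta>m_def inner_diff_left dual RW RWm less_Suc_eq)
  qed
qed

section \<open>The energy gap in coordinates\<close>

lemma (in bounded_bilinear) lipschitz_on_Icc:
  fixes f :: "real \<Rightarrow> 'a" and h :: "real \<Rightarrow> 'b"
  assumes "C-lipschitz_on {s..t} f" "D-lipschitz_on {s..t} h"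
  shows "\<exists>E. E-lipschitz_on {s..t} (\<lambda>x. prod (f x) (h x))"
proof -
  obtain K where K: "0 \<le> K" "\<And>a b. norm (prod a b) \<le> norm a * norm b * K"
    using nonneg_bounded by blast
  have "bounded (f ` {s..t})" "bounded (h ` {s..t})"
    using assms by (auto intro!: compact_imp_bounded compact_continuous_image lipschitz_on_continuous_on)
  then obtain F H where F: "\<And>x. x \<in> {s..t} \<Longrightarrow> norm (f x) \<le> F" "F > 0" and H: "\<And>x. x \<in> {s..t} \<Longrightarrow> norm (h x) \<le> H" "H > 0"
    unfolding bounded_pos by (metis image_eqI)
  have CD: "C \<ge> 0" "D \<ge> 0" using assms lipschitz_on_nonneg by auto
  have "(F * D * K + C * H * K)-lipschitz_on {s..t} (\<lambda>x. prod (f x) (h x))"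
  proof (rule lipschitz_onI)
    fix x y assume xy: "x \<in> {s..t}" "y \<in> {s..t}"
    have "prod (f x) (h x) - prod (f y) (h y) = prod (f x) (h x - h y) + prod (f x - f y) (h y)"
      by (simp add: diff_left diff_right)
    also have "norm \<dots> \<le> norm (f x) * norm (h x - h y) * K + norm (f x - f y) * norm (h y) * K"
      by (intro norm_triangle_le add_mono K)
    also have "\<dots> \<le> F * (D * dist x y) * K + (C * dist x y) * H * K"
      using lipschitz_onD[OF assms(1) xy] lipschitz_onD[OF assms(2) xy] xy F H K(1) CD
      by (intro add_mono mult_mono mult_nonneg_nonneg) (auto simp: dist_norm)
    finally show "dist (prod (f x) (h x)) (prod (f y) (h y)) \<le> (F * D * K + C * H * K) * dist x y"
      by (simp add: dist_norm algebra_simps)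
  qed (use F H K CD in simp)
  then show ?thesis by blast
qed

lemma has_vector_derivative_lipschitz_on:
  fixes f :: "real \<Rightarrow> 'a::real_normed_vector"
  assumes "\<And>t. t \<in> {a..b} \<Longrightarrow> (f has_vector_derivative f' t) (at t within {a..b})"
    and "\<And>t. t \<in> {a..b} \<Longrightarrow> norm (f' t) \<le> C" "C \<ge> 0"
  shows "C-lipschitz_on {a..b} f"
proof (rule bounded_derivative_imp_lipschitz)
  show "(f has_derivative (\<lambda>h. h *\<^sub>R f' t)) (at t within {a..b})" if "t \<in> {a..b}" for t
    using assms(1)[OF that] by (simp add: has_vector_derivative_def)
  show "onorm (\<lambda>h. h *\<^sub>R f' t) \<le> C" if "t \<in> {a..b}" for t
    using assms(2)[OF that] assms(3) by (intro onorm_bound) (auto simp: mult.commute[of C] intro: mult_left_mono)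
qed (use assms in auto)

text \<open>Taylor for s \<mapsto> s^2/2 when the increment \<open>b - a\<close> is itself known
  only to second order as \<delta>. The two error terms are at most
  \<open>E\<^sup>2 * d\<^sup>2 / 2\<close> and \<open>E\<^sup>2 * d\<^sup>2\<close>; the factor 2 is
  a rounding up.\<close>

lemma half_square_taylor:
  fixes a b \<delta> E :: real
  assumes "\<bar>a\<bar> \<le> E" "\<bar>b - a\<bar> \<le> E * d" "\<bar>b - a - \<delta>\<bar> \<le> E * d\<^sup>2" "d \<ge> 0"
  shows "b\<^sup>2 / 2 \<le> a\<^sup>2 / 2 + a * \<delta> + 2 * E\<^sup>2 * d\<^sup>2"
proof -
  have "E \<ge> 0" using assms(1) by linarith
  have "b\<^sup>2 / 2 - a\<^sup>2 / 2 - a * \<delta> = (b - a)\<^sup>2 / 2 + a * (b - a - \<delta>)"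
    by (simp add: power2_eq_square field_simps)
  moreover have "(b - a)\<^sup>2 \<le> (E * d)\<^sup>2"
    using assms(2) by (rule abs_le_square_iff[THEN iffD1, OF order_trans]) (use \<open>E \<ge> 0\<close> assms in auto)
  moreover have "a * (b - a - \<delta>) \<le> \<bar>a\<bar> * \<bar>b - a - \<delta>\<bar>"
    by (simp flip: abs_mult)
  moreover have "\<bar>a\<bar> * \<bar>b - a - \<delta>\<bar> \<le> E * (E * d\<^sup>2)"
    using assms \<open>E \<ge> 0\<close> by (intro mult_mono) auto
  ultimately show ?thesis using zero_le_square[of "E * d"]
    by (simp add: power2_eq_square algebra_simps)
qed

text \<open>Second-order expansion at (z, \<xi>) of the Hamiltonian, half the sum of the squares of
  \<xi> \<bullet> W i z, with increment (w - z, q - \<xi>). As the covector increment is bounded by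
  the one in position, the remainder is quadratic in \<open>w - z\<close> alone, with a constant
  made of bounds on the frame and on \<xi> only.\<close>

lemma hamiltonian_taylor:
  fixes W :: "nat \<Rightarrow> 'a::real_inner \<Rightarrow> 'a" and W' :: "nat \<Rightarrow> 'a \<Rightarrow> 'a \<Rightarrow> 'a"
  assumes "L \<ge> 0" "norm \<xi> \<le> M" "norm (q - \<xi>) \<le> norm (w - z)"
    and "\<And>i. i < k \<Longrightarrow> norm (W i z) \<le> L" "\<And>i. i < k \<Longrightarrow> norm (W i w) \<le> L"
    and "\<And>i. i < k \<Longrightarrow> norm (W i w - W i z) \<le> L * norm (w - z)"
    and "\<And>i. i < k \<Longrightarrow> norm (W i w - W i z - W' i z (w - z)) \<le> L * (norm (w - z))\<^sup>2"
  shows "(\<Sum>i<k. (q \<bullet> W i w)\<^sup>2) / 2 \<le> (\<Sum>i<k. (\<xi> \<bullet> W i z)\<^sup>2) / 2 +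
    (\<Sum>i<k. (\<xi> \<bullet> W i z) * (\<xi> \<bullet> W' i z (w - z) + (q - \<xi>) \<bullet> W i z)) +
    2 * real k * (L * (1 + M))\<^sup>2 * (norm (w - z))\<^sup>2"
proof -
  have M: "M \<ge> 0" using assms(2) norm_ge_zero order_trans by blast
  have "(q \<bullet> W i w)\<^sup>2 / 2 \<le> (\<xi> \<bullet> W i z)\<^sup>2 / 2 +
      (\<xi> \<bullet> W i z) * (\<xi> \<bullet> W' i z (w - z) + (q - \<xi>) \<bullet> W i z) + 2 * (L * (1 + M))\<^sup>2 * (norm (w - z))\<^sup>2"
    if i: "i < k" for i
  proof (rule half_square_taylor)
    let ?d = "norm (w - z)"
    have "\<bar>\<xi> \<bullet> W i z\<bar> \<le> norm \<xi> * norm (W i z)" by (rule Cauchy_Schwarz_ineq2)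
    also have "\<dots> \<le> M * L" using assms i M by (intro mult_mono) auto
    also have "\<dots> \<le> L * (1 + M)" using assms(1) by (simp add: algebra_simps)
    finally show "\<bar>\<xi> \<bullet> W i z\<bar> \<le> L * (1 + M)" .
    have "q \<bullet> W i w - \<xi> \<bullet> W i z = (q - \<xi>) \<bullet> W i w + \<xi> \<bullet> (W i w - W i z)"
      by (simp add: inner_diff_left inner_diff_right)
    also have "\<bar>\<dots>\<bar> \<le> norm (q - \<xi>) * norm (W i w) + norm \<xi> * norm (W i w - W i z)"
      by (intro abs_triangle_ineq[THEN order_trans] add_mono Cauchy_Schwarz_ineq2)
    also have "\<dots> \<le> ?d * L + M * (L * ?d)"
      using assms i M by (intro add_mono mult_mono) auto
    finally show "\<bar>q \<bullet> W i w - \<xi> \<bullet> W i z\<bar> \<le> L * (1 + M) * ?d" by (simp add: algebra_simps)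
    \<comment> \<open>The second-order error consists of the mixed term of the pairing and the
      Taylor remainder of \<open>W i\<close>.\<close>
    have "q \<bullet> W i w - \<xi> \<bullet> W i z - (\<xi> \<bullet> W' i z (w - z) + (q - \<xi>) \<bullet> W i z) =
        (q - \<xi>) \<bullet> (W i w - W i z) + \<xi> \<bullet> (W i w - W i z - W' i z (w - z))"
      by (simp add: inner_diff_left inner_diff_right)
    also have "\<bar>\<dots>\<bar> \<le> norm (q - \<xi>) * norm (W i w - W i z) + norm \<xi> * norm (W i w - W i z - W' i z (w - z))"
      by (intro abs_triangle_ineq[THEN order_trans] add_mono Cauchy_Schwarz_ineq2)
    also have "\<dots> \<le> ?d * (L * ?d) + M * (L * ?d\<^sup>2)"
      using assms i M by (intro add_mono mult_mono) auto
    finally show "\<bar>q \<bullet> W i w - \<xi> \<bullet> W i z - (\<xi> \<bullet> W' i z (w - z) + (q - \<xi>) \<bullet> W i z)\<bar> \<le> L * (1 + M) * ?d\<^sup>2"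
      by (simp add: algebra_simps power2_eq_square)
  qed simp
  then have "(\<Sum>i<k. (q \<bullet> W i w)\<^sup>2 / 2) \<le> (\<Sum>i<k. (\<xi> \<bullet> W i z)\<^sup>2 / 2 +
      (\<xi> \<bullet> W i z) * (\<xi> \<bullet> W' i z (w - z) + (q - \<xi>) \<bullet> W i z) + 2 * (L * (1 + M))\<^sup>2 * (norm (w - z))\<^sup>2)"
    by (intro sum_mono) auto
  then show ?thesis by (simp add: sum.distrib sum_divide_distrib mult_ac)
qed

text \<open>The calibration argument in Euclidean space. For an orthonormal frame the sums of
  squares are the densities g(x', x') and g(y', y'), so the outer terms are the two energies. The
  middle term measures how far the competitor \<open>y\<close> is from \<open>x\<close> in L^2 and
  is what later gives uniqueness. \<open>W'\<close> stands for the derivative of the frame, and the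
  formula for \<xi>' is Hamilton's equation tested against vectors.\<close>

lemma energy_gap:
  fixes W :: "nat \<Rightarrow> 'a::euclidean_space \<Rightarrow> 'a" and W' :: "nat \<Rightarrow> 'a \<Rightarrow> 'a \<Rightarrow> 'a"
    and x y \<xi> \<xi>' :: "real \<Rightarrow> 'a" and u :: "nat \<Rightarrow> real \<Rightarrow> real"
  assumes L: "L \<ge> 0"
    and W: "\<And>i z. i < k \<Longrightarrow> z \<in> B \<Longrightarrow> norm (W i z) \<le> L"
      "\<And>i z w. i < k \<Longrightarrow> z \<in> B \<Longrightarrow> w \<in> B \<Longrightarrow> norm (W i w - W i z) \<le> L * norm (w - z)"
      "\<And>i z w. i < k \<Longrightarrow> z \<in> B \<Longrightarrow> w \<in> B \<Longrightarrow> norm (W i w - W i z - W' i z (w - z)) \<le> L * (norm (w - z))\<^sup>2"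
      "\<And>i z v. i < k \<Longrightarrow> z \<in> B \<Longrightarrow> norm (W' i z v) \<le> L * norm v"
    and ab: "a \<le> b" "(b - a) * (4 * real k * (L * (1 + M))\<^sup>2 + 2) \<le> 1"
    and xB: "\<And>t. t \<in> {a..b} \<Longrightarrow> x t \<in> B"
    and \<xi>M: "\<And>t. t \<in> {a..b} \<Longrightarrow> norm (\<xi> t) \<le> M"
    and dx: "\<And>t. t \<in> {a..b} \<Longrightarrow> (x has_vector_derivative (\<Sum>i<k. (\<xi> t \<bullet> W i (x t)) *\<^sub>R W i (x t))) (at t within {a..b})"
    and d\<xi>: "\<And>t. t \<in> {a..b} \<Longrightarrow> (\<xi> has_vector_derivative \<xi>' t) (at t within {a..b})"
    and \<xi>': "\<And>t v. t \<in> {a..b} \<Longrightarrow> \<xi>' t \<bullet> v = - (\<Sum>i<k. (\<xi> t \<bullet> W i (x t)) * (\<xi> t \<bullet> W' i (x t) v))"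
    and Wx: "(\<lambda>t. \<Sum>i<k. (\<xi> t \<bullet> W i (x t))\<^sup>2) integrable_on {a..b}"
    and yB: "\<And>t. t \<in> {a..b} \<Longrightarrow> y t \<in> B"
    and yl: "Cy-lipschitz_on {a..b} y"
    and N: "negligible N"
    and dy: "\<And>t. t \<in> {a..b} - N \<Longrightarrow> (y has_vector_derivative (\<Sum>i<k. u i t *\<^sub>R W i (y t))) (at t within {a..b})"
    and u: "(\<lambda>t. \<Sum>i<k. (u i t)\<^sup>2) integrable_on {a..b}"
    and ends: "y a = x a" "y b = x b"
  shows "integral {a..b} (\<lambda>t. \<Sum>i<k. (\<xi> t \<bullet> W i (x t))\<^sup>2) / 2 + integral {a..b} (\<lambda>t. (norm (y t - x t))\<^sup>2)
    \<le> integral {a..b} (\<lambda>t. \<Sum>i<k. (u i t)\<^sup>2) / 2"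
proof -
  define C where "C = 2 * real k * (L * (1 + M))\<^sup>2"
  \<comment> \<open>\<open>lam / 2 = C + 1\<close>: the part \<open>C\<close> absorbs the Taylor
    remainder, the part 1 leaves the term -|e|^2.\<close>
  define lam where "lam = 2 * C + 2"
  have C: "C \<ge> 0" by (simp add: C_def)
  have lam: "lam \<ge> 0" "(b - a) * lam \<le> 1" using C ab(2) by (auto simp: lam_def C_def algebra_simps)
  define x' where "x' t = (\<Sum>i<k. (\<xi> t \<bullet> W i (x t)) *\<^sub>R W i (x t))" for t
  define y' where "y' t = (\<Sum>i<k. u i t *\<^sub>R W i (y t))" for t
  have M: "M \<ge> 0" using \<xi>M[of a] ab(1) norm_ge_zero order_trans by (metis atLeastAtMost_iff order_refl)
  have inner: "\<bar>\<xi> t \<bullet> v\<bar> \<le> M * norm v" if "t \<in> {a..b}" for t v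
    using Cauchy_Schwarz_ineq2[of "\<xi> t" v] \<xi>M[OF that] by (meson mult_right_mono norm_ge_zero order_trans)
  have coef: "\<bar>\<xi> t \<bullet> W i (x t)\<bar> \<le> M * L" if "t \<in> {a..b}" "i < k" for t i
    using inner[OF that(1), of "W i (x t)"] W(1)[OF that(2) xB[OF that(1)]] M by (meson mult_left_mono order_trans)
  have xl: "(real k * (M * L * L))-lipschitz_on {a..b} x"
  proof (rule has_vector_derivative_lipschitz_on[OF dx])
    fix t assume t: "t \<in> {a..b}"
    have "norm (\<Sum>i<k. (\<xi> t \<bullet> W i (x t)) *\<^sub>R W i (x t)) \<le> (\<Sum>i<k. M * L * L)"
    proof (rule sum_norm_le)
      fix i assume "i \<in> {..<k}"
      then show "norm ((\<xi> t \<bullet> W i (x t)) *\<^sub>R W i (x t)) \<le> M * L * L"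
        using coef[OF t] W(1)[OF _ xB[OF t]] M L by (auto intro!: mult_mono)
    qed
    then show "norm (\<Sum>i<k. (\<xi> t \<bullet> W i (x t)) *\<^sub>R W i (x t)) \<le> real k * (M * L * L)" by simp
  qed (use M L in auto)
  have \<xi>l: "(real k * (M * L * (M * L)))-lipschitz_on {a..b} \<xi>"
  proof (rule has_vector_derivative_lipschitz_on[OF d\<xi>])
    fix t assume t: "t \<in> {a..b}"
    \<comment> \<open>\<xi>' is known only through its inner products; testing it against itself and
      cancelling one factor of its norm bounds it.\<close>
    have "norm (\<xi>' t) * norm (\<xi>' t) = \<xi>' t \<bullet> \<xi>' t" by (simp add: dot_square_norm power2_eq_square)
    also have "\<dots> \<le> \<bar>\<Sum>i<k. (\<xi> t \<bullet> W i (x t)) * (\<xi> t \<bullet> W' i (x t) (\<xi>' t))\<bar>"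
      using \<xi>'[OF t, of "\<xi>' t"] by linarith
    also have "\<dots> \<le> (\<Sum>i<k. M * L * (M * (L * norm (\<xi>' t))))"
    proof (rule order_trans[OF sum_abs sum_mono])
      fix i assume i: "i \<in> {..<k}"
      have "\<bar>\<xi> t \<bullet> W' i (x t) (\<xi>' t)\<bar> \<le> M * (L * norm (\<xi>' t))"
        using inner[OF t, of "W' i (x t) (\<xi>' t)"] W(4)[OF _ xB[OF t], of i "\<xi>' t"] i M
        by (meson lessThan_iff mult_left_mono order_trans)
      then show "\<bar>(\<xi> t \<bullet> W i (x t)) * (\<xi> t \<bullet> W' i (x t) (\<xi>' t))\<bar> \<le> M * L * (M * (L * norm (\<xi>' t)))"
        unfolding abs_mult using coef[OF t] i M L by (intro mult_mono) auto
    qed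
    also have "\<dots> = (real k * (M * L * (M * L))) * norm (\<xi>' t)" by simp
    finally have "norm (\<xi>' t) = 0 \<or> norm (\<xi>' t) \<le> real k * (M * L * (M * L))"
      by (metis mult_right_le_imp_le norm_ge_zero order_le_less)
    then show "norm (\<xi>' t) \<le> real k * (M * L * (M * L))" using M L by auto
  qed (use M L in auto)
  define e where "e t = y t - x t" for t
  define \<phi> where "\<phi> t = \<xi> t \<bullet> e t - lam / 2 * ((t - a) * (e t \<bullet> e t))" for t
  define \<phi>' where "\<phi>' t = \<xi>' t \<bullet> e t + \<xi> t \<bullet> (y' t - x' t) - lam / 2 * (e t \<bullet> e t) - lam * (t - a) * (e t \<bullet> (y' t - x' t))" for t
  \<comment> \<open>The derivative of \<phi> off the null set, completed by 0 as
    \<open>abs_cont_on_has_integral\<close> demands.\<close>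
  define G where "G t = (if t \<in> N then 0 else \<phi>' t)" for t
  have "\<exists>E. E-lipschitz_on {a..b} \<phi>"
  proof -
    have el: "(Cy + real k * (M * L * L))-lipschitz_on {a..b} e"
      unfolding e_def using yl xl by (rule lipschitz_on_diff)
    obtain E1 where E1: "E1-lipschitz_on {a..b} (\<lambda>t. \<xi> t \<bullet> e t)"
      using bounded_bilinear.lipschitz_on_Icc[OF bounded_bilinear_inner \<xi>l el] by blast
    obtain E2 where E2: "E2-lipschitz_on {a..b} (\<lambda>t. e t \<bullet> e t)"
      using bounded_bilinear.lipschitz_on_Icc[OF bounded_bilinear_inner el el] by blast
    have "1-lipschitz_on {a..b} (\<lambda>t. t - a)" by (rule lipschitz_onI) (auto simp: dist_real_def)
    from bounded_bilinear.lipschitz_on_Icc[OF bounded_bilinear_mult this E2]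
    obtain E3 where E3: "E3-lipschitz_on {a..b} (\<lambda>t. (t - a) * (e t \<bullet> e t))" by blast
    have "E-lipschitz_on {a..b} f \<Longrightarrow> (\<bar>lam / 2\<bar> * E)-lipschitz_on {a..b} (\<lambda>t. lam / 2 * f t)" for E and f :: "real \<Rightarrow> real"
      by (rule lipschitz_on_cmult_real)
    from lipschitz_on_diff[OF E1 this[OF E3]] show ?thesis unfolding \<phi>_def by blast
  qed
  then have ac: "abs_cont_on a b \<phi>" using lipschitz_imp_abs_cont_on by blast
  have "(G has_integral (\<phi> b - \<phi> a)) {a..b}"
  proof (rule abs_cont_on_has_integral[OF ab(1) ac N])
    fix t assume t: "t \<in> {a..b} - N"
    have de: "(e has_vector_derivative (y' t - x' t)) (at t within {a..b})"
      unfolding e_def y'_def x'_def using dy dx t by (intro has_vector_derivative_diff) auto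
    have i1: "((\<lambda>t. \<xi> t \<bullet> e t) has_vector_derivative (\<xi> t \<bullet> (y' t - x' t) + \<xi>' t \<bullet> e t)) (at t within {a..b})"
      using t by (intro bounded_bilinear.has_vector_derivative[OF bounded_bilinear_inner] d\<xi> de) auto
    have i2: "((\<lambda>t. e t \<bullet> e t) has_vector_derivative (e t \<bullet> (y' t - x' t) + (y' t - x' t) \<bullet> e t)) (at t within {a..b})"
      by (intro bounded_bilinear.has_vector_derivative[OF bounded_bilinear_inner] de)
    have i3: "((\<lambda>t. t - a) has_vector_derivative 1) (at t within {a..b})"
      by (auto intro!: derivative_eq_intros simp: has_real_derivative_iff_has_vector_derivative[symmetric])
    have i4: "((\<lambda>t. lam / 2 * ((t - a) * (e t \<bullet> e t))) has_vector_derivative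
        (lam / 2 * ((t - a) * (e t \<bullet> (y' t - x' t) + (y' t - x' t) \<bullet> e t) + 1 * (e t \<bullet> e t)))) (at t within {a..b})"
      by (intro has_vector_derivative_mult_right bounded_bilinear.has_vector_derivative[OF bounded_bilinear_mult] i3 i2)
    have "\<phi>' t = (\<xi> t \<bullet> (y' t - x' t) + \<xi>' t \<bullet> e t) -
        (lam / 2 * ((t - a) * (e t \<bullet> (y' t - x' t) + (y' t - x' t) \<bullet> e t) + 1 * (e t \<bullet> e t)))"
      unfolding \<phi>'_def by (simp add: inner_commute algebra_simps)
    then show "(\<phi> has_vector_derivative G t) (at t within {a..b})"
      unfolding \<phi>_def G_def using has_vector_derivative_diff[OF i1 i4] t by simp
  qed (simp add: G_def)
  moreover have "\<phi> a = 0" "\<phi> b = 0" using ends by (auto simp: \<phi>_def e_def)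
  ultimately have G0: "(G has_integral 0) {a..b}" by simp
  have bound: "\<phi>' t \<le> (\<Sum>i<k. (u i t)\<^sup>2) / 2 - (\<Sum>i<k. (\<xi> t \<bullet> W i (x t))\<^sup>2) / 2 - (norm (e t))\<^sup>2"
    if t: "t \<in> {a..b}" for t
  proof -
    \<comment> \<open>The gradient at z = y t of the calibrating function z \<mapsto> \<xi>
      \<bullet> (z - x) - \<lambda>/2 (t - a) |z - x|^2.\<close>
    define q where "q = \<xi> t - (lam * (t - a)) *\<^sub>R e t"
    have lt: "0 \<le> lam * (t - a)" "lam * (t - a) \<le> 1"
      using lam t mult_left_mono[of "t - a" "b - a" lam] by (auto simp: mult.commute)
    have q: "norm (q - \<xi> t) \<le> norm (y t - x t)"
      using lt by (auto simp: q_def e_def intro: mult_left_le_one_le)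
    have "q \<bullet> y' t = (\<Sum>i<k. u i t * (q \<bullet> W i (y t)))"
      by (simp add: y'_def inner_sum_right)
    also have "\<dots> \<le> (\<Sum>i<k. (u i t)\<^sup>2 / 2 + (q \<bullet> W i (y t))\<^sup>2 / 2)"
    proof (rule sum_mono)
      fix i
      show "u i t * (q \<bullet> W i (y t)) \<le> (u i t)\<^sup>2 / 2 + (q \<bullet> W i (y t))\<^sup>2 / 2"
        using sum_squares_bound[of "u i t" "q \<bullet> W i (y t)"] by simp
    qed
    also have "\<dots> = (\<Sum>i<k. (u i t)\<^sup>2) / 2 + (\<Sum>i<k. (q \<bullet> W i (y t))\<^sup>2) / 2"
      by (simp add: sum.distrib sum_divide_distrib)
    also have "(\<Sum>i<k. (q \<bullet> W i (y t))\<^sup>2) / 2 \<le> (\<Sum>i<k. (\<xi> t \<bullet> W i (x t))\<^sup>2) / 2 +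
        (\<Sum>i<k. (\<xi> t \<bullet> W i (x t)) * (\<xi> t \<bullet> W' i (x t) (y t - x t) + (q - \<xi> t) \<bullet> W i (x t))) +
        2 * real k * (L * (1 + M))\<^sup>2 * (norm (y t - x t))\<^sup>2"
      using W xB[OF t] yB[OF t] by (intro hamiltonian_taylor[OF L \<xi>M[OF t] q]) auto
    finally have 1: "q \<bullet> y' t \<le> (\<Sum>i<k. (u i t)\<^sup>2) / 2 + (\<Sum>i<k. (\<xi> t \<bullet> W i (x t))\<^sup>2) / 2 +
        (\<Sum>i<k. (\<xi> t \<bullet> W i (x t)) * (\<xi> t \<bullet> W' i (x t) (e t) + (q - \<xi> t) \<bullet> W i (x t))) + C * (norm (e t))\<^sup>2"
      by (simp add: C_def e_def)
    \<comment> \<open>Both Hamilton equations at once: the first-order part of the expansion of H is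
      -\<xi>' paired with the displacement plus the covector increment paired with x'.\<close>
    have 2: "(\<Sum>i<k. (\<xi> t \<bullet> W i (x t)) * (\<xi> t \<bullet> W' i (x t) (e t) + (q - \<xi> t) \<bullet> W i (x t)))
        = - (\<xi>' t \<bullet> e t) + (q - \<xi> t) \<bullet> x' t"
      by (simp add: \<xi>'[OF t] x'_def inner_sum_right distrib_left sum.distrib)
    \<comment> \<open>Euler's relation \<xi> \<bullet> x' = 2 H. It turns the + H of the Taylor
      estimate into - H, the energy density of the extremal with the right sign.\<close>
    have 3: "\<xi> t \<bullet> x' t = (\<Sum>i<k. (\<xi> t \<bullet> W i (x t))\<^sup>2)"
      by (simp add: x'_def inner_sum_right power2_eq_square)
    have "\<phi>' t = \<xi>' t \<bullet> e t + q \<bullet> y' t - q \<bullet> x' t - lam / 2 * (norm (e t))\<^sup>2"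
      unfolding \<phi>'_def q_def
      by (simp add: inner_diff_left inner_diff_right dot_square_norm algebra_simps)
    moreover have "lam / 2 * (norm (e t))\<^sup>2 = C * (norm (e t))\<^sup>2 + (norm (e t))\<^sup>2"
      by (simp add: lam_def algebra_simps)
    moreover have "(q - \<xi> t) \<bullet> x' t = q \<bullet> x' t - \<xi> t \<bullet> x' t" by (simp add: inner_diff_left)
    ultimately show ?thesis using 1 2 3 by (simp add: field_simps)
  qed
  have e2: "(\<lambda>t. (norm (e t))\<^sup>2) integrable_on {a..b}"
    unfolding e_def using lipschitz_on_continuous_on[OF yl] lipschitz_on_continuous_on[OF xl]
    by (intro integrable_continuous_real continuous_intros)
  let ?R = "\<lambda>t. (\<Sum>i<k. (u i t)\<^sup>2) / 2 - (\<Sum>i<k. (\<xi> t \<bullet> W i (x t))\<^sup>2) / 2 - (norm (e t))\<^sup>2"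
  have "(?R has_integral (integral {a..b} (\<lambda>t. \<Sum>i<k. (u i t)\<^sup>2) / 2 -
      integral {a..b} (\<lambda>t. \<Sum>i<k. (\<xi> t \<bullet> W i (x t))\<^sup>2) / 2 - integral {a..b} (\<lambda>t. (norm (e t))\<^sup>2))) {a..b}"
    using u Wx e2 by (intro has_integral_diff has_integral_divide) (auto simp: has_integral_integral)
  then have "((\<lambda>t. if t \<in> N then 0 else ?R t) has_integral (integral {a..b} (\<lambda>t. \<Sum>i<k. (u i t)\<^sup>2) / 2 -
      integral {a..b} (\<lambda>t. \<Sum>i<k. (\<xi> t \<bullet> W i (x t))\<^sup>2) / 2 - integral {a..b} (\<lambda>t. (norm (e t))\<^sup>2))) {a..b}"
    by (rule has_integral_spike[OF N, rotated]) simp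
  from has_integral_le[OF G0 this] have "0 \<le> integral {a..b} (\<lambda>t. \<Sum>i<k. (u i t)\<^sup>2) / 2 -
      integral {a..b} (\<lambda>t. \<Sum>i<k. (\<xi> t \<bullet> W i (x t))\<^sup>2) / 2 - integral {a..b} (\<lambda>t. (norm (e t))\<^sup>2)"
    using bound by (simp add: G_def)
  then show ?thesis unfolding e_def by linarith
qed

section \<open>Orthonormal frames\<close>

lemma chart_open_image:
  assumes "is_chart c" "open V"
  shows "open (chmap c ` (chdom c \<inter> V))"
proof -
  have "openin (top_of_set (chmap c ` chdom c)) (chmap c ` (chdom c \<inter> V))"
    using assms by (intro homeomorphism_imp_open_map[of "chdom c" _ _ "chinv c"])
      (auto simp: is_chart_def openin_open)
  then show ?thesis using assms(1) openin_open_trans unfolding is_chart_def by blast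
qed

lemma chinv_chmap: "is_chart c \<Longrightarrow> q \<in> chdom c \<Longrightarrow> chinv c (chmap c q) = q"
  by (meson homeomorphism_apply1 is_chart_def)

lemma transition_differentiable:
  assumes "smooth_atlas A" "c \<in> A" "c' \<in> A" "q \<in> chdom c \<inter> chdom c'"
  shows "transition c c' differentiable at (chmap c q)"
proof -
  have "Ck_on (Suc 0) (chmap c ` (chdom c \<inter> chdom c')) (transition c c')"
    using assms(1-3) unfolding smooth_atlas_def smooth_on_def by blast
  then show ?thesis using assms(4) by auto
qed

section \<open>Tangent vectors and smooth vector fields through their components\<close>

lemma comps_zero [simp]: "comps 0 c = 0"
  and comps_add [simp]: "comps (v + w) c = comps v c + comps w c"
  and comps_diff [simp]: "comps (v - w) c = comps v c - comps w c"
  and comps_scaleR [simp]: "comps (r *\<^sub>R v) c = r *\<^sub>R comps v c"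
  by (simp_all add: zero_tvec_def plus_tvec_def minus_tvec_def scaleR_tvec_def)

lemma comps_sum [simp]: "comps (\<Sum>i\<in>I. f i) c = (\<Sum>i\<in>I. comps (f i) c)"
  by (induction I rule: infinite_finite_induct) auto

lemma tangent_space_transform:
  assumes "v \<in> tangent_space A q" "c \<in> A" "c' \<in> A" "q \<in> chdom c" "q \<in> chdom c'"
  shows "comps v c' = frechet_derivative (transition c c') (at (chmap c q)) (comps v c)"
  using assms unfolding tangent_space_def by blast

lemma tangent_space_comps_outside:
  "v \<in> tangent_space A q \<Longrightarrow> \<not> (c \<in> A \<and> q \<in> chdom c) \<Longrightarrow> comps v c = 0"
  unfolding tangent_space_def by blast

lemma tangent_spaceI:
  assumes "\<And>c. \<not> (c \<in> A \<and> q \<in> chdom c) \<Longrightarrow> comps v c = 0"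
    and "\<And>c c'. c \<in> A \<Longrightarrow> c' \<in> A \<Longrightarrow> q \<in> chdom c \<Longrightarrow> q \<in> chdom c' \<Longrightarrow>
      comps v c' = frechet_derivative (transition c c') (at (chmap c q)) (comps v c)"
  shows "v \<in> tangent_space A q"
  using assms unfolding tangent_space_def by blast

text \<open>The compatibility condition is linear because the Jacobians are, and
  \<open>frechet_derivative\<close> is known to be linear only where the transition map is
  differentiable. Here the smoothness of the atlas enters.\<close>

lemma subspace_tangent_space:
  assumes "smooth_atlas A"
  shows "subspace (tangent_space A q)"
proof -
  have lin: "linear (frechet_derivative (transition c c') (at (chmap c q)))"
    if "c \<in> A" "c' \<in> A" "q \<in> chdom c" "q \<in> chdom c'" for c c'
    by (rule linear_frechet_derivative[OF transition_differentiable[OF assms]]) (use that in auto)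
  show ?thesis
  proof (rule subspaceI)
    show "0 \<in> tangent_space A q"
      by (rule tangent_spaceI) (simp_all add: linear_0[OF lin])
    fix v w assume v: "v \<in> tangent_space A q" and w: "w \<in> tangent_space A q"
    show "v + w \<in> tangent_space A q"
    proof (rule tangent_spaceI)
      fix c c' assume c: "c \<in> A" "c' \<in> A" "q \<in> chdom c" "q \<in> chdom c'"
      show "comps (v + w) c' = frechet_derivative (transition c c') (at (chmap c q)) (comps (v + w) c)"
        unfolding comps_add linear_add[OF lin[OF c]] tangent_space_transform[OF v c] tangent_space_transform[OF w c] ..
    qed (simp add: tangent_space_comps_outside[OF v] tangent_space_comps_outside[OF w])
  next
    fix r v assume v: "v \<in> tangent_space A q"
    show "r *\<^sub>R v \<in> tangent_space A q"
    proof (rule tangent_spaceI)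
      fix c c' assume c: "c \<in> A" "c' \<in> A" "q \<in> chdom c" "q \<in> chdom c'"
      show "comps (r *\<^sub>R v) c' = frechet_derivative (transition c c') (at (chmap c q)) (comps (r *\<^sub>R v) c)"
        unfolding comps_scaleR linear_cmul[OF lin[OF c]] tangent_space_transform[OF v c] ..
    qed (simp add: tangent_space_comps_outside[OF v])
  qed
qed

text \<open>The components in all other charts are Jacobian images of those in \<open>c\<close>, or
  0 by convention.\<close>

lemma tangent_space_eqI:
  assumes "v \<in> tangent_space A q" "w \<in> tangent_space A q" "c \<in> A" "q \<in> chdom c"
    and "comps v c = comps w c"
  shows "v = w"
  unfolding tvec_eq_iff
proof
  fix c'
  show "comps v c' = comps w c'"
  proof (cases "c' \<in> A \<and> q \<in> chdom c'")
    case True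
    then show ?thesis
      using tangent_space_transform[OF assms(1,3) _ assms(4)] tangent_space_transform[OF assms(2,3) _ assms(4)] assms(5)
      by simp
  next
    case False
    then show ?thesis using tangent_space_comps_outside assms(1,2) by metis
  qed
qed

lemma smooth_vector_field_on_diff:
  assumes "smooth_atlas A" "open V" "smooth_vector_field_on A V X" "smooth_vector_field_on A V Y"
  shows "smooth_vector_field_on A V (\<lambda>q. X q - Y q)"
  unfolding smooth_vector_field_on_def
proof (intro conjI ballI)
  fix q assume "q \<in> V"
  then show "X q - Y q \<in> tangent_space A q"
    using assms by (auto simp: smooth_vector_field_on_def intro!: subspace_diff subspace_tangent_space)
next
  fix c assume c: "c \<in> A"
  let ?U = "chmap c ` (chdom c \<inter> V)"
  have U: "open ?U" using assms c by (auto simp: smooth_atlas_def intro: chart_open_image)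
  have "Ck_on n ?U (\<lambda>x. comps (X (chinv c x)) c + (-1) *\<^sub>R comps (Y (chinv c x)) c)" for n
    using assms c by (intro Ck_on_add bounded_bilinear.Ck_on[OF bounded_bilinear_scaleR] Ck_on_const U)
      (auto simp: smooth_vector_field_on_def smooth_on_def)
  then show "smooth_on ?U (\<lambda>x. comps (X (chinv c x) - Y (chinv c x)) c)"
    by (simp add: smooth_on_def)
qed

lemma smooth_vector_field_on_scaleR:
  assumes "smooth_atlas A" "open V" "smooth_fun_on A V f" "smooth_vector_field_on A V X"
  shows "smooth_vector_field_on A V (\<lambda>q. f q *\<^sub>R X q)"
  unfolding smooth_vector_field_on_def
proof (intro conjI ballI)
  fix q assume "q \<in> V"
  then show "f q *\<^sub>R X q \<in> tangent_space A q"
    using assms by (auto simp: smooth_vector_field_on_def intro!: subspace_scale subspace_tangent_space)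
next
  fix c assume c: "c \<in> A"
  let ?U = "chmap c ` (chdom c \<inter> V)"
  have U: "open ?U" using assms c by (auto simp: smooth_atlas_def intro: chart_open_image)
  have "Ck_on n ?U (\<lambda>x. f (chinv c x) *\<^sub>R comps (X (chinv c x)) c)" for n
    using assms c by (intro bounded_bilinear.Ck_on[OF bounded_bilinear_scaleR] U)
      (auto simp: smooth_vector_field_on_def smooth_on_def smooth_fun_on_def comp_def)
  then show "smooth_on ?U (\<lambda>x. comps (f (chinv c x) *\<^sub>R X (chinv c x)) c)"
    by (simp add: smooth_on_def)
qed

text \<open>This is the shape of a Gram-Schmidt residual. The induction subtracts one term at a time
  and starts from \<open>X\<close> itself.\<close>

lemma smooth_vector_field_on_diff_sum:
  assumes "smooth_atlas A" "open V" "smooth_vector_field_on A V X"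
    and "\<And>i. i < m \<Longrightarrow> smooth_fun_on A V (f i)" "\<And>i. i < m \<Longrightarrow> smooth_vector_field_on A V (Y i)"
  shows "smooth_vector_field_on A V (\<lambda>q. X q - (\<Sum>i<(m::nat). f i q *\<^sub>R Y i q))"
  using assms(4,5)
proof (induction m)
  case (Suc m)
  have "smooth_vector_field_on A V (\<lambda>q. (X q - (\<Sum>i<m. f i q *\<^sub>R Y i q)) - f m q *\<^sub>R Y m q)"
    by (intro smooth_vector_field_on_diff[OF assms(1,2)] smooth_vector_field_on_scaleR[OF assms(1,2)] Suc) (use Suc in auto)
  then show ?case by (simp add: algebra_simps)
qed (use assms(3) in simp)

lemma smooth_fun_on_inverse_sqrt:
  assumes "smooth_atlas A" "open V" "smooth_fun_on A V f" "\<And>q. q \<in> V \<Longrightarrow> f q > 0"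
  shows "smooth_fun_on A V (\<lambda>q. inverse (sqrt (f q)))"
  unfolding smooth_fun_on_def smooth_on_def
proof (intro ballI allI)
  fix c n assume c: "c \<in> A"
  then have ch: "is_chart c" using assms(1) by (auto simp: smooth_atlas_def)
  have "Ck_on n (chmap c ` (chdom c \<inter> V)) (\<lambda>x. inverse (sqrt (f (chinv c x))))"
    using assms c by (intro Ck_on_inverse_sqrt chart_open_image ch)
      (auto simp: smooth_fun_on_def smooth_on_def chinv_chmap[OF ch] comp_def)
  then show "Ck_on n (chmap c ` (chdom c \<inter> V)) ((\<lambda>q. inverse (sqrt (f q))) \<circ> chinv c)"
    by (simp add: comp_def)
qed

section \<open>Linear algebra of an inner product given on a subspace only\<close>

text \<open>A vector outside the span of its predecessors is in particular different from them, so
  the family has no repetitions. The count is what the dimension argument for orthonormal expansions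
  needs.\<close>

lemma independent_sequence:
  fixes e :: "nat \<Rightarrow> 'v::real_vector"
  assumes "\<And>i. i < m \<Longrightarrow> e i \<notin> span (e ` {..<i})"
  shows "independent (e ` {..<m}) \<and> card (e ` {..<m}) = m"
  using assms
proof (induction m)
  case (Suc m)
  then have "independent (e ` {..<m})" "card (e ` {..<m}) = m" "e m \<notin> span (e ` {..<m})" by auto
  moreover have "e m \<notin> e ` {..<m}" using \<open>e m \<notin> span (e ` {..<m})\<close> span_base[of "e m"] by metis
  ultimately show ?case by (simp add: lessThan_Suc independent_insert)
qed (simp add: independent_empty)

context
  fixes E :: "'v::real_vector set" and b :: "'v \<Rightarrow> 'v \<Rightarrow> real"
  assumes E: "subspace E" and ip: "inner_product_on E b"
begin

lemma ip_sym: "u \<in> E \<Longrightarrow> v \<in> E \<Longrightarrow> b u v = b v u"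
  using ip[unfolded inner_product_on_def, THEN conjunct1] by blast

lemma ip_add: "u \<in> E \<Longrightarrow> v \<in> E \<Longrightarrow> w \<in> E \<Longrightarrow> b (u + v) w = b u w + b v w"
  using ip[unfolded inner_product_on_def, THEN conjunct2, THEN conjunct1] by blast

lemma ip_scale: "u \<in> E \<Longrightarrow> v \<in> E \<Longrightarrow> b (r *\<^sub>R u) v = r * b u v"
  using ip[unfolded inner_product_on_def, THEN conjunct2, THEN conjunct2, THEN conjunct1] by blast

lemma ip_pos: "u \<in> E \<Longrightarrow> u \<noteq> 0 \<Longrightarrow> b u u > 0"
  using ip[unfolded inner_product_on_def, THEN conjunct2, THEN conjunct2, THEN conjunct2] by blast

lemma ip_zero: "v \<in> E \<Longrightarrow> b 0 v = 0"
  using ip_scale[of v v 0] by simp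

lemma ip_diff: "u \<in> E \<Longrightarrow> v \<in> E \<Longrightarrow> w \<in> E \<Longrightarrow> b (u - v) w = b u w - b v w"
  using ip_add[of u "(-1) *\<^sub>R v" w] ip_scale[of v w "-1"] E by (auto simp: subspace_scale subspace_neg)

lemma ip_sum: "(\<And>i. i \<in> I \<Longrightarrow> u i \<in> E) \<Longrightarrow> w \<in> E \<Longrightarrow> b (\<Sum>i\<in>I. u i) w = (\<Sum>i\<in>I. b (u i) w)"
  by (induction I rule: infinite_finite_induct) (auto simp: ip_zero ip_add subspace_sum[OF E])

lemma ip_zero_on_span:
  assumes "S \<subseteq> E" "w \<in> E" "\<And>v. v \<in> S \<Longrightarrow> b v w = 0" "v \<in> span S"
  shows "b v w = 0"
proof -
  have "subspace {v \<in> E. b v w = 0}"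
    using assms(2) subspace_0[OF E] subspace_add[OF E] subspace_scale[OF E]
    by (intro subspaceI) (auto simp: ip_zero ip_add ip_scale)
  then show ?thesis using span_minimal[of S "{v \<in> E. b v w = 0}"] assms by blast
qed

lemma ip_orthonormal_sum:
  assumes "\<And>i. i < k \<Longrightarrow> X i \<in> E" "\<And>i j. i < k \<Longrightarrow> j < k \<Longrightarrow> b (X i) (X j) = (if i = j then 1 else 0)"
    and "j < (k::nat)"
  shows "b (\<Sum>i<k. c i *\<^sub>R X i) (X j) = c j"
proof -
  have "b (\<Sum>i<k. c i *\<^sub>R X i) (X j) = (\<Sum>i<k. b (c i *\<^sub>R X i) (X j))"
    using assms by (intro ip_sum subspace_scale[OF E]) auto
  also have "\<dots> = (\<Sum>i<k. if i = j then c j else 0)"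
    using assms by (intro sum.cong) (auto simp: ip_scale)
  finally show ?thesis using assms(3) by simp
qed

lemma ip_orthonormal_norm:
  assumes "\<And>i. i < k \<Longrightarrow> X i \<in> E" "\<And>i j. i < k \<Longrightarrow> j < k \<Longrightarrow> b (X i) (X j) = (if i = j then 1 else 0)"
  shows "b (\<Sum>i<k. c i *\<^sub>R X i) (\<Sum>i<k. c i *\<^sub>R X i) = (\<Sum>i<(k::nat). (c i)\<^sup>2)"
proof -
  let ?s = "\<Sum>i<k. c i *\<^sub>R X i"
  have s: "?s \<in> E" using assms(1) by (intro subspace_sum[OF E] subspace_scale[OF E]) auto
  have "b ?s ?s = (\<Sum>i<k. b (c i *\<^sub>R X i) ?s)"
    using assms(1) s by (intro ip_sum subspace_scale[OF E]) auto
  also have "\<dots> = (\<Sum>i<k. (c i)\<^sup>2)"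
    using assms s ip_orthonormal_sum[OF assms, where c = c]
    by (intro sum.cong) (auto simp: ip_scale ip_sym[of _ ?s] power2_eq_square)
  finally show ?thesis .
qed

lemma ip_orthonormal_not_in_span:
  assumes "\<And>i. i < k \<Longrightarrow> X i \<in> E" "\<And>i j. i < k \<Longrightarrow> j < k \<Longrightarrow> b (X i) (X j) = (if i = j then 1 else 0)"
    and "i < (k::nat)"
  shows "X i \<notin> span (X ` {..<i})"
proof
  assume "X i \<in> span (X ` {..<i})"
  then have "b (X i) (X i) = 0"
    by (rule ip_zero_on_span[of "X ` {..<i}", rotated 3]) (use assms in auto)
  then show False using assms by auto
qed

text \<open>Completeness by counting: a non-zero residual would be orthogonal to all
  \<open>X i\<close>, and together they would be k + 1 independent vectors in the span of at most k
  vectors.\<close>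

lemma ip_orthonormal_expansion:
  assumes "\<And>i. i < k \<Longrightarrow> X i \<in> E" "\<And>i j. i < k \<Longrightarrow> j < k \<Longrightarrow> b (X i) (X j) = (if i = j then 1 else 0)"
    and F: "finite F" "card F \<le> k" "E \<subseteq> span F" and v: "v \<in> E"
  shows "v = (\<Sum>i<(k::nat). b v (X i) *\<^sub>R X i)"
proof (rule ccontr)
  assume neq: "v \<noteq> (\<Sum>i<k. b v (X i) *\<^sub>R X i)"
  define w where "w = v - (\<Sum>i<k. b v (X i) *\<^sub>R X i)"
  have sE: "(\<Sum>i<k. b v (X i) *\<^sub>R X i) \<in> E" using assms(1) by (intro subspace_sum[OF E] subspace_scale[OF E]) auto
  have w: "w \<in> E" "w \<noteq> 0" using neq v sE by (auto simp: w_def subspace_diff[OF E])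
  have "b w (X j) = 0" if "j < k" for j
    using that v sE assms(1) ip_orthonormal_sum[OF assms(1,2) that, of "\<lambda>i. b v (X i)"] by (simp add: w_def ip_diff)
  then have perp: "b (X j) w = 0" if "j < k" for j
    using that w assms(1) ip_sym by metis
  have wn: "w \<notin> span (X ` {..<k})"
  proof
    assume "w \<in> span (X ` {..<k})"
    then have "b w w = 0"
      by (rule ip_zero_on_span[of "X ` {..<k}", rotated 3]) (use assms(1) w perp in auto)
    then show False using ip_pos[OF w] by simp
  qed
  \<comment> \<open>The orthonormal vectors with the residual appended at index
    \<open>k\<close>.\<close>
  define e where "e i = (if i < k then X i else w)" for i
  have im: "e ` {..<i} = X ` {..<i}" if "i \<le> k" for i
    using that by (intro image_cong) (auto simp: e_def)
  have "e i \<notin> span (e ` {..<i})" if "i < Suc k" for i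
  proof (cases "i < k")
    case True
    then show ?thesis
      using ip_orthonormal_not_in_span[OF assms(1,2) True] im[of i] e_def[of i] by simp
  next
    case False
    then have "i = k" using that by simp
    then show ?thesis using wn im[of k] e_def[of k] by simp
  qed
  from independent_sequence[of "Suc k" e, OF this]
  have "independent (e ` {..<Suc k})" "card (e ` {..<Suc k}) = Suc k" by auto
  moreover have "e ` {..<Suc k} \<subseteq> span F" using F(3) w assms(1) by (auto simp: e_def)
  ultimately show False using independent_span_bound[OF F(1)] F(2) by fastforce
qed

end

section \<open>Existence of local orthonormal frames\<close>

text \<open>Gram-Schmidt done with fields. The coefficients are smooth by the smoothness of the
  metric on sections of \<open>D\<close>. The claim that \<open>Y\<close> stays in the span of
  \<open>X\<close> is there for the induction: it forces the next residual to be non-zero, hence of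
  positive length, so that it can be normalized smoothly.\<close>

lemma gram_schmidt_fields:
  assumes A: "smooth_atlas A" and met: "smooth_metric_on_distribution A D g"
    and D: "\<And>q. q \<in> V \<Longrightarrow> subspace (D q)" and V: "open V"
    and X: "\<And>i. i < m \<Longrightarrow> smooth_vector_field_on A V (X i)" "\<And>i q. i < m \<Longrightarrow> q \<in> V \<Longrightarrow> X i q \<in> D q"
    and ind: "\<And>i q. i < m \<Longrightarrow> q \<in> V \<Longrightarrow> X i q \<notin> span ((\<lambda>j. X j q) ` {..<i})"
  shows "\<exists>Y. (\<forall>i<m. smooth_vector_field_on A V (Y i)) \<and>
    (\<forall>q\<in>V. \<forall>i<(m::nat). Y i q \<in> D q \<and> Y i q \<in> span ((\<lambda>j. X j q) ` {..<m}) \<and>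
      (\<forall>j<m. g q (Y i q) (Y j q) = (if i = j then 1 else 0)))"
  using X ind
proof (induction m)
  case 0
  then show ?case by simp
next
  case (Suc m)
  have "\<exists>Y. (\<forall>i<m. smooth_vector_field_on A V (Y i)) \<and>
    (\<forall>q\<in>V. \<forall>i<m. Y i q \<in> D q \<and> Y i q \<in> span ((\<lambda>j. X j q) ` {..<m}) \<and>
      (\<forall>j<m. g q (Y i q) (Y j q) = (if i = j then 1 else 0)))"
    by (rule Suc.IH) (use Suc.prems less_SucI in blast)+
  then obtain Y where Y: "\<And>i. i < m \<Longrightarrow> smooth_vector_field_on A V (Y i)"
    "\<And>q i. q \<in> V \<Longrightarrow> i < m \<Longrightarrow> Y i q \<in> D q"
    "\<And>q i. q \<in> V \<Longrightarrow> i < m \<Longrightarrow> Y i q \<in> span ((\<lambda>j. X j q) ` {..<m})"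
    "\<And>q i j. q \<in> V \<Longrightarrow> i < m \<Longrightarrow> j < m \<Longrightarrow> g q (Y i q) (Y j q) = (if i = j then 1 else 0)"
    by blast
  have ip: "inner_product_on (D q) (g q)" for q using met by (simp add: smooth_metric_on_distribution_def)
  have gs: "smooth_fun_on A V (\<lambda>q. g q (F q) (G q))"
    if "smooth_vector_field_on A V F" "smooth_vector_field_on A V G" "\<And>q. q \<in> V \<Longrightarrow> F q \<in> D q" "\<And>q. q \<in> V \<Longrightarrow> G q \<in> D q" for F G
    using met that V unfolding smooth_metric_on_distribution_def by blast
  have Xm: "smooth_vector_field_on A V (X m)" "\<And>q. q \<in> V \<Longrightarrow> X m q \<in> D q" using Suc.prems by auto
  define P where "P q = (\<Sum>i<m. g q (X m q) (Y i q) *\<^sub>R Y i q)" for q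
  define R where "R q = X m q - P q" for q
  have PD: "P q \<in> D q" if "q \<in> V" for q
    unfolding P_def using Y that D by (intro subspace_sum subspace_scale) auto
  have RD: "R q \<in> D q" if "q \<in> V" for q
    unfolding R_def using PD Xm that D by (intro subspace_diff) auto
  have Psp: "P q \<in> span ((\<lambda>j. X j q) ` {..<m})" if "q \<in> V" for q
    unfolding P_def using Y(3)[OF that] by (intro span_sum span_scale) auto
  have R0: "R q \<noteq> 0" if "q \<in> V" for q
    using Psp[OF that] Suc.prems(3)[of m, OF _ that] by (auto simp: R_def)
  have Rpos: "g q (R q) (R q) > 0" if "q \<in> V" for q
    using ip_pos[OF D ip RD R0] that by blast
  have Rsm: "smooth_vector_field_on A V R"
    unfolding R_def P_def using Y Xm gs by (intro smooth_vector_field_on_diff_sum A V) auto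
  have RY: "g q (R q) (Y j q) = 0" if "q \<in> V" "j < m" for q j
  proof -
    have "g q (R q) (Y j q) = g q (X m q) (Y j q) - g q (P q) (Y j q)"
      unfolding R_def using that Xm Y PD by (intro ip_diff[OF D ip]) auto
    also have "g q (P q) (Y j q) = g q (X m q) (Y j q)"
      unfolding P_def using that Y by (intro ip_orthonormal_sum[OF D ip]) auto
    finally show ?thesis by simp
  qed
  define r where "r q = inverse (sqrt (g q (R q) (R q)))" for q
  define Ym where "Ym q = r q *\<^sub>R R q" for q
  have YmD: "Ym q \<in> D q" if "q \<in> V" for q unfolding Ym_def using RD that D by (intro subspace_scale) auto
  have Ymsm: "smooth_vector_field_on A V Ym"
    unfolding Ym_def r_def using gs[OF Rsm Rsm RD RD] Rpos
    by (intro smooth_vector_field_on_scaleR A V smooth_fun_on_inverse_sqrt Rsm) auto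
  have YmY: "g q (Ym q) (Y j q) = 0" "g q (Y j q) (Ym q) = 0" if "q \<in> V" "j < m" for q j
  proof -
    show "g q (Ym q) (Y j q) = 0"
      unfolding Ym_def using that RY ip_scale[OF D ip RD Y(2)] by simp
    then show "g q (Y j q) (Ym q) = 0"
      using ip_sym[OF D ip YmD Y(2)] that by simp
  qed
  have YmYm: "g q (Ym q) (Ym q) = 1" if "q \<in> V" for q
  proof -
    have "g q (Ym q) (Ym q) = r q * g q (R q) (Ym q)"
      unfolding Ym_def[of q] using that D RD by (intro ip_scale[OF D ip] subspace_scale) auto
    also have "g q (R q) (Ym q) = r q * g q (R q) (R q)"
      using ip_sym[OF D ip RD YmD] ip_scale[OF D ip RD RD, where r = "r q"] that by (simp add: Ym_def)
    finally show ?thesis using Rpos[OF that] by (simp add: r_def field_simps)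
  qed
  have mono: "span ((\<lambda>j. X j q) ` {..<m}) \<subseteq> span ((\<lambda>j. X j q) ` {..<Suc m})" for q
    by (intro span_mono image_mono) auto
  have Ysp: "Y i q \<in> span ((\<lambda>j. X j q) ` {..<Suc m})" if "q \<in> V" "i < m" for i q
    using Y(3)[OF that] mono by blast
  have Ymsp: "Ym q \<in> span ((\<lambda>j. X j q) ` {..<Suc m})" if "q \<in> V" for q
    unfolding Ym_def R_def using Psp[OF that] mono by (intro span_scale span_diff) (auto intro: span_base)
  show ?case
    by (rule exI[of _ "\<lambda>i. if i < m then Y i else Ym"])
      (use Y Ymsm YmD YmY YmYm Ysp Ymsp in \<open>auto simp: less_Suc_eq\<close>)
qed

lemma orthonormal_frame_exists:
  assumes "subriemannian_structure A k D g"
  shows "\<exists>V X. orthonormal_frame_on A k D g V X \<and> q \<in> V"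
proof -
  have A: "smooth_atlas A" and dis: "smooth_distribution A k D" and met: "smooth_metric_on_distribution A D g"
    using assms by (auto simp: subriemannian_structure_def)
  obtain V X where V: "open V" "q \<in> V" and X: "\<And>i. i < k \<Longrightarrow> smooth_vector_field_on A V (X i)"
    and DX: "\<And>q. q \<in> V \<Longrightarrow> D q = span {X i q | i. i < k}"
    using dis unfolding smooth_distribution_def by meson
  have D: "subspace (D q)" "dim (D q) = k" for q using dis by (auto simp: smooth_distribution_def)
  have eq: "{X i q | i. i < k} = (\<lambda>j. X j q) ` {..<k}" for q by auto
  have XD: "X i q \<in> D q" if "i < k" "q \<in> V" for i q
    unfolding DX[OF that(2)] by (rule span_base) (use that(1) in blast)
  \<comment> \<open>If one generator were a combination of earlier ones, k - 1 of the fields would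
    already span a space of dimension k.\<close>
  have ind: "X i q \<notin> span ((\<lambda>j. X j q) ` {..<i})" if i: "i < k" and q: "q \<in> V" for i q
  proof
    assume "X i q \<in> span ((\<lambda>j. X j q) ` {..<i})"
    then have "X i q \<in> span ((\<lambda>j. X j q) ` ({..<k} - {i}))"
      using span_mono[of "(\<lambda>j. X j q) ` {..<i}" "(\<lambda>j. X j q) ` ({..<k} - {i})"] i by force
    moreover have "X j q \<in> span ((\<lambda>j. X j q) ` ({..<k} - {i}))" if "j < k" "j \<noteq> i" for j
      using that by (intro span_base) auto
    ultimately have "(\<lambda>j. X j q) ` {..<k} \<subseteq> span ((\<lambda>j. X j q) ` ({..<k} - {i}))" by auto
    then have "D q \<subseteq> span ((\<lambda>j. X j q) ` ({..<k} - {i}))"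
      unfolding DX[OF q] eq by (simp add: span_minimal)
    from dim_le_card[OF this] have "dim (D q) \<le> card ((\<lambda>j. X j q) ` ({..<k} - {i}))" by simp
    also have "\<dots> \<le> card ({..<k} - {i})" by (intro card_image_le) auto
    finally show False using D(2) i by simp
  qed
  have "\<exists>Y. (\<forall>i<k. smooth_vector_field_on A V (Y i)) \<and>
    (\<forall>q\<in>V. \<forall>i<k. Y i q \<in> D q \<and> Y i q \<in> span ((\<lambda>j. X j q) ` {..<k}) \<and>
      (\<forall>j<k. g q (Y i q) (Y j q) = (if i = j then 1 else 0)))"
    by (rule gram_schmidt_fields[OF A met D(1) V(1)]) (rule X XD ind; assumption)+
  then obtain Y where Y: "\<forall>i<k. smooth_vector_field_on A V (Y i)"
    "\<forall>q\<in>V. \<forall>i<k. Y i q \<in> D q \<and> Y i q \<in> span ((\<lambda>j. X j q) ` {..<k}) \<and>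
      (\<forall>j<k. g q (Y i q) (Y j q) = (if i = j then 1 else 0))"
    by (elim exE conjE)
  have "orthonormal_frame_on A k D g V Y"
    unfolding orthonormal_frame_on_def using V(1) Y by simp
  then show ?thesis using V(2) by blast
qed

text \<open>The counting argument needs a spanning set of at most \<open>k\<close> vectors; the
  local generators of the distribution provide it.\<close>

lemma orthonormal_frame_expansion:
  assumes "subriemannian_structure A k D g" "orthonormal_frame_on A k D g V X" "q \<in> V" "v \<in> D q"
  shows "v = (\<Sum>i<k. g q v (X i q) *\<^sub>R X i q)"
proof -
  have dis: "smooth_distribution A k D" and ip: "inner_product_on (D q) (g q)"
    using assms by (auto simp: subriemannian_structure_def smooth_metric_on_distribution_def)
  obtain Z where Z: "D q = span {Z i q | i. i < k}"
    using dis unfolding smooth_distribution_def by meson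
  have eq: "{Z i q | i. i < k} = (\<lambda>j. Z j q) ` {..<k}" by auto
  show ?thesis
  proof (rule ip_orthonormal_expansion[OF _ ip, where F = "(\<lambda>j. Z j q) ` {..<k}"])
    show "subspace (D q)" using dis by (auto simp: smooth_distribution_def)
    show "card ((\<lambda>j. Z j q) ` {..<k}) \<le> k" using card_image_le[of "{..<k}" "\<lambda>j. Z j q"] by simp
    show "D q \<subseteq> span ((\<lambda>j. Z j q) ` {..<k})" using Z eq by simp
  qed (use assms in \<open>auto simp: orthonormal_frame_on_def\<close>)
qed

lemma orthonormal_frame_norm:
  assumes "subriemannian_structure A k D g" "orthonormal_frame_on A k D g V X" "q \<in> V"
  shows "g q (\<Sum>i<k. c i *\<^sub>R X i q) (\<Sum>i<k. c i *\<^sub>R X i q) = (\<Sum>i<k. (c i)\<^sup>2)"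
  using assms
  by (intro ip_orthonormal_norm[of "D q"])
    (auto simp: orthonormal_frame_on_def subriemannian_structure_def smooth_distribution_def smooth_metric_on_distribution_def)

section \<open>Independence of the Hamiltonian from the frame\<close>

lemma cotangent_sum:
  assumes A: "smooth_atlas A" and p: "p \<in> cotangent_space A q"
    and "\<And>i. i \<in> I \<Longrightarrow> X i \<in> tangent_space A q"
  shows "p (\<Sum>i\<in>I. c i *\<^sub>R X i) = (\<Sum>i\<in>I. c i * p (X i))"
proof -
  have T: "subspace (tangent_space A q)" using A by (rule subspace_tangent_space)
  have lin: "\<And>u v. u \<in> tangent_space A q \<Longrightarrow> v \<in> tangent_space A q \<Longrightarrow> p (u + v) = p u + p v"
    "\<And>r u. u \<in> tangent_space A q \<Longrightarrow> p (r *\<^sub>R u) = r * p u"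
    using p by (auto simp: cotangent_space_def)
  have "p 0 = 0" using lin(2)[of 0 0] subspace_0[OF T] by simp
  then show ?thesis using assms(3)
    by (induction I rule: infinite_finite_induct)
      (auto simp: lin subspace_scale[OF T] subspace_sum[OF T])
qed

text \<open>Both sums are the maximum of \<open>2 p v - g v v\<close> over the distribution.\<close>
lemma orthonormal_frame_hamiltonian_le:
  assumes S: "subriemannian_structure A k D g" and p: "p \<in> cotangent_space A q"
    and V: "orthonormal_frame_on A k D g V X" "q \<in> V" and V': "orthonormal_frame_on A k D g V' Y" "q \<in> V'"
  shows "(\<Sum>i<k. (p (X i q))\<^sup>2) \<le> (\<Sum>i<k. (p (Y i q))\<^sup>2)"
proof -
  have A: "smooth_atlas A" and D: "D q \<subseteq> tangent_space A q" "subspace (D q)"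
    using S by (auto simp: subriemannian_structure_def smooth_distribution_def)
  have X: "X i q \<in> D q" "Y i q \<in> D q" if "i < k" for i using V V' that by (auto simp: orthonormal_frame_on_def)
  \<comment> \<open>The maximizer, written in the first frame. At it, 2 p v - g v v equals the
    left-hand sum; expanding the same vector in the second frame and using 2 a b \<le> a^2 + b^2
    bounds this by the right-hand one.\<close>
  define v where "v = (\<Sum>i<k. p (X i q) *\<^sub>R X i q)"
  have vD: "v \<in> D q" unfolding v_def using X by (intro subspace_sum subspace_scale D) auto
  have pv: "p v = (\<Sum>i<k. (p (X i q))\<^sup>2)"
    unfolding v_def using X D by (subst cotangent_sum[OF A p]) (auto simp: power2_eq_square)
  have gv: "g q v v = (\<Sum>i<k. (p (X i q))\<^sup>2)"
    unfolding v_def by (rule orthonormal_frame_norm[OF S V])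
  define c where "c i = g q v (Y i q)" for i
  have v: "v = (\<Sum>i<k. c i *\<^sub>R Y i q)" unfolding c_def by (rule orthonormal_frame_expansion[OF S V' vD])
  have "2 * p v = (\<Sum>i<k. 2 * (c i * p (Y i q)))"
    unfolding v using X D by (subst cotangent_sum[OF A p]) (auto simp: sum_distrib_left)
  also have "\<dots> \<le> (\<Sum>i<k. (c i)\<^sup>2 + (p (Y i q))\<^sup>2)"
    by (intro sum_mono) (simp add: sum_squares_bound flip: mult.assoc)
  also have "\<dots> = g q v v + (\<Sum>i<k. (p (Y i q))\<^sup>2)"
    unfolding v by (simp add: orthonormal_frame_norm[OF S V'] sum.distrib)
  finally show ?thesis unfolding pv gv by simp
qed

text \<open>The description by \<open>THE\<close> is legitimate because the preceding inequality can
  be applied with the two frames interchanged.\<close>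

lemma sR_hamiltonian_eq:
  assumes "subriemannian_structure A k D g" "p \<in> cotangent_space A q"
    and "orthonormal_frame_on A k D g V X" "q \<in> V"
  shows "sR_hamiltonian A k D g q p = 1 / 2 * (\<Sum>i<k. (p (X i q))\<^sup>2)"
  unfolding sR_hamiltonian_def
proof (rule the_equality)
  fix h assume "\<exists>V X. orthonormal_frame_on A k D g V X \<and> q \<in> V \<and> h = 1 / 2 * (\<Sum>i<k. (p (X i q))\<^sup>2)"
  then obtain V' Y where V': "orthonormal_frame_on A k D g V' Y" "q \<in> V'" "h = 1 / 2 * (\<Sum>i<k. (p (Y i q))\<^sup>2)"
    by blast
  show "h = 1 / 2 * (\<Sum>i<k. (p (X i q))\<^sup>2)"
    using orthonormal_frame_hamiltonian_le[OF assms(1,2) V'(1,2) assms(3,4)]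
      orthonormal_frame_hamiltonian_le[OF assms V'(1,2)] V'(3) by simp
qed (use assms in blast)

section \<open>Coordinates adapted to a frame\<close>

text \<open>A chart and a frame with unrelated domains. Everything takes place over their
  intersection, whose coordinate image is \<open>U\<close>; there the frame becomes the Euclidean
  fields \<open>W\<close>.\<close>

locale framed_chart =
  fixes A :: "('q::{t2_space, second_countable_topology}, 'n::finite) chart set"
    and k :: nat
    and D :: "'q \<Rightarrow> ('q, 'n) tvec set"
    and g :: "'q \<Rightarrow> ('q, 'n) tvec \<Rightarrow> ('q, 'n) tvec \<Rightarrow> real"
    and V :: "'q set" and X :: "nat \<Rightarrow> 'q \<Rightarrow> ('q, 'n) tvec"
    and c :: "('q, 'n) chart"
  assumes sR: "subriemannian_structure A k D g"
    and frame: "orthonormal_frame_on A k D g V X"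
    and c: "c \<in> A"
begin

definition W :: "nat \<Rightarrow> real ^ 'n \<Rightarrow> real ^ 'n" where
  "W i x = comps (X i (chinv c x)) c"

definition U :: "(real ^ 'n) set" where
  "U = chmap c ` (chdom c \<inter> V)"

lemma atlas: "smooth_atlas A"
  using sR by (simp add: subriemannian_structure_def)

lemma chart: "is_chart c"
  using atlas c by (simp add: smooth_atlas_def)

lemma open_V: "open V"
  using frame by (simp add: orthonormal_frame_on_def)

lemma open_dom: "open (chdom c \<inter> V)"
  using chart open_V by (auto simp: is_chart_def)

lemma open_U: "open U"
  unfolding U_def using chart open_V by (rule chart_open_image)

lemma continuous_chmap: "continuous_on (chdom c \<inter> V) (chmap c)"
  using chart by (auto simp: is_chart_def homeomorphism_def intro: continuous_on_subset)

lemma continuous_chinv: "continuous_on U (chinv c)"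
  using chart unfolding U_def is_chart_def homeomorphism_def by (metis Int_lower1 continuous_on_subset image_mono)

lemma U_chinv: "x \<in> U \<Longrightarrow> chinv c x \<in> chdom c \<inter> V \<and> chmap c (chinv c x) = x"
  unfolding U_def using chinv_chmap[OF chart] by auto

lemma chmap_in_U: "q \<in> chdom c \<inter> V \<Longrightarrow> chmap c q \<in> U"
  by (simp add: U_def)

lemma W_chmap: "q \<in> chdom c \<Longrightarrow> W i (chmap c q) = comps (X i q) c"
  by (simp add: W_def chinv_chmap[OF chart])

lemma Ck_on_W: "i < k \<Longrightarrow> Ck_on n U (W i)"
  using frame c unfolding orthonormal_frame_on_def smooth_vector_field_on_def smooth_on_def U_def W_def by blast

lemma D_tangent: "D q \<subseteq> tangent_space A q" and D_subspace: "subspace (D q)"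
  using sR by (auto simp: subriemannian_structure_def smooth_distribution_def)

lemma D_inner_product: "inner_product_on (D q) (g q)"
  using sR by (auto simp: subriemannian_structure_def smooth_metric_on_distribution_def)

lemma X_in_D: "i < k \<Longrightarrow> q \<in> V \<Longrightarrow> X i q \<in> D q"
  using frame by (simp add: orthonormal_frame_on_def)

lemma X_orthonormal: "q \<in> V \<Longrightarrow> i < k \<Longrightarrow> j < k \<Longrightarrow> g q (X i q) (X j q) = (if i = j then 1 else 0)"
  using frame by (simp add: orthonormal_frame_on_def)

text \<open>Coefficients found by a computation in R^n are those of the tangent vector itself, since
  its components in \<open>c\<close> determine it. Energy densities thus become sums of
  squares.\<close>

lemma frame_norm_coords:
  assumes "q \<in> chdom c \<inter> V" "v \<in> D q" "comps v c = (\<Sum>i<k. a i *\<^sub>R W i (chmap c q))"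
  shows "g q v v = (\<Sum>i<k. (a i)\<^sup>2)"
proof -
  have "v = (\<Sum>i<k. a i *\<^sub>R X i q)"
  proof (rule tangent_space_eqI[OF _ _ c])
    show "v \<in> tangent_space A q" using assms(2) D_tangent by blast
    have "(\<Sum>i<k. a i *\<^sub>R X i q) \<in> D q"
      using X_in_D assms(1) by (intro subspace_sum subspace_scale D_subspace) auto
    then show "(\<Sum>i<k. a i *\<^sub>R X i q) \<in> tangent_space A q" using D_tangent by blast
    show "q \<in> chdom c" using assms(1) by simp
    then show "comps v c = comps (\<Sum>i<k. a i *\<^sub>R X i q) c"
      using assms(3) by (simp add: W_chmap)
  qed
  then show ?thesis using orthonormal_frame_norm[OF sR frame, of q a] assms(1) by simp
qed

text \<open>Taking components in \<open>c\<close> is linear, and injective on tangent vectors at one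
  point, so the independence of the orthonormal vectors \<open>X i q\<close> survives in
  R^n.\<close>

lemma W_not_in_span:
  assumes x: "x \<in> U" and i: "i < k"
  shows "W i x \<notin> span ((\<lambda>j. W j x) ` {..<i})"
proof
  assume a: "W i x \<in> span ((\<lambda>j. W j x) ` {..<i})"
  define q where "q = chinv c x"
  have q: "q \<in> chdom c" "q \<in> V" using U_chinv[OF x] by (auto simp: q_def)
  have lin: "linear (\<lambda>v :: ('q, 'n) tvec. comps v c)" by (rule linearI) simp_all
  have "(\<lambda>j. W j x) ` {..<i} = (\<lambda>v. comps v c) ` ((\<lambda>j. X j q) ` {..<i})"
    by (simp add: W_def q_def image_image)
  then have "W i x \<in> (\<lambda>v. comps v c) ` span ((\<lambda>j. X j q) ` {..<i})"
    using a linear_span_image[OF lin] by simp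
  then obtain v where v: "v \<in> span ((\<lambda>j. X j q) ` {..<i})" "comps (X i q) c = comps v c"
    by (auto simp: W_def q_def)
  have sub: "(\<lambda>j. X j q) ` {..<i} \<subseteq> D q" using X_in_D q i by auto
  have "v \<in> D q" using v(1) span_minimal[OF sub D_subspace] by blast
  then have "X i q = v"
    using D_tangent X_in_D[OF i q(2)] v(2) by (intro tangent_space_eqI[OF _ _ c q(1)]) auto
  then have "X i q \<in> span ((\<lambda>j. X j q) ` {..<i})" using v(1) by simp
  then show False
    using ip_orthonormal_not_in_span[OF D_subspace D_inner_product, of k "\<lambda>j. X j q" q i] X_in_D X_orthonormal q i by simp
qed

lemma dual_coframe:
  obtains \<theta> where "\<And>i. i < k \<Longrightarrow> continuous_on U (\<theta> i)"
    "\<And>x i j. x \<in> U \<Longrightarrow> i < k \<Longrightarrow> j < k \<Longrightarrow> \<theta> i x \<bullet> W j x = (if i = j then 1 else 0)"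
proof -
  have "\<exists>\<theta>. (\<forall>i<k. continuous_on U (\<theta> i)) \<and>
    (\<forall>x\<in>U. \<forall>i<k. \<theta> i x \<in> span ((\<lambda>j. W j x) ` {..<k}) \<and>
       (\<forall>j<k. \<theta> i x \<bullet> W j x = (if i = j then 1 else 0)))"
  proof (rule continuous_dual_frame)
    show "continuous_on U (W i)" if "i < k" for i using Ck_on_W[OF that] by (rule Ck_on_continuous_on)
  qed (rule W_not_in_span)
  then obtain \<theta> where 1: "\<forall>i<k. continuous_on U (\<theta> i)"
    and 2: "\<forall>x\<in>U. \<forall>i<k. \<theta> i x \<in> span ((\<lambda>j. W j x) ` {..<k}) \<and>
       (\<forall>j<k. \<theta> i x \<bullet> W j x = (if i = j then 1 else 0))"
    by (elim exE conjE)
  show ?thesis by (rule that[of \<theta>]) (use 1 2 in simp_all)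
qed

text \<open>Every estimate stays true when its constant grows, so the constants for the single
  estimates and the single fields can be added up to one \<open>L\<close> that serves
  throughout.\<close>

lemma frame_bounds:
  assumes "compact K" "convex K" "K \<subseteq> U"
  obtains L where "L \<ge> 1" "\<And>i z. i < k \<Longrightarrow> z \<in> K \<Longrightarrow> norm (W i z) \<le> L"
    "\<And>i z w. i < k \<Longrightarrow> z \<in> K \<Longrightarrow> w \<in> K \<Longrightarrow> norm (W i w - W i z) \<le> L * norm (w - z)"
    "\<And>i z w. i < k \<Longrightarrow> z \<in> K \<Longrightarrow> w \<in> K \<Longrightarrow>
      norm (W i w - W i z - frechet_derivative (W i) (at z) (w - z)) \<le> L * (norm (w - z))\<^sup>2"
    "\<And>i z v. i < k \<Longrightarrow> z \<in> K \<Longrightarrow> norm (frechet_derivative (W i) (at z) v) \<le> L * norm v"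
proof -
  define Q where "Q i L \<longleftrightarrow> L \<ge> 0 \<and> (\<forall>z\<in>K. norm (W i z) \<le> L) \<and>
    (\<forall>z\<in>K. \<forall>w\<in>K. norm (W i w - W i z) \<le> L * norm (w - z)) \<and>
    (\<forall>z\<in>K. \<forall>w\<in>K. norm (W i w - W i z - frechet_derivative (W i) (at z) (w - z)) \<le> L * (norm (w - z))\<^sup>2) \<and>
    (\<forall>z\<in>K. \<forall>v. norm (frechet_derivative (W i) (at z) v) \<le> L * norm v)" for i L
  have mono: "Q i L'" if "Q i L" "L \<le> L'" for i L L'
    using that unfolding Q_def by (meson mult_right_mono norm_ge_zero order_trans zero_le_power)
  have ex: "\<exists>L. Q i L" if i: "i < k" for i
  proof -
    have "continuous_on K (W i)" using Ck_on_continuous_on[OF Ck_on_W[OF i]] assms(3) continuous_on_subset by blast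
    then have "bounded (W i ` K)" using assms(1) compact_continuous_image compact_imp_bounded by blast
    then obtain L0 where L0: "\<And>z. z \<in> K \<Longrightarrow> norm (W i z) \<le> L0" by (auto simp: bounded_iff)
    obtain L1 where L1: "L1 \<ge> 0" "\<And>x v. x \<in> K \<Longrightarrow> norm (frechet_derivative (W i) (at x) v) \<le> L1 * norm v"
      using bounded_by_Ck1_derivative[OF Ck_on_W[OF i] assms(3,1)] by blast
    obtain L2 where L2: "L2 \<ge> 0" "\<And>x y. x \<in> K \<Longrightarrow> y \<in> K \<Longrightarrow> norm (W i y - W i x) \<le> L2 * norm (y - x)"
      using Ck1_lipschitz[OF Ck_on_W[OF i] assms(3,1,2)] by blast
    obtain L3 where L3: "L3 \<ge> 0" "\<And>x y. x \<in> K \<Longrightarrow> y \<in> K \<Longrightarrow>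
        norm (W i y - W i x - frechet_derivative (W i) (at x) (y - x)) \<le> L3 * (norm (y - x))\<^sup>2"
      using Ck2_taylor[OF Ck_on_W[OF i] assms(3,1,2)] by blast
    define L where "L = \<bar>L0\<bar> + L1 + L2 + L3"
    have le: "L0 \<le> L" "L1 \<le> L" "L2 \<le> L" "L3 \<le> L" "0 \<le> L" using L1 L2 L3 by (auto simp: L_def)
    have "Q i L" unfolding Q_def
    proof (intro conjI ballI allI)
      show "norm (W i z) \<le> L" if "z \<in> K" for z using L0[OF that] le by simp
      show "norm (W i w - W i z) \<le> L * norm (w - z)" if "z \<in> K" "w \<in> K" for z w
        using L2(2)[OF that] mult_right_mono[OF le(3), of "norm (w - z)"] by simp
      show "norm (W i w - W i z - frechet_derivative (W i) (at z) (w - z)) \<le> L * (norm (w - z))\<^sup>2" if "z \<in> K" "w \<in> K" for z w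
        using L3(2)[OF that] mult_right_mono[OF le(4), of "(norm (w - z))\<^sup>2"] by simp
      show "norm (frechet_derivative (W i) (at z) v) \<le> L * norm v" if "z \<in> K" for z v
        using L1(2)[OF that, of v] mult_right_mono[OF le(2), of "norm v"] by simp
    qed (rule le)
    then show ?thesis by blast
  qed
  define M where "M i = (SOME L. Q i L)" for i
  have M: "Q i (M i)" if "i < k" for i unfolding M_def using ex[OF that] by (rule someI_ex)
  define L where "L = 1 + (\<Sum>i<k. M i)"
  have nn: "0 \<le> M i" if "i < k" for i using M[OF that] by (simp add: Q_def)
  have "M i \<le> L" if "i < k" for i
    using member_le_sum[of i "{..<k}" M] nn that by (simp add: L_def)
  then have QL: "Q i L" if "i < k" for i using mono[OF M[OF that]] that by blast
  have "0 \<le> (\<Sum>i<k. M i)" using nn by (intro sum_nonneg) simp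
  then have "L \<ge> 1" by (simp add: L_def)
  then show ?thesis by (rule that) (use QL in \<open>simp_all add: Q_def\<close>)
qed

text \<open>Makes the coordinate Hamiltonian an explicit function over \<open>U\<close>, which can
  be differentiated.\<close>

lemma in_canonical_coords_frame:
  assumes "x \<in> U"
  shows "in_canonical_coords A c (sR_hamiltonian A k D g) (x, \<xi>) = 1 / 2 * (\<Sum>i<k. (\<xi> \<bullet> W i x)\<^sup>2)"
proof -
  define q where "q = chinv c x"
  have q: "q \<in> V" using U_chinv[OF assms] by (simp add: q_def)
  have T: "subspace (tangent_space A q)" by (rule subspace_tangent_space[OF atlas])
  have "covec_at A c q \<xi> \<in> cotangent_space A q"
    unfolding cotangent_space_def covec_at_def
    using subspace_add[OF T] subspace_scale[OF T] by (simp add: inner_add_right)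
  from sR_hamiltonian_eq[OF sR this frame q]
  have "sR_hamiltonian A k D g q (covec_at A c q \<xi>) = 1 / 2 * (\<Sum>i<k. (covec_at A c q \<xi> (X i q))\<^sup>2)" .
  also have "(\<Sum>i<k. (covec_at A c q \<xi> (X i q))\<^sup>2) = (\<Sum>i<k. (\<xi> \<bullet> W i x)\<^sup>2)"
  proof (rule sum.cong)
    fix i assume "i \<in> {..<k}"
    then have "X i q \<in> tangent_space A q" using X_in_D[of i q] q D_tangent by blast
    then show "(covec_at A c q \<xi> (X i q))\<^sup>2 = (\<xi> \<bullet> W i x)\<^sup>2" by (simp add: covec_at_def W_def q_def)
  qed simp
  finally show ?thesis by (simp add: in_canonical_coords_def q_def)
qed

text \<open>The explicit differential of H is compared with the one prescribed through the
  symplectic form. \<xi>' is described by its inner products because as a vector it would involve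
  the adjoint of the derivative of \<open>W i\<close>.\<close>

lemma hamilton_equations:
  assumes H: "hamiltonian_integral_curve A (sR_hamiltonian A k D g) a b \<gamma> p"
    and t: "t \<in> {a..b}" "\<gamma> t \<in> chdom c \<inter> V"
  defines "x \<equiv> chmap c \<circ> \<gamma>" and "\<xi> \<equiv> \<lambda>s. covec_coords A c (\<gamma> s) (p s)"
  obtains \<xi>' where
    "(x has_vector_derivative (\<Sum>i<k. (\<xi> t \<bullet> W i (x t)) *\<^sub>R W i (x t))) (at t within {a..b})"
    "(\<xi> has_vector_derivative \<xi>') (at t within {a..b})"
    "\<And>v. \<xi>' \<bullet> v = - (\<Sum>i<k. (\<xi> t \<bullet> W i (x t)) * (\<xi> t \<bullet> frechet_derivative (W i) (at (x t)) v))"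
proof -
  obtain Z1 Z2 where Z: "(in_canonical_coords A c (sR_hamiltonian A k D g) has_derivative symplectic_form (Z1, Z2)) (at (x t, \<xi> t))"
    "((\<lambda>s. (x s, \<xi> s)) has_vector_derivative (Z1, Z2)) (at t within {a..b})"
  proof -
    have "\<exists>Z. (in_canonical_coords A c (sR_hamiltonian A k D g) has_derivative symplectic_form Z) (at (x t, \<xi> t)) \<and>
      ((\<lambda>s. (x s, \<xi> s)) has_vector_derivative Z) (at t within {a..b})"
      using H t c unfolding hamiltonian_integral_curve_def Let_def x_def \<xi>_def comp_def by blast
    then show ?thesis using that by force
  qed
  have xU: "x t \<in> U" using t(2) chmap_in_U by (simp add: x_def)
  \<comment> \<open>The explicit Hamiltonian. It agrees with the abstract one on the open set
    \<open>U \<times> UNIV\<close>, so both have the same derivative there.\<close>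
  define K where "K z = 1 / 2 * (\<Sum>i<k. (snd z \<bullet> W i (fst z))\<^sup>2)" for z :: "(real ^ 'n) \<times> (real ^ 'n)"
  have "(K has_derivative symplectic_form (Z1, Z2)) (at (x t, \<xi> t))"
  proof (rule has_derivative_transform_within_open[OF Z(1)])
    show "open (U \<times> (UNIV :: (real ^ 'n) set))" using open_U by (simp add: open_Times)
    show "(x t, \<xi> t) \<in> U \<times> UNIV" using xU by simp
    show "in_canonical_coords A c (sR_hamiltonian A k D g) z = K z" if "z \<in> U \<times> UNIV" for z
      using in_canonical_coords_frame[of "fst z" "snd z"] that unfolding K_def by (simp add: mem_Times_iff)
  qed
  moreover have "(K has_derivative (\<lambda>h. \<Sum>i<k. (\<xi> t \<bullet> W i (x t)) *
      (snd h \<bullet> W i (x t) + \<xi> t \<bullet> frechet_derivative (W i) (at (x t)) (fst h)))) (at (x t, \<xi> t))"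
  proof -
    have "((\<lambda>z. W i (fst z)) has_derivative (\<lambda>h. frechet_derivative (W i) (at (x t)) (fst h))) (at (x t, \<xi> t))"
      if "i < k" for i
    proof -
      have "(W i has_derivative frechet_derivative (W i) (at (x t))) (at (fst (x t, \<xi> t)))"
        using Ck_on_SucD_has_derivative[OF Ck_on_W[OF that] xU] by simp
      from has_derivative_compose[OF has_derivative_fst[OF has_derivative_ident] this] show ?thesis .
    qed
    note dW = this
    have "((\<lambda>z. (snd z \<bullet> W i (fst z))\<^sup>2) has_derivative (\<lambda>h. 2 * ((\<xi> t \<bullet> W i (x t)) *
      (snd h \<bullet> W i (x t) + \<xi> t \<bullet> frechet_derivative (W i) (at (x t)) (fst h))))) (at (x t, \<xi> t))"
      if i: "i < k" for i
    proof -
      have "((\<lambda>z. snd z \<bullet> W i (fst z)) has_derivative (\<lambda>h. snd (x t, \<xi> t) \<bullet> frechet_derivative (W i) (at (x t)) (fst h)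
          + snd h \<bullet> W i (fst (x t, \<xi> t)))) (at (x t, \<xi> t))"
        by (intro has_derivative_inner has_derivative_snd has_derivative_ident dW[OF i])
      from has_derivative_power[OF this, of 2] show ?thesis
        by (rule has_derivative_eq_rhs) (auto simp: fun_eq_iff algebra_simps)
    qed
    then have "((\<lambda>z. 1 / 2 * (\<Sum>i<k. (snd z \<bullet> W i (fst z))\<^sup>2)) has_derivative (\<lambda>h. 1 / 2 * (\<Sum>i<k. 2 * ((\<xi> t \<bullet> W i (x t)) *
      (snd h \<bullet> W i (x t) + \<xi> t \<bullet> frechet_derivative (W i) (at (x t)) (fst h)))))) (at (x t, \<xi> t))"
      by (intro has_derivative_mult_right has_derivative_sum) auto
    then show ?thesis by (simp add: K_def[abs_def] flip: sum_distrib_left)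
  qed
  ultimately have eq: "symplectic_form (Z1, Z2) = (\<lambda>h. \<Sum>i<k. (\<xi> t \<bullet> W i (x t)) *
      (snd h \<bullet> W i (x t) + \<xi> t \<bullet> frechet_derivative (W i) (at (x t)) (fst h)))"
    by (rule has_derivative_unique)
  have lin: "linear (frechet_derivative (W i) (at (x t)))" if "i < k" for i
    using Ck_on_SucD_has_derivative[OF Ck_on_W[OF that] xU] has_derivative_linear by blast
  \<comment> \<open>Testing against a purely vertical vector isolates x'; the horizontal vectors
    below isolate \<xi>'.\<close>
  have "Z1 \<bullet> w = (\<Sum>i<k. (\<xi> t \<bullet> W i (x t)) *\<^sub>R W i (x t)) \<bullet> w" for w
    using fun_cong[OF eq, of "(0, w)"]
    by (simp add: symplectic_form_def inner_sum_left linear_0[OF lin] inner_commute[of w])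
  then have Z1: "Z1 = (\<Sum>i<k. (\<xi> t \<bullet> W i (x t)) *\<^sub>R W i (x t))"
    using vector_eq_rdot by blast
  have Z2: "Z2 \<bullet> v = - (\<Sum>i<k. (\<xi> t \<bullet> W i (x t)) * (\<xi> t \<bullet> frechet_derivative (W i) (at (x t)) v))" for v
    using fun_cong[OF eq, of "(v, 0)"] by (simp add: symplectic_form_def)
  have zd: "((\<lambda>s. (x s, \<xi> s)) has_derivative (\<lambda>h. h *\<^sub>R (Z1, Z2))) (at t within {a..b})"
    using Z(2) by (simp add: has_vector_derivative_def)
  show ?thesis
  proof (rule that[OF _ _ Z2])
    show "(x has_vector_derivative (\<Sum>i<k. (\<xi> t \<bullet> W i (x t)) *\<^sub>R W i (x t))) (at t within {a..b})"
      using has_derivative_fst[OF zd] by (simp add: has_vector_derivative_def Z1)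
    show "(\<xi> has_vector_derivative Z2) (at t within {a..b})"
      using has_derivative_snd[OF zd] by (simp add: has_vector_derivative_def)
  qed
qed

end

section \<open>Admissible curves\<close>

lemma AE_lebesgue_on_Icc:
  fixes a b :: real
  shows "(AE x in lebesgue_on {a..b}. P x) \<longleftrightarrow> (\<exists>N. negligible N \<and> (\<forall>x\<in>{a..b} - N. P x))"
  by (rule AE_lebesgue_on_iff_negligible) simp

lemma abs_cont_on_subinterval: "abs_cont_on a b f \<Longrightarrow> {s..t} \<subseteq> {a..b} \<Longrightarrow> abs_cont_on s t f"
  unfolding abs_cont_on_def by (meson order_trans)

text \<open>An almost everywhere bound on the derivative is not enough in itself, as the Cantor
  function shows. Absolute continuity makes every increment the integral of the derivative, whose
  value on the null set may be put to 0.\<close>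

lemma bounded_derivative_AE_lipschitz:
  fixes y :: "real \<Rightarrow> 'a::euclidean_space"
  assumes ac: "abs_cont_on s t y" and N: "negligible N" and C: "C \<ge> 0"
    and der: "\<And>\<tau>. \<tau> \<in> {s..t} - N \<Longrightarrow> (y has_vector_derivative f \<tau>) (at \<tau> within {s..t}) \<and> norm (f \<tau>) \<le> C"
  shows "C-lipschitz_on {s..t} y"
proof (rule lipschitz_onI[OF _ C])
  have le: "norm (y q - y p) \<le> C * (q - p)" if pq: "p \<in> {s..t}" "q \<in> {s..t}" "p \<le> q" for p q
  proof -
    have sub: "{p..q} \<subseteq> {s..t}" using pq by auto
    have "((\<lambda>\<tau>. if \<tau> \<in> N then 0 else f \<tau>) has_integral (y q - y p)) {p..q}"
    proof (rule abs_cont_on_has_integral[OF pq(3) abs_cont_on_subinterval[OF ac sub] N])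
      show "(y has_vector_derivative (if \<tau> \<in> N then 0 else f \<tau>)) (at \<tau> within {p..q})" if "\<tau> \<in> {p..q} - N" for \<tau>
        using der[of \<tau>] that sub by (auto intro: has_vector_derivative_within_subset)
    qed simp
    from has_integral_bound[OF C this[folded box_real(2)]]
    have "norm (y q - y p) \<le> C * measure lborel (cbox p q)"
      using der sub C by fastforce
    then show ?thesis using pq by simp
  qed
  show "dist (y p) (y q) \<le> C * dist p q" if "p \<in> {s..t}" "q \<in> {s..t}" for p q
    using le[of p q] le[of q p] that by (cases "p \<le> q") (auto simp: dist_norm norm_minus_commute)
qed

lemma ACB_tangent_subinterval:
  assumes "ACB_tangent A D a b \<eta>" "{s..t} \<subseteq> {a..b}"
  shows "ACB_tangent A D s t \<eta>"
proof -
  have "continuous_on {s..t} \<eta>"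
    using assms continuous_on_subset unfolding ACB_tangent_def ACB_def by blast
  moreover have "ACB_vec s' t' (chmap c \<circ> \<eta>)"
    if that: "c \<in> A" "s \<le> s' \<and> s' \<le> t' \<and> t' \<le> t \<and> \<eta> ` {s'..t'} \<subseteq> chdom c" for c s' t'
  proof -
    have "a \<le> s' \<and> s' \<le> t' \<and> t' \<le> b \<and> \<eta> ` {s'..t'} \<subseteq> chdom c"
      using assms(2) that(2) by auto
    then show ?thesis using assms(1) that(1) unfolding ACB_tangent_def ACB_def by blast
  qed
  moreover have "AE \<tau> in lebesgue_on {s..t}. velocity A \<eta> \<tau> \<in> D (\<eta> \<tau>)"
    using assms unfolding ACB_tangent_def unfolding AE_lebesgue_on_Icc by blast
  ultimately show ?thesis unfolding ACB_tangent_def ACB_def by blast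
qed

context framed_chart
begin

text \<open>An admissible curve within the framed chart becomes a Lipschitz solution of the control
  system y' = \<Sum> u i W i(y), with energy density \<Sum> (u i)^2. This is the form in which
  competitors enter the estimates.\<close>

lemma tangent_curve_representation:
  assumes \<eta>: "ACB_tangent A D s t \<eta>" and st: "s \<le> t" and im: "\<eta> ` {s..t} \<subseteq> chdom c \<inter> V"
  obtains u N C where "negligible N" "C-lipschitz_on {s..t} (chmap c \<circ> \<eta>)"
    "\<And>\<tau>. \<tau> \<in> {s..t} - N \<Longrightarrow>
       (chmap c \<circ> \<eta> has_vector_derivative (\<Sum>i<k. u i \<tau> *\<^sub>R W i (chmap c (\<eta> \<tau>)))) (at \<tau> within {s..t})"
    "\<And>\<tau>. \<tau> \<in> {s..t} - N \<Longrightarrow> g (\<eta> \<tau>) (velocity A \<eta> \<tau>) (velocity A \<eta> \<tau>) = (\<Sum>i<k. (u i \<tau>)\<^sup>2)"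
    "(\<lambda>\<tau>. \<Sum>i<k. (u i \<tau>)\<^sup>2) integrable_on {s..t}"
proof -
  define y where "y = chmap c \<circ> \<eta>"
  have imt: "\<eta> \<tau> \<in> chdom c" "\<eta> \<tau> \<in> V" "y \<tau> \<in> U" if "\<tau> \<in> {s..t}" for \<tau>
  proof -
    have "\<eta> \<tau> \<in> chdom c \<inter> V" using im that by blast
    then show "\<eta> \<tau> \<in> chdom c" "\<eta> \<tau> \<in> V" "y \<tau> \<in> U" using chmap_in_U by (auto simp: y_def)
  qed
  have "ACB_vec s t y"
  proof -
    have "s \<le> s \<and> s \<le> t \<and> t \<le> t \<and> \<eta> ` {s..t} \<subseteq> chdom c" using st im by auto
    then show ?thesis using \<eta> c unfolding y_def ACB_tangent_def ACB_def by blast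
  qed
  then have ac: "abs_cont_on s t y" and "\<exists>B. AE \<tau> in lebesgue_on {s..t}.
      \<exists>f'. (y has_vector_derivative f') (at \<tau> within {s..t}) \<and> norm f' \<le> B"
    unfolding ACB_vec_def by (rule conjunct1, rule conjunct2)
  then obtain B N1 where N1: "negligible N1"
    "\<forall>\<tau>\<in>{s..t} - N1. \<exists>f'. (y has_vector_derivative f') (at \<tau> within {s..t}) \<and> norm f' \<le> B"
    unfolding AE_lebesgue_on_Icc by blast
  have "AE \<tau> in lebesgue_on {s..t}. velocity A \<eta> \<tau> \<in> D (\<eta> \<tau>)" using \<eta> by (simp add: ACB_tangent_def)
  then obtain N2 where N2: "negligible N2" "\<forall>\<tau>\<in>{s..t} - N2. velocity A \<eta> \<tau> \<in> D (\<eta> \<tau>)"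
    unfolding AE_lebesgue_on_Icc by blast
  \<comment> \<open>The end-points are included because \<open>velocity\<close> takes the two-sided
    derivative, which need not agree there with the derivative within the interval.\<close>
  define N where "N = N1 \<union> N2 \<union> {s, t}"
  have N: "negligible N" using N1(1) N2(1) by (simp add: N_def)
  define f where "f \<tau> = (if \<tau> \<in> N then 0 else vector_derivative y (at \<tau>))" for \<tau>
  have f: "(y has_vector_derivative f \<tau>) (at \<tau> within {s..t}) \<and> norm (f \<tau>) \<le> \<bar>B\<bar>" if \<tau>: "\<tau> \<in> {s..t} - N" for \<tau>
  proof -
    obtain f' where f': "(y has_vector_derivative f') (at \<tau> within {s..t})" "norm f' \<le> B"
      using N1(2) \<tau> unfolding N_def by blast
    have "at \<tau> within {s..t} = at \<tau>" using \<tau> by (intro at_within_Icc_at) (auto simp: N_def)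
    then have "vector_derivative y (at \<tau>) = f'" using f'(1) by (simp add: vector_derivative_at)
    then show ?thesis using f' \<tau> by (simp add: f_def)
  qed
  have lip: "\<bar>B\<bar>-lipschitz_on {s..t} y"
    by (rule bounded_derivative_AE_lipschitz[OF ac N _ f]) auto
  have fint: "f integrable_on {s..t}"
    using abs_cont_on_has_integral[OF st ac N, of f] f by (auto simp: f_def integrable_on_def)
  obtain \<theta> where \<theta>: "\<And>i. i < k \<Longrightarrow> continuous_on U (\<theta> i)"
    "\<And>x i j. x \<in> U \<Longrightarrow> i < k \<Longrightarrow> j < k \<Longrightarrow> \<theta> i x \<bullet> W j x = (if i = j then 1 else 0)"
    by (rule dual_coframe; rule that)
  \<comment> \<open>The controls equal the coefficients g(v, X i), but in this form they are visibly
    measurable: a continuous coframe paired with a derivative that is integrable by the fundamental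
    theorem.\<close>
  define u where "u i \<tau> = \<theta> i (y \<tau>) \<bullet> f \<tau>" for i \<tau>
  have rep: "f \<tau> = (\<Sum>i<k. u i \<tau> *\<^sub>R W i (y \<tau>))"
    "g (\<eta> \<tau>) (velocity A \<eta> \<tau>) (velocity A \<eta> \<tau>) = (\<Sum>i<k. (u i \<tau>)\<^sup>2)" if \<tau>: "\<tau> \<in> {s..t} - N" for \<tau>
  proof -
    define v where "v = velocity A \<eta> \<tau>"
    have vD: "v \<in> D (\<eta> \<tau>)" using N2(2) \<tau> by (simp add: v_def N_def)
    have vc: "comps v c = f \<tau>"
      using imt(1)[of \<tau>] \<tau> c by (simp add: v_def velocity_def f_def y_def)
    have "v = (\<Sum>i<k. g (\<eta> \<tau>) v (X i (\<eta> \<tau>)) *\<^sub>R X i (\<eta> \<tau>))"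
      using orthonormal_frame_expansion[OF sR frame _ vD] imt(2) \<tau> by simp
    from arg_cong[OF this, of "\<lambda>v. comps v c"]
    have f1: "f \<tau> = (\<Sum>i<k. g (\<eta> \<tau>) v (X i (\<eta> \<tau>)) *\<^sub>R W i (y \<tau>))"
      using imt(1)[of \<tau>] \<tau> by (simp add: vc y_def W_chmap)
    have u: "u j \<tau> = g (\<eta> \<tau>) v (X j (\<eta> \<tau>))" if j: "j < k" for j
    proof -
      have "u j \<tau> = (\<Sum>i<k. g (\<eta> \<tau>) v (X i (\<eta> \<tau>)) * (\<theta> j (y \<tau>) \<bullet> W i (y \<tau>)))"
        by (simp add: u_def f1 inner_sum_right)
      also have "\<dots> = (\<Sum>i<k. if j = i then g (\<eta> \<tau>) v (X j (\<eta> \<tau>)) else 0)"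
        using \<theta>(2)[OF imt(3) j] \<tau> by (intro sum.cong) auto
      finally show ?thesis using j by simp
    qed
    show "f \<tau> = (\<Sum>i<k. u i \<tau> *\<^sub>R W i (y \<tau>))" using f1 u by simp
    then have "comps v c = (\<Sum>i<k. u i \<tau> *\<^sub>R W i (chmap c (\<eta> \<tau>)))" by (simp add: vc y_def)
    from frame_norm_coords[OF _ vD this]
    show "g (\<eta> \<tau>) (velocity A \<eta> \<tau>) (velocity A \<eta> \<tau>) = (\<Sum>i<k. (u i \<tau>)\<^sup>2)"
      using imt \<tau> by (simp add: v_def)
  qed
  have usq: "(\<lambda>\<tau>. (u i \<tau>)\<^sup>2) integrable_on {s..t}" if i: "i < k" for i
  proof -
    have cont: "continuous_on {s..t} (\<lambda>\<tau>. \<theta> i (y \<tau>))"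
      using imt by (intro continuous_on_compose2[OF \<theta>(1)[OF i] lipschitz_on_continuous_on[OF lip]]) auto
    then have "bounded ((\<lambda>\<tau>. \<theta> i (y \<tau>)) ` {s..t})"
      using compact_continuous_image compact_imp_bounded by blast
    then obtain M where M: "\<And>\<tau>. \<tau> \<in> {s..t} \<Longrightarrow> norm (\<theta> i (y \<tau>)) \<le> M"
      unfolding bounded_iff by blast
    have fm: "f \<in> borel_measurable (lebesgue_on {s..t})" by (rule integrable_imp_measurable[OF fint])
    have "(\<lambda>\<tau>. \<theta> i (y \<tau>)) \<in> borel_measurable (lebesgue_on {s..t})"
      by (rule continuous_imp_measurable_on_sets_lebesgue[OF cont]) simp
    then have "(\<lambda>\<tau>. u i \<tau>) \<in> borel_measurable (lebesgue_on {s..t})"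
      unfolding u_def using fm by (intro borel_measurable_inner)
    then have um: "(\<lambda>\<tau>. (u i \<tau>)\<^sup>2) \<in> borel_measurable (lebesgue_on {s..t})" by measurable
    show ?thesis
    proof (rule measurable_bounded_by_integrable_imp_integrable[OF um])
      show "(\<lambda>\<tau>. (M * \<bar>B\<bar>)\<^sup>2) integrable_on {s..t}" by (rule integrable_const_ivl)
      fix \<tau> assume \<tau>: "\<tau> \<in> {s..t}"
      have "norm (f \<tau>) \<le> \<bar>B\<bar>" using f[of \<tau>] \<tau> by (cases "\<tau> \<in> N") (auto simp: f_def)
      then have "norm (\<theta> i (y \<tau>)) * norm (f \<tau>) \<le> M * \<bar>B\<bar>"
        using M[OF \<tau>] by (intro mult_mono) (auto intro: order_trans[OF norm_ge_zero])
      then have "\<bar>u i \<tau>\<bar> \<le> M * \<bar>B\<bar>"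
        unfolding u_def using Cauchy_Schwarz_ineq2[of "\<theta> i (y \<tau>)" "f \<tau>"] by linarith
      then have "\<bar>u i \<tau>\<bar>\<^sup>2 \<le> (M * \<bar>B\<bar>)\<^sup>2" by (intro power_mono) auto
      then show "norm ((u i \<tau>)\<^sup>2) \<le> (M * \<bar>B\<bar>)\<^sup>2" by simp
    qed simp
  qed
  show ?thesis
  proof (rule that[of N "\<bar>B\<bar>" u])
    show "\<bar>B\<bar>-lipschitz_on {s..t} (chmap c \<circ> \<eta>)" using lip by (simp add: y_def)
    show "(chmap c \<circ> \<eta> has_vector_derivative (\<Sum>i<k. u i \<tau> *\<^sub>R W i (chmap c (\<eta> \<tau>)))) (at \<tau> within {s..t})"
      if "\<tau> \<in> {s..t} - N" for \<tau>
      using f[OF that] rep(1)[OF that] by (simp add: y_def)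
    show "(\<lambda>\<tau>. \<Sum>i<k. (u i \<tau>)\<^sup>2) integrable_on {s..t}"
      using usq by (intro integrable_sum) auto
  qed (use N rep(2) in auto)
qed

end

section \<open>Energy as an integral over the whole interval\<close>

text \<open>Without integrability \<open>integral\<close> would return the default 0 and energies
  could not be compared. Integrability is local, and a short piece of the curve lies in one framed
  chart.\<close>

lemma energy_density_integrable:
  assumes sR: "subriemannian_structure A k D g" and \<eta>: "ACB_tangent A D a b \<eta>"
  shows "(\<lambda>t. g (\<eta> t) (velocity A \<eta> t) (velocity A \<eta> t)) integrable_on {a..b}"
  unfolding box_real(2)[symmetric]
proof (rule integrable_on_little_subintervals, intro ballI)
  fix x assume "x \<in> cbox a b"
  then have x: "x \<in> {a..b}" by simp
  have A: "smooth_atlas A" using sR by (simp add: subriemannian_structure_def)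
  then obtain c where cA: "c \<in> A" "\<eta> x \<in> chdom c" unfolding smooth_atlas_def by blast
  obtain V X where V: "orthonormal_frame_on A k D g V X" "\<eta> x \<in> V"
    using orthonormal_frame_exists[OF sR] by blast
  interpret framed_chart A k D g V X c
    using sR V cA by unfold_locales
  have "continuous_on {a..b} \<eta>" using \<eta> by (simp add: ACB_tangent_def ACB_def)
  then obtain B where B: "open B" "B \<inter> {a..b} = \<eta> -` (chdom c \<inter> V) \<inter> {a..b}"
    using open_dom unfolding continuous_on_open_invariant by blast
  have "x \<in> B \<inter> {a..b}" unfolding B(2) using x cA(2) V(2) by simp
  then have "x \<in> B" by simp
  then obtain d where d: "d > 0" "ball x d \<subseteq> B" using B(1) openE by blast
  have "(\<lambda>t. g (\<eta> t) (velocity A \<eta> t) (velocity A \<eta> t)) integrable_on cbox u v"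
    if uv: "x \<in> cbox u v" "cbox u v \<subseteq> ball x d" "cbox u v \<subseteq> cbox a b" for u v
  proof -
    have sub: "{u..v} \<subseteq> {a..b}" "u \<le> v" using uv by auto
    have "{u..v} \<subseteq> B \<inter> {a..b}" using uv d(2) by auto
    then have im: "\<eta> ` {u..v} \<subseteq> chdom c \<inter> V" unfolding B(2) by blast
    show ?thesis unfolding box_real(2)
      by (rule tangent_curve_representation[OF ACB_tangent_subinterval[OF \<eta> sub(1)] sub(2) im])
        (rule integrable_spike)
  qed
  then show "\<exists>d>0. \<forall>u v. x \<in> cbox u v \<and> cbox u v \<subseteq> ball x d \<and> cbox u v \<subseteq> cbox a b \<longrightarrow>
      (\<lambda>t. g (\<eta> t) (velocity A \<eta> t) (velocity A \<eta> t)) integrable_on cbox u v"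
    using d(1) by blast
qed

text \<open>The density is known to be non-negative only where the velocity lies in
  \<open>D\<close>, hence the modification on a null set.\<close>

lemma energy_subinterval_le:
  assumes sR: "subriemannian_structure A k D g" and \<eta>: "ACB_tangent A D a b \<eta>"
    and \<tau>: "a \<le> \<tau>" "\<tau> \<le> b"
  shows "energy A g a \<tau> \<eta> \<le> energy A g a b \<eta>"
proof -
  let ?e = "\<lambda>t. g (\<eta> t) (velocity A \<eta> t) (velocity A \<eta> t)"
  have int: "?e integrable_on {a..b}" by (rule energy_density_integrable[OF sR \<eta>])
  have "AE t in lebesgue_on {a..b}. velocity A \<eta> t \<in> D (\<eta> t)" using \<eta> by (simp add: ACB_tangent_def)
  then obtain N where N: "negligible N" "\<And>t. t \<in> {a..b} - N \<Longrightarrow> velocity A \<eta> t \<in> D (\<eta> t)"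
    unfolding AE_lebesgue_on_Icc by blast
  have nn: "0 \<le> ?e t" if "t \<in> {a..b} - N" for t
  proof -
    have D: "subspace (D (\<eta> t))" and ip: "inner_product_on (D (\<eta> t)) (g (\<eta> t))"
      using sR by (auto simp: subriemannian_structure_def smooth_distribution_def smooth_metric_on_distribution_def)
    show ?thesis
      using ip_pos[OF D ip N(2)[OF that]] ip_zero[OF D ip N(2)[OF that]] by (cases "velocity A \<eta> t = 0") auto
  qed
  have "0 \<le> integral {\<tau>..b} (\<lambda>t. if t \<in> N then 0 else ?e t)"
  proof (rule integral_nonneg)
    have "?e integrable_on {\<tau>..b}" using int \<tau> by (auto intro: integrable_subinterval_real)
    then show "(\<lambda>t. if t \<in> N then 0 else ?e t) integrable_on {\<tau>..b}"
      by (rule integrable_spike[OF _ N(1)]) simp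
  qed (use nn \<tau> in auto)
  also have "\<dots> = integral {\<tau>..b} ?e" by (rule integral_spike[OF N(1)]) simp
  finally have "integral {a..\<tau>} ?e \<le> integral {a..b} ?e"
    using Henstock_Kurzweil_Integration.integral_combine[OF \<tau> int] by linarith
  then show ?thesis by (simp add: energy_def)
qed

section \<open>Local minimality\<close>

context framed_chart
begin

lemma energy_extremal:
  assumes \<gamma>: "ACB_tangent A D a b \<gamma>" and ab: "a \<le> b" and im: "\<gamma> ` {a..b} \<subseteq> chdom c \<inter> V"
    and dx: "\<And>t. t \<in> {a..b} \<Longrightarrow> (chmap c \<circ> \<gamma> has_vector_derivative (\<Sum>i<k. h i t *\<^sub>R W i (chmap c (\<gamma> t)))) (at t within {a..b})"
  shows "energy A g a b \<gamma> = integral {a..b} (\<lambda>t. \<Sum>i<k. (h i t)\<^sup>2) / 2"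
proof -
  have "AE t in lebesgue_on {a..b}. velocity A \<gamma> t \<in> D (\<gamma> t)" using \<gamma> by (simp add: ACB_tangent_def)
  then obtain N where N: "negligible N" "\<forall>t\<in>{a..b} - N. velocity A \<gamma> t \<in> D (\<gamma> t)"
    unfolding AE_lebesgue_on_Icc by blast
  have "integral {a..b} (\<lambda>t. \<Sum>i<k. (h i t)\<^sup>2) = integral {a..b} (\<lambda>t. g (\<gamma> t) (velocity A \<gamma> t) (velocity A \<gamma> t))"
  proof (rule integral_spike)
    \<comment> \<open>Away from the end-points the two-sided derivative in \<open>velocity\<close>
      is the derivative given by \<open>dx\<close>.\<close>
    show "negligible (N \<union> {a, b})" using N(1) by simp
    fix t assume t: "t \<in> {a..b} - (N \<union> {a, b})"
    have "at t within {a..b} = at t" using t by (intro at_within_Icc_at) auto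
    then have "vector_derivative (chmap c \<circ> \<gamma>) (at t) = (\<Sum>i<k. h i t *\<^sub>R W i (chmap c (\<gamma> t)))"
      using dx[of t] t by (simp add: vector_derivative_at)
    moreover have "\<gamma> t \<in> chdom c \<inter> V" using im t by blast
    ultimately show "g (\<gamma> t) (velocity A \<gamma> t) (velocity A \<gamma> t) = (\<Sum>i<k. (h i t)\<^sup>2)"
      using c N(2) t by (intro frame_norm_coords) (auto simp: velocity_def)
  qed
  then show ?thesis by (simp add: energy_def)
qed

text \<open>A curve leaving a coordinate ball has traversed it before its first exit time, which takes energy.\<close>
lemma energy_lower_bound_of_exit:
  assumes \<eta>: "ACB_tangent A D a b \<eta>" and ab: "a \<le> b" and r: "r > 0" and K: "cball x0 (2 * r) \<subseteq> U"
    and W: "\<And>i z. i < k \<Longrightarrow> z \<in> cball x0 (2 * r) \<Longrightarrow> norm (W i z) \<le> L" and L: "L \<ge> 0"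
    and start: "\<eta> a \<in> chdom c \<inter> V" "chmap c (\<eta> a) \<in> ball x0 r"
    and exit: "t0 \<in> {a..b}" "\<not> (\<eta> t0 \<in> chdom c \<inter> V \<and> chmap c (\<eta> t0) \<in> ball x0 (2 * r))"
  shows "r \<le> L / 2 * (real k * (b - a) + 2 * energy A g a b \<eta>)"
proof -
  define G where "G = {q \<in> chdom c \<inter> V. chmap c q \<in> ball x0 (2 * r)}"
  \<comment> \<open>The image of a compact ball under \<open>chinv c\<close>, hence closed in the
    Hausdorff space \<open>'q\<close>. By closedness the curve is still in \<open>K'\<close>, and so
    in the chart, at the first exit time from the open set \<open>G\<close>.\<close>
  define K' where "K' = {q \<in> chdom c \<inter> V. chmap c q \<in> cball x0 (2 * r)}"
  have cont: "continuous_on {a..b} \<eta>" using \<eta> by (simp add: ACB_tangent_def ACB_def)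
  have "G = (chdom c \<inter> V) \<inter> chmap c -` ball x0 (2 * r)" by (auto simp: G_def)
  then have "open G" using continuous_open_preimage[OF continuous_chmap open_dom open_ball] by simp
  have "K' = chinv c ` cball x0 (2 * r)"
  proof
    show "K' \<subseteq> chinv c ` cball x0 (2 * r)"
      using chinv_chmap[OF chart] unfolding K'_def by (force simp: image_iff)
    show "chinv c ` cball x0 (2 * r) \<subseteq> K'" using U_chinv K unfolding K'_def by fastforce
  qed
  then have "compact K'"
    using continuous_on_subset[OF continuous_chinv K] by (simp add: compact_continuous_image)
  then have "closed K'" by (rule compact_imp_closed)
  define B where "B = {a..b} \<inter> \<eta> -` (- G)"
  have "closed B"
    unfolding B_def using \<open>open G\<close> by (intro continuous_closed_preimage[OF cont]) auto
  moreover have "B \<noteq> {}" using exit by (auto simp: B_def G_def)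
  moreover have "bdd_below B" by (rule bdd_belowI[of _ a]) (simp add: B_def)
  ultimately have Inf: "Inf B \<in> B" by (intro closed_contains_Inf)
  define \<tau> where "\<tau> = Inf B"
  have \<tau>: "a \<le> \<tau>" "\<tau> \<le> b" "\<eta> \<tau> \<notin> G" using Inf by (auto simp: B_def \<tau>_def)
  have "ball x0 r \<subseteq> ball x0 (2 * r)" using r by (intro subset_ball) simp
  then have "\<eta> a \<in> G" using start by (auto simp: G_def)
  then have "a < \<tau>" using \<tau> by (metis order_le_less)
  have before: "\<eta> s \<in> G" if "s \<in> {a..<\<tau>}" for s
    using cInf_lower[of s B] \<open>bdd_below B\<close> that \<tau> by (force simp: B_def \<tau>_def)
  have GK: "G \<subseteq> K'" by (auto simp: G_def K'_def)
  have "closed ({a..\<tau>} \<inter> \<eta> -` K')"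
    using cont \<tau> \<open>closed K'\<close> by (intro continuous_closed_preimage) (auto intro: continuous_on_subset)
  moreover have "{a..<\<tau>} \<subseteq> {a..\<tau>} \<inter> \<eta> -` K'"
    using subsetD[OF GK before] by auto
  ultimately have "closure {a..<\<tau>} \<subseteq> {a..\<tau>} \<inter> \<eta> -` K'" by (intro closure_minimal)
  then have inK: "\<eta> s \<in> K'" if "s \<in> {a..\<tau>}" for s
    using that \<open>a < \<tau>\<close> by auto
  have im: "\<eta> ` {a..\<tau>} \<subseteq> chdom c \<inter> V" using inK by (auto simp: K'_def)
  have sub: "{a..\<tau>} \<subseteq> {a..b}" using \<tau> by auto
  have \<eta>': "ACB_tangent A D a \<tau> \<eta>" by (rule ACB_tangent_subinterval[OF \<eta> sub])
  define y where "y = chmap c \<circ> \<eta>"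
  have yK: "y s \<in> cball x0 (2 * r)" if "s \<in> {a..\<tau>}" for s using inK[OF that] by (simp add: K'_def y_def)
  \<comment> \<open>In \<open>K'\<close> but no longer in \<open>G\<close>: the curve has reached
    the sphere of radius 2 r, having started within distance r of the centre.\<close>
  have "2 * r \<le> dist x0 (y \<tau>)" using \<tau>(3) inK[of \<tau>] \<tau>(1) by (auto simp: G_def K'_def y_def)
  moreover have "dist x0 (y a) < r" using start(2) by (simp add: y_def)
  ultimately have dist: "r \<le> norm (y \<tau> - y a)"
    using dist_triangle[of x0 "y \<tau>" "y a"] by (simp add: dist_norm norm_minus_commute)
  from \<eta>' \<tau>(1) im show ?thesis
  proof (rule tangent_curve_representation)
    fix u N C
    assume N: "negligible N" and lip: "C-lipschitz_on {a..\<tau>} (chmap c \<circ> \<eta>)"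
      and der: "\<And>s. s \<in> {a..\<tau>} - N \<Longrightarrow>
       (chmap c \<circ> \<eta> has_vector_derivative (\<Sum>i<k. u i s *\<^sub>R W i (chmap c (\<eta> s)))) (at s within {a..\<tau>})"
      and gu: "\<And>s. s \<in> {a..\<tau>} - N \<Longrightarrow> g (\<eta> s) (velocity A \<eta> s) (velocity A \<eta> s) = (\<Sum>i<k. (u i s)\<^sup>2)"
      and ui: "(\<lambda>s. \<Sum>i<k. (u i s)\<^sup>2) integrable_on {a..\<tau>}"
    define f where "f s = (if s \<in> N then 0 else \<Sum>i<k. u i s *\<^sub>R W i (y s))" for s
    have f: "(f has_integral (y \<tau> - y a)) {a..\<tau>}"
    proof (rule abs_cont_on_has_integral[OF \<tau>(1) _ N])
      show "abs_cont_on a \<tau> y" unfolding y_def by (rule lipschitz_imp_abs_cont_on[OF lip])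
      show "(y has_vector_derivative f s) (at s within {a..\<tau>})" if "s \<in> {a..\<tau>} - N" for s
        using der[OF that] that unfolding f_def y_def by (simp add: comp_def)
    qed (simp add: f_def)
    \<comment> \<open>A bound for the coordinate speed that is affine in the energy density,
      obtained from |u| \<le> (1 + u^2)/2.\<close>
    define R where "R s = L / 2 * (real k + (\<Sum>i<k. (u i s)\<^sup>2))" for s
    have Rint: "(R has_integral L / 2 * (real k * (\<tau> - a) + integral {a..\<tau>} (\<lambda>s. \<Sum>i<k. (u i s)\<^sup>2))) {a..\<tau>}"
      unfolding R_def using has_integral_const_real[of "real k" a \<tau>] ui \<tau>(1)
      by (intro has_integral_mult_right has_integral_add) (auto simp: has_integral_integral mult.commute)
    have "norm (integral {a..\<tau>} f) \<le> integral {a..\<tau>} R"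
    proof (rule integral_norm_bound_integral)
      show "f integrable_on {a..\<tau>}" "R integrable_on {a..\<tau>}" using f Rint by auto
      fix s assume s: "s \<in> {a..\<tau>}"
      have R0: "0 \<le> R s" using L by (auto simp: R_def intro!: mult_nonneg_nonneg add_nonneg_nonneg sum_nonneg)
      have "norm (\<Sum>i<k. u i s *\<^sub>R W i (y s)) \<le> (\<Sum>i<k. L / 2 * (1 + (u i s)\<^sup>2))"
      proof (rule sum_norm_le)
        fix i assume "i \<in> {..<k}"
        then have "norm (u i s *\<^sub>R W i (y s)) \<le> \<bar>u i s\<bar> * L"
          using W[of i "y s"] yK[OF s] by (simp add: mult_left_mono)
        also have "\<bar>u i s\<bar> \<le> (1 + (u i s)\<^sup>2) / 2"
          using sum_squares_bound[of 1 "\<bar>u i s\<bar>"] by simp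
        finally show "norm (u i s *\<^sub>R W i (y s)) \<le> L / 2 * (1 + (u i s)\<^sup>2)"
          using L by (simp add: mult_right_mono mult.commute)
      qed
      also have "\<dots> = R s" unfolding R_def sum_distrib_left[symmetric] by (simp add: sum.distrib)
      finally show "norm (f s) \<le> R s" using R0 by (simp add: f_def)
    qed
    also have "integral {a..\<tau>} f = y \<tau> - y a" using f by (rule integral_unique)
    also have "integral {a..\<tau>} R = L / 2 * (real k * (\<tau> - a) + integral {a..\<tau>} (\<lambda>s. \<Sum>i<k. (u i s)\<^sup>2))"
      using Rint by (rule integral_unique)
    also have "integral {a..\<tau>} (\<lambda>s. \<Sum>i<k. (u i s)\<^sup>2) = 2 * energy A g a \<tau> \<eta>"
      unfolding energy_def by (simp, rule integral_spike[OF N], rule gu)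
    also have "L / 2 * (real k * (\<tau> - a) + 2 * energy A g a \<tau> \<eta>) \<le> L / 2 * (real k * (b - a) + 2 * energy A g a b \<eta>)"
      using energy_subinterval_le[OF sR \<eta> \<tau>(1,2)] \<tau>(2) L by (intro mult_left_mono add_mono) auto
    finally show ?thesis using dist by linarith
  qed
qed

end

lemma continuous_at_open_preimage:
  fixes f :: "'a::metric_space \<Rightarrow> 'b::topological_space"
  assumes "continuous_on S f" "open G" "t0 \<in> S" "f t0 \<in> G"
  obtains d where "d > 0" "\<And>t. t \<in> S \<Longrightarrow> dist t t0 < d \<Longrightarrow> f t \<in> G"
proof -
  have "\<forall>\<^sub>F t in at t0 within S. f t \<in> G"
    using assms unfolding continuous_on_def by (metis topological_tendstoD)
  then obtain d where "d > 0" "\<And>t. t \<in> S \<Longrightarrow> t \<noteq> t0 \<Longrightarrow> dist t t0 < d \<Longrightarrow> f t \<in> G"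
    unfolding eventually_at by blast
  then show ?thesis using that assms(4) by metis
qed

context framed_chart
begin

lemma local_minimality:
  assumes \<gamma>: "ACB_tangent A D 0 T \<gamma>"
    and H: "hamiltonian_integral_curve A (sR_hamiltonian A k D g) 0 T \<gamma> p"
    and t0: "t0 \<in> {0..T}" "\<gamma> t0 \<in> chdom c \<inter> V"
  shows "\<exists>\<epsilon>>0. \<forall>a b \<eta>. a \<le> b \<and> {a..b} \<subseteq> {0..T} \<inter> ball t0 \<epsilon> \<and>
      ACB_tangent A D a b \<eta> \<and> \<eta> a = \<gamma> a \<and> \<eta> b = \<gamma> b \<and> energy A g a b \<eta> \<le> energy A g a b \<gamma> \<longrightarrow>
      energy A g a b \<gamma> \<le> energy A g a b \<eta> \<and> (\<forall>t\<in>{a..b}. \<eta> t = \<gamma> t)"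
proof -
  define x where "x = chmap c \<circ> \<gamma>"
  define \<xi> where "\<xi> s = covec_coords A c (\<gamma> s) (p s)" for s
  define x0 where "x0 = x t0"
  have "x0 \<in> U" using t0(2) chmap_in_U by (simp add: x0_def x_def)
  then obtain r' where "r' > 0" "cball x0 r' \<subseteq> U" using open_U open_contains_cball by blast
  \<comment> \<open>The extremal will be kept in the ball of radius r and the competitors in the one
    of radius 2 r, so that leaving the latter requires a displacement of at least r.\<close>
  then obtain r where r: "r > 0" and K: "cball x0 (2 * r) \<subseteq> U" by (intro that[of "r' / 2"]) auto
  obtain L where L: "L \<ge> 1" and W: "\<And>i z. i < k \<Longrightarrow> z \<in> cball x0 (2 * r) \<Longrightarrow> norm (W i z) \<le> L"
    "\<And>i z w. i < k \<Longrightarrow> z \<in> cball x0 (2 * r) \<Longrightarrow> w \<in> cball x0 (2 * r) \<Longrightarrow> norm (W i w - W i z) \<le> L * norm (w - z)"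
    "\<And>i z w. i < k \<Longrightarrow> z \<in> cball x0 (2 * r) \<Longrightarrow> w \<in> cball x0 (2 * r) \<Longrightarrow>
      norm (W i w - W i z - frechet_derivative (W i) (at z) (w - z)) \<le> L * (norm (w - z))\<^sup>2"
    "\<And>i z v. i < k \<Longrightarrow> z \<in> cball x0 (2 * r) \<Longrightarrow> norm (frechet_derivative (W i) (at z) v) \<le> L * norm v"
    by (rule frame_bounds[OF compact_cball convex_cball K]; rule that)
  define G where "G = {q \<in> chdom c \<inter> V. chmap c q \<in> ball x0 r}"
  have "G = (chdom c \<inter> V) \<inter> chmap c -` ball x0 r" by (auto simp: G_def)
  then have "open G" using continuous_open_preimage[OF continuous_chmap open_dom open_ball] by simp
  have cont: "continuous_on {0..T} \<gamma>" using \<gamma> by (simp add: ACB_tangent_def ACB_def)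
  have "\<gamma> t0 \<in> G" using t0(2) r by (simp add: G_def x0_def x_def)
  obtain d1 where d1: "d1 > 0" "\<And>t. t \<in> {0..T} \<Longrightarrow> dist t t0 < d1 \<Longrightarrow> \<gamma> t \<in> G"
    by (rule continuous_at_open_preimage[OF cont \<open>open G\<close> t0(1) \<open>\<gamma> t0 \<in> G\<close>]; rule that)
  define M where "M = norm (\<xi> t0) + 1"
  have M: "M > 0" by (simp add: M_def add_nonneg_pos)
  obtain d2 where d2: "d2 > 0" "\<And>t. t \<in> {0..T} \<Longrightarrow> dist t t0 < d2 \<Longrightarrow> norm (\<xi> t) \<le> M"
  proof -
    obtain \<xi>' where "(\<xi> has_vector_derivative \<xi>') (at t0 within {0..T})"
      using hamilton_equations[OF H t0] unfolding \<xi>_def by blast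
    then have "(\<xi> \<longlongrightarrow> \<xi> t0) (at t0 within {0..T})"
      using has_vector_derivative_continuous by (auto simp: continuous_within)
    then have "\<forall>\<^sub>F t in at t0 within {0..T}. dist (\<xi> t) (\<xi> t0) < 1" by (rule tendstoD) simp
    then obtain d where d: "d > 0" "\<And>t. t \<in> {0..T} \<Longrightarrow> t \<noteq> t0 \<Longrightarrow> dist t t0 < d \<Longrightarrow> dist (\<xi> t) (\<xi> t0) < 1"
      unfolding eventually_at by blast
    show ?thesis
    proof (rule that[OF d(1)])
      fix t assume t: "t \<in> {0..T}" "dist t t0 < d"
      have "dist (\<xi> t) (\<xi> t0) < 1" using d(2)[OF t(1) _ t(2)] by (cases "t = t0") auto
      then show "norm (\<xi> t) \<le> M"
        using norm_triangle_ineq2[of "\<xi> t" "\<xi> t0"] unfolding M_def dist_norm by linarith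
    qed
  qed
  \<comment> \<open>The constant \<lambda> of \<open>energy_gap\<close>.\<close>
  define P where "P = 4 * real k * (L * (1 + M))\<^sup>2 + 2"
  \<comment> \<open>An escaping competitor would force r \<le> (Q - 1)(b - a): the frame bound L/2
    times k plus k (M L)^2, the latter bounding the doubled energy of \<gamma> per unit of time. The
    summand 1 makes \<open>Q\<close> positive and the contradiction strict.\<close>
  define Q where "Q = L / 2 * (real k * (1 + (M * L)\<^sup>2)) + 1"
  have P: "P > 0" by (simp add: P_def add_nonneg_pos)
  have Q: "Q > 0" using L by (simp add: Q_def add_nonneg_pos)
  \<comment> \<open>The last two entries carry a factor 1/2 because an interval inside
    \<open>ball t0 \<epsilon>\<close> can have length up to 2 \<epsilon>.\<close>
  define \<epsilon> where "\<epsilon> = Min {d1, d2, 1 / (2 * P), r / (2 * Q)}"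
  have \<epsilon>: "\<epsilon> > 0" "\<epsilon> \<le> d1" "\<epsilon> \<le> d2" "\<epsilon> \<le> 1 / (2 * P)" "\<epsilon> \<le> r / (2 * Q)"
    using d1 d2 P Q r by (auto simp: \<epsilon>_def)
  show ?thesis
  proof (rule exI[of _ \<epsilon>], rule conjI[OF \<epsilon>(1)], intro allI impI, goal_cases)
    case (1 a b \<eta>)
    then have ab: "a \<le> b" and sub: "{a..b} \<subseteq> {0..T} \<inter> ball t0 \<epsilon>" and \<eta>: "ACB_tangent A D a b \<eta>"
      and ends: "\<eta> a = \<gamma> a" "\<eta> b = \<gamma> b" and le: "energy A g a b \<eta> \<le> energy A g a b \<gamma>" by auto
    have abI: "a \<in> {a..b}" "b \<in> {a..b}" using ab by auto
    have near: "t \<in> {0..T}" "dist t t0 < \<epsilon>" if "t \<in> {a..b}" for t using sub that by (auto simp: dist_commute)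
    have len: "b - a \<le> 2 * \<epsilon>" using near(2)[OF abI(1)] near(2)[OF abI(2)] by (simp add: dist_real_def)
    have lenP: "(b - a) * P \<le> 1"
    proof -
      have "(b - a) * P \<le> 2 * (1 / (2 * P)) * P" using len \<epsilon>(4) P by (intro mult_right_mono) auto
      then show ?thesis using P by simp
    qed
    have \<gamma>G: "\<gamma> t \<in> G" if "t \<in> {a..b}" for t using d1(2)[of t] near[OF that] \<epsilon>(2) by simp
    have xB: "x t \<in> cball x0 (2 * r)" if "t \<in> {a..b}" for t using \<gamma>G[OF that] r by (simp add: G_def x_def)
    have \<xi>M: "norm (\<xi> t) \<le> M" if "t \<in> {a..b}" for t using d2(2)[of t] near[OF that] \<epsilon>(3) by simp
    have sub0: "{a..b} \<subseteq> {0..T}" using sub by auto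
    have ham: "\<exists>\<xi>'. (x has_vector_derivative (\<Sum>i<k. (\<xi> t \<bullet> W i (x t)) *\<^sub>R W i (x t))) (at t within {a..b}) \<and>
        (\<xi> has_vector_derivative \<xi>') (at t within {a..b}) \<and>
        (\<forall>v. \<xi>' \<bullet> v = - (\<Sum>i<k. (\<xi> t \<bullet> W i (x t)) * (\<xi> t \<bullet> frechet_derivative (W i) (at (x t)) v)))"
      if t: "t \<in> {a..b}" for t
    proof -
      have "\<gamma> t \<in> chdom c \<inter> V" using \<gamma>G[OF t] by (simp add: G_def)
      from H near(1)[OF t] this show ?thesis
      proof (rule hamilton_equations, goal_cases)
        case (1 \<xi>')
        then show ?case
          using has_vector_derivative_within_subset[OF _ sub0] unfolding x_def \<xi>_def by blast
      qed
    qed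
    \<comment> \<open>\<open>hamilton_equations\<close> yields a derivative for each time
      separately; a choice collects them into one function.\<close>
    obtain \<xi>' where ham': "\<forall>t\<in>{a..b}. (x has_vector_derivative (\<Sum>i<k. (\<xi> t \<bullet> W i (x t)) *\<^sub>R W i (x t))) (at t within {a..b}) \<and>
        (\<xi> has_vector_derivative \<xi>' t) (at t within {a..b}) \<and>
        (\<forall>v. \<xi>' t \<bullet> v = - (\<Sum>i<k. (\<xi> t \<bullet> W i (x t)) * (\<xi> t \<bullet> frechet_derivative (W i) (at (x t)) v)))"
      by (rule exE[OF bchoice[OF ballI[OF ham]]]) (assumption | rule that)+
    have dx: "(x has_vector_derivative (\<Sum>i<k. (\<xi> t \<bullet> W i (x t)) *\<^sub>R W i (x t))) (at t within {a..b})"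
      and d\<xi>: "(\<xi> has_vector_derivative \<xi>' t) (at t within {a..b})"
      and \<xi>': "\<xi>' t \<bullet> v = - (\<Sum>i<k. (\<xi> t \<bullet> W i (x t)) * (\<xi> t \<bullet> frechet_derivative (W i) (at (x t)) v))"
      if "t \<in> {a..b}" for t v
      using ham' that by blast+
    have xcont: "continuous_on {a..b} x"
      unfolding continuous_on_eq_continuous_within using has_vector_derivative_continuous[OF dx] by blast
    have \<xi>cont: "continuous_on {a..b} \<xi>"
      unfolding continuous_on_eq_continuous_within using has_vector_derivative_continuous[OF d\<xi>] by blast
    have Wcont: "continuous_on {a..b} (\<lambda>t. W i (x t))" if "i < k" for i
      using xB K by (intro continuous_on_compose2[OF Ck_on_continuous_on[OF Ck_on_W[OF that, of 0]] xcont]) auto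
    have Wx: "(\<lambda>t. \<Sum>i<k. (\<xi> t \<bullet> W i (x t))\<^sup>2) integrable_on {a..b}"
      using Wcont \<xi>cont by (intro integrable_continuous_real continuous_intros) auto
    have \<gamma>': "ACB_tangent A D a b \<gamma>" by (rule ACB_tangent_subinterval[OF \<gamma> sub0])
    have E\<gamma>: "energy A g a b \<gamma> = integral {a..b} (\<lambda>t. \<Sum>i<k. (\<xi> t \<bullet> W i (x t))\<^sup>2) / 2"
    proof (rule energy_extremal[OF \<gamma>' ab])
      show "\<gamma> ` {a..b} \<subseteq> chdom c \<inter> V" using \<gamma>G unfolding G_def by blast
    qed (use dx in \<open>simp add: x_def\<close>)
    have E\<gamma>_le: "2 * energy A g a b \<gamma> \<le> real k * (M * L)\<^sup>2 * (b - a)"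
    proof -
      have "(\<Sum>i<k. (\<xi> t \<bullet> W i (x t))\<^sup>2) \<le> real k * (M * L)\<^sup>2" if t: "t \<in> {a..b}" for t
      proof -
        have "(\<xi> t \<bullet> W i (x t))\<^sup>2 \<le> (M * L)\<^sup>2" if "i < k" for i
        proof -
          have "norm (\<xi> t) * norm (W i (x t)) \<le> M * L"
            using \<xi>M[OF t] W(1)[OF that xB[OF t]] M by (intro mult_mono) auto
          then have "\<bar>\<xi> t \<bullet> W i (x t)\<bar> \<le> M * L"
            using Cauchy_Schwarz_ineq2[of "\<xi> t" "W i (x t)"] by linarith
          then have "\<bar>\<xi> t \<bullet> W i (x t)\<bar>\<^sup>2 \<le> (M * L)\<^sup>2" by (intro power_mono) auto
          then show ?thesis by simp
        qed
        then show ?thesis using sum_bounded_above[of "{..<k}" "\<lambda>i. (\<xi> t \<bullet> W i (x t))\<^sup>2" "(M * L)\<^sup>2"] by simp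
      qed
      then have "integral {a..b} (\<lambda>t. \<Sum>i<k. (\<xi> t \<bullet> W i (x t))\<^sup>2) \<le> integral {a..b} (\<lambda>t. real k * (M * L)\<^sup>2)"
        using Wx by (intro integral_le) auto
      then show ?thesis using ab by (simp add: E\<gamma> mult_ac)
    qed
    have \<eta>K: "\<eta> t \<in> chdom c \<inter> V \<and> chmap c (\<eta> t) \<in> ball x0 (2 * r)" if t: "t \<in> {a..b}" for t
    proof (rule ccontr)
      assume exit: "\<not> ?thesis"
      have "r \<le> L / 2 * (real k * (b - a) + 2 * energy A g a b \<eta>)"
        using energy_lower_bound_of_exit[OF \<eta> ab r K W(1) _ _ _ t exit] \<gamma>G[OF abI(1)] ends L by (simp add: G_def)
      also have "\<dots> \<le> L / 2 * (real k * (b - a) + real k * (M * L)\<^sup>2 * (b - a))"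
        using le E\<gamma>_le L by (intro mult_left_mono add_left_mono) auto
      also have "\<dots> = (Q - 1) * (b - a)" by (simp add: Q_def field_simps)
      also have "\<dots> \<le> (Q - 1) * (r / Q)"
      proof (rule mult_left_mono)
        show "b - a \<le> r / Q" using len \<epsilon>(5) by simp
        show "0 \<le> Q - 1" using L by (simp add: Q_def)
      qed
      also have "\<dots> < Q * (r / Q)" using r Q by (intro mult_strict_right_mono) auto
      finally show False using Q by simp
    qed
    define y where "y = chmap c \<circ> \<eta>"
    have yB: "y t \<in> cball x0 (2 * r)" if "t \<in> {a..b}" for t using \<eta>K[OF that] by (simp add: y_def)
    have im: "\<eta> ` {a..b} \<subseteq> chdom c \<inter> V" using \<eta>K by blast
    have "energy A g a b \<gamma> + integral {a..b} (\<lambda>t. (norm (y t - x t))\<^sup>2) \<le> energy A g a b \<eta> \<and> continuous_on {a..b} y"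
      using \<eta> ab im
    proof (rule tangent_curve_representation)
      fix u N C
      assume N: "negligible N" and lip: "C-lipschitz_on {a..b} (chmap c \<circ> \<eta>)"
        and der: "\<And>s. s \<in> {a..b} - N \<Longrightarrow>
         (chmap c \<circ> \<eta> has_vector_derivative (\<Sum>i<k. u i s *\<^sub>R W i (chmap c (\<eta> s)))) (at s within {a..b})"
        and gu: "\<And>s. s \<in> {a..b} - N \<Longrightarrow> g (\<eta> s) (velocity A \<eta> s) (velocity A \<eta> s) = (\<Sum>i<k. (u i s)\<^sup>2)"
        and ui: "(\<lambda>s. \<Sum>i<k. (u i s)\<^sup>2) integrable_on {a..b}"
      have E\<eta>: "energy A g a b \<eta> = integral {a..b} (\<lambda>s. \<Sum>i<k. (u i s)\<^sup>2) / 2"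
        unfolding energy_def by (simp, rule integral_spike[OF N, symmetric], rule gu)
      have ylip: "C-lipschitz_on {a..b} y" using lip by (simp add: y_def)
      have dy: "(y has_vector_derivative (\<Sum>i<k. u i s *\<^sub>R W i (y s))) (at s within {a..b})" if "s \<in> {a..b} - N" for s
        using der[OF that] by (simp add: y_def)
      have "integral {a..b} (\<lambda>t. \<Sum>i<k. (\<xi> t \<bullet> W i (x t))\<^sup>2) / 2 + integral {a..b} (\<lambda>t. (norm (y t - x t))\<^sup>2)
        \<le> integral {a..b} (\<lambda>t. \<Sum>i<k. (u i t)\<^sup>2) / 2"
      proof (rule energy_gap[where B = "cball x0 (2 * r)" and W' = "\<lambda>i z. frechet_derivative (W i) (at z)"
            and L = L and M = M and \<xi>' = \<xi>' and N = N and Cy = C])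
        show "0 \<le> L" using L by simp
        show "(b - a) * (4 * real k * (L * (1 + M))\<^sup>2 + 2) \<le> 1" using lenP by (simp add: P_def)
        show "y a = x a" "y b = x b" using ends by (simp_all add: y_def x_def)
      qed (fact W ab xB \<xi>M dx d\<xi> \<xi>' Wx yB ylip N dy ui)+
      then show ?thesis using E\<gamma> E\<eta> lipschitz_on_continuous_on[OF ylip] by simp
    qed
    then have gap: "energy A g a b \<gamma> + integral {a..b} (\<lambda>t. (norm (y t - x t))\<^sup>2) \<le> energy A g a b \<eta>"
      and ycont: "continuous_on {a..b} y" by auto
    have icont: "continuous_on {a..b} (\<lambda>t. (norm (y t - x t))\<^sup>2)"
      using xcont ycont by (intro continuous_intros)
    have nonneg: "0 \<le> integral {a..b} (\<lambda>t. (norm (y t - x t))\<^sup>2)"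
      by (intro integral_nonneg integrable_continuous_real icont) auto
    show ?case
    proof
      show "energy A g a b \<gamma> \<le> energy A g a b \<eta>" using gap nonneg by linarith
      \<comment> \<open>Equal energies leave no room for the gap, and a continuous non-negative
        function with zero integral vanishes. The case \<open>a = b\<close> is settled separately by
        the common end-points.\<close>
      have "integral {a..b} (\<lambda>t. (norm (y t - x t))\<^sup>2) = 0" using gap nonneg le by linarith
      then have zero: "(norm (y t - x t))\<^sup>2 = 0" if "t \<in> {a..b}" "a < b" for t
        using integral_eq_0_iff[OF icont that(2)] that(1) by simp
      show "\<forall>t\<in>{a..b}. \<eta> t = \<gamma> t"
      proof
        fix t assume t: "t \<in> {a..b}"
        show "\<eta> t = \<gamma> t"
        proof (cases "a < b")
          case True
          then have "chmap c (\<eta> t) = chmap c (\<gamma> t)" using zero[OF t] by (simp add: x_def y_def)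
          moreover have "\<eta> t \<in> chdom c" "\<gamma> t \<in> chdom c" using \<eta>K[OF t] \<gamma>G[OF t] by (auto simp: G_def)
          ultimately show ?thesis using chinv_chmap[OF chart] by metis
        next
          case False
          then have "t = a" using t ab by simp
          then show ?thesis using ends(1) by simp
        qed
      qed
    qed
  qed
qed

end

section \<open>From local to uniform length\<close>

theorem theorem2p2:
  fixes A :: "('q::{t2_space, second_countable_topology}, 'n::finite) chart set"
    and k :: nat
    and D :: "'q \<Rightarrow> ('q, 'n) tvec set"
    and g :: "'q \<Rightarrow> ('q, 'n) tvec \<Rightarrow> ('q, 'n) tvec \<Rightarrow> real"
    and T :: real and \<gamma> :: "real \<Rightarrow> 'q"
  assumes "subriemannian_structure A k D g"
    and "0 \<le> T"
    and "normal_extremal A k D g T \<gamma>"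
  shows "\<exists>\<epsilon>>0. \<forall>a b. a \<le> b \<and> {a..b} \<subseteq> {0..T} \<and> b - a < \<epsilon> \<longrightarrow>
           minimizing_geodesic A D g a b \<gamma> \<and>
           (\<forall>\<eta>. minimizing_geodesic A D g a b \<eta> \<and> \<eta> a = \<gamma> a \<and> \<eta> b = \<gamma> b \<longrightarrow>
              (\<forall>t\<in>{a..b}. \<eta> t = \<gamma> t))"
proof -
  obtain p where \<gamma>: "ACB_tangent A D 0 T \<gamma>"
    and H: "hamiltonian_integral_curve A (sR_hamiltonian A k D g) 0 T \<gamma> p"
    using assms(3) unfolding normal_extremal_def by blast
  define good where "good t \<epsilon> \<longleftrightarrow> \<epsilon> > 0 \<and> (\<forall>a b \<eta>. a \<le> b \<and> {a..b} \<subseteq> {0..T} \<inter> ball t \<epsilon> \<and>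
      ACB_tangent A D a b \<eta> \<and> \<eta> a = \<gamma> a \<and> \<eta> b = \<gamma> b \<and> energy A g a b \<eta> \<le> energy A g a b \<gamma> \<longrightarrow>
      energy A g a b \<gamma> \<le> energy A g a b \<eta> \<and> (\<forall>t\<in>{a..b}. \<eta> t = \<gamma> t))" for t \<epsilon>
  have ex: "\<exists>\<epsilon>. good t \<epsilon>" if t: "t \<in> {0..T}" for t
  proof -
    have "smooth_atlas A" using assms(1) by (simp add: subriemannian_structure_def)
    then obtain c where cA: "c \<in> A" "\<gamma> t \<in> chdom c" unfolding smooth_atlas_def by blast
    obtain V X where V: "orthonormal_frame_on A k D g V X" "\<gamma> t \<in> V"
      using orthonormal_frame_exists[OF assms(1)] by blast
    interpret framed_chart A k D g V X c
      using assms(1) V cA by unfold_locales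
    show ?thesis unfolding good_def using local_minimality[OF \<gamma> H t] cA(2) V(2) by simp
  qed
  define e where "e t = (SOME \<epsilon>. good t \<epsilon>)" for t
  have e: "good t (e t)" if "t \<in> {0..T}" for t unfolding e_def using ex[OF that] by (rule someI_ex)
  have cover: "{0..T} \<subseteq> \<Union>((\<lambda>t. ball t (e t)) ` {0..T})"
  proof
    fix t assume t: "t \<in> {0..T}"
    then have "t \<in> ball t (e t)" using e by (simp add: good_def)
    then show "t \<in> \<Union>((\<lambda>t. ball t (e t)) ` {0..T})" using t by blast
  qed
  \<comment> \<open>A Lebesgue number of the cover: an interval shorter than this lies in the ball
    around its left end-point, hence in one of the covering balls.\<close>
  obtain \<epsilon> where \<epsilon>: "\<epsilon> > 0" "\<And>t. t \<in> {0..T} \<Longrightarrow> \<exists>G \<in> (\<lambda>t. ball t (e t)) ` {0..T}. ball t \<epsilon> \<subseteq> G"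
    by (rule Heine_Borel_lemma[OF compact_Icc cover]) (auto intro: that)
  have main: "energy A g a b \<gamma> \<le> energy A g a b \<eta> \<and> (\<forall>t\<in>{a..b}. \<eta> t = \<gamma> t)"
    if ab: "a \<le> b" "{a..b} \<subseteq> {0..T}" "b - a < \<epsilon>"
      and \<eta>: "ACB_tangent A D a b \<eta>" "\<eta> a = \<gamma> a" "\<eta> b = \<gamma> b" "energy A g a b \<eta> \<le> energy A g a b \<gamma>" for a b \<eta>
  proof -
    have "a \<in> {0..T}" using ab by auto
    then obtain t where t: "t \<in> {0..T}" "ball a \<epsilon> \<subseteq> ball t (e t)" using \<epsilon>(2) by blast
    have "{a..b} \<subseteq> ball a \<epsilon>" using ab by (auto simp: dist_real_def)
    then have "{a..b} \<subseteq> {0..T} \<inter> ball t (e t)" using ab(2) t(2) by blast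
    then show ?thesis using e[OF t(1)] ab(1) \<eta> unfolding good_def by blast
  qed
  show ?thesis
  proof (intro exI[of _ \<epsilon>] conjI allI impI)
    show "\<epsilon> > 0" by (rule \<epsilon>)
    fix a b assume ab: "a \<le> b \<and> {a..b} \<subseteq> {0..T} \<and> b - a < \<epsilon>"
    have \<gamma>': "ACB_tangent A D a b \<gamma>" using ACB_tangent_subinterval[OF \<gamma>] ab by blast
    show "minimizing_geodesic A D g a b \<gamma>"
      unfolding minimizing_geodesic_def
    proof (intro conjI allI impI \<gamma>')
      fix \<eta> assume "ACB_tangent A D a b \<eta> \<and> \<eta> a = \<gamma> a \<and> \<eta> b = \<gamma> b"
      \<comment> \<open>A competitor with more energy than \<gamma> satisfies the inequality
        outright; \<open>main\<close> covers the others.\<close>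
      then show "energy A g a b \<gamma> \<le> energy A g a b \<eta>"
        using main[of a b \<eta>] ab by linarith
    qed
    fix \<eta> assume \<eta>: "minimizing_geodesic A D g a b \<eta> \<and> \<eta> a = \<gamma> a \<and> \<eta> b = \<gamma> b"
    then have "ACB_tangent A D a b \<eta>" "energy A g a b \<eta> \<le> energy A g a b \<gamma>"
      using \<gamma>' unfolding minimizing_geodesic_def by auto
    then show "\<forall>t\<in>{a..b}. \<eta> t = \<gamma> t" using main[of a b \<eta>] ab \<eta> by blast
  qed
qed

end
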